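(* Let $n\geq 1$, $2\leq p<\infty$, $0<\varepsilon<1$ and $k:=[\frac{n}{2}]+1$. Let $a:\mathbb{T}^n\times\mathbb{Z}^n\rightarrow\mathbb{C}$ be a symbol such that, for all $(x,\xi)\in\mathbb{T}^n\times\mathbb{Z}^n$ and all $\alpha,\beta\in\mathbb{N}^n$ with $|\alpha|,|\beta|\leq k$, $$|\Delta_{\xi}^{\alpha}a(x,\xi)|\leq C_\alpha\langle\xi\rangle^{-\frac{n}{2}\varepsilon-(1-\varepsilon)|\alpha|},\qquad |\partial_{x}^{\beta}a(x,\xi)|\leq C_\beta\langle\xi\rangle^{-\frac{n}{2}\varepsilon}.$$ Then $a(x,D):L^p(\mathbb{T}^n)\rightarrow L^r(\mathbb{T}^n)$ is a bounded linear operator for all $r$ with $1<q\leq r\leq p<\infty$, where $\frac{1}{p}+\frac{1}{q}=1$.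
   Context: $\mathbb{T}^n=\mathbb{R}^n/\mathbb{Z}^n$ with normalized Lebesgue measure; $\mathbb{N}=\{0,1,2,\dots\}$; $[\cdot]$ denotes the integer part; $\langle\xi\rangle=(1+|\xi|^2)^{1/2}$. The toroidal Fourier transform is $\widehat{f}(\xi)=\int_{\mathbb{T}^n}e^{-i2\pi\langle x,\xi\rangle}f(x)\,dx$, $\xi\in\mathbb{Z}^n$. For $f:\mathbb{Z}^n\to\mathbb{C}$ and the canonical basis $(e_j)$, $(\Delta_{\xi_j}f)(\xi)=f(\xi+e_j)-f(\xi)$, and $\Delta_\xi^\alpha=\Delta_{\xi_1}^{\alpha_1}\cdots\Delta_{\xi_n}^{\alpha_n}$. The symbol is understood to have the $x$-derivatives appearing in the hypothesis (continuous in $x$). The periodic operator with symbol $a$ is $a(x,D)f(x)=\sum_{\xi\in\mathbb{Z}^n}e^{i2\pi\langle x,\xi\rangle}a(x,\xi)\widehat{f}(\xi)$ for $f\in C^\infty(\mathbb{T}^n)$; boundedness means that it extends to a bounded operator between the stated spaces. *)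

theory Defs
  imports "HOL-Analysis.Analysis"
begin

definition of_lattice :: "int ^ 'n \<Rightarrow> real ^ 'n" where
  "of_lattice \<xi> = (\<chi> j. real_of_int (\<xi> $ j))"

definition jbracket :: "int ^ 'n::finite \<Rightarrow> real" where
  "jbracket \<xi> = sqrt (1 + (norm (of_lattice \<xi>))\<^sup>2)"

text \<open>Functions on the torus are represented by \<open>\<int>\<^sup>n\<close>-periodic functions on \<open>\<real>\<^sup>n\<close>, and
  integrals over the torus are integrals over the closed unit cube, whose faces are null sets.\<close>

definition periodic :: "(real ^ 'n \<Rightarrow> complex) \<Rightarrow> bool" where
  "periodic f \<longleftrightarrow> (\<forall>m x. f (x + of_lattice m) = f x)"

abbreviation torus_measure :: "(real ^ 'n::finite) measure" where
  "torus_measure \<equiv> lebesgue_on (cbox 0 1)"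

definition fourier :: "(real ^ 'n::finite \<Rightarrow> complex) \<Rightarrow> int ^ 'n \<Rightarrow> complex" where
  "fourier f \<xi> =
     (LINT x|torus_measure. exp (- (\<i> * complex_of_real (2 * pi * (x \<bullet> of_lattice \<xi>)))) * f x)"

text \<open>Multi-indices are functions \<open>'n \<Rightarrow> nat\<close>. The index type carries no order, so the products
  of operators defining \<open>\<Delta>\<^sup>\<alpha>\<close> and \<open>\<partial>\<^sup>\<beta>\<close> are taken along an arbitrary enumeration of the
  coordinates. Differences always commute, and so do the partial derivatives of order up to \<open>k\<close>
  of a \<open>C\<^sup>k\<close> function, hence the choice of the enumeration is immaterial.\<close>

definition coords :: "'n::finite list" where
  "coords = (SOME js. distinct js \<and> set js = UNIV)"

definition mi_order :: "('n::finite \<Rightarrow> nat) \<Rightarrow> nat" where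
  "mi_order \<alpha> = (\<Sum>j\<in>UNIV. \<alpha> j)"

definition difference :: "'n \<Rightarrow> (int ^ 'n \<Rightarrow> complex) \<Rightarrow> int ^ 'n \<Rightarrow> complex" where
  "difference j f \<xi> = f (\<xi> + axis j 1) - f \<xi>"

definition differences ::
    "('n::finite \<Rightarrow> nat) \<Rightarrow> (int ^ 'n \<Rightarrow> complex) \<Rightarrow> int ^ 'n \<Rightarrow> complex" where
  "differences \<alpha> f = foldr (\<lambda>j. difference j ^^ \<alpha> j) coords f"

definition partial :: "'n::finite \<Rightarrow> (real ^ 'n \<Rightarrow> complex) \<Rightarrow> real ^ 'n \<Rightarrow> complex" where
  "partial j f x = vector_derivative (\<lambda>t. f (x + t *\<^sub>R axis j 1)) (at 0)"

definition partials ::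
    "('n::finite \<Rightarrow> nat) \<Rightarrow> (real ^ 'n \<Rightarrow> complex) \<Rightarrow> real ^ 'n \<Rightarrow> complex" where
  "partials \<beta> f = foldr (\<lambda>j. partial j ^^ \<beta> j) coords f"

primrec Ck :: "nat \<Rightarrow> (real ^ 'n::finite \<Rightarrow> complex) \<Rightarrow> bool" where
  "Ck 0 f \<longleftrightarrow> continuous_on UNIV f"
| "Ck (Suc k) f \<longleftrightarrow> continuous_on UNIV f \<and>
     (\<forall>j. (\<forall>x. (\<lambda>t. f (x + t *\<^sub>R axis j 1)) differentiable (at 0)) \<and> Ck k (partial j f))"

definition smooth_torus :: "(real ^ 'n::finite \<Rightarrow> complex) set" where
  "smooth_torus = {f. periodic f \<and> (\<forall>k. Ck k f)}"

text \<open>The sum is the (unordered) sum over the lattice; it converges absolutely whenever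
  \<open>a\<close> is bounded and \<open>f\<close> is smooth.\<close>

definition pseudo_diff_op ::
    "(real ^ 'n::finite \<Rightarrow> int ^ 'n \<Rightarrow> complex) \<Rightarrow> (real ^ 'n \<Rightarrow> complex) \<Rightarrow> real ^ 'n \<Rightarrow> complex"
  where
  "pseudo_diff_op a f x =
     (\<Sum>\<^sub>\<infinity>\<xi>\<in>UNIV. exp (\<i> * complex_of_real (2 * pi * (x \<bullet> of_lattice \<xi>))) * a x \<xi> * fourier f \<xi>)"

definition Lp_torus :: "real \<Rightarrow> (real ^ 'n::finite \<Rightarrow> complex) set" where
  "Lp_torus p = {f. periodic f \<and> f \<in> borel_measurable torus_measure \<and>
     integrable torus_measure (\<lambda>x. norm (f x) powr p)}"

definition Lp_norm :: "real \<Rightarrow> (real ^ 'n::finite \<Rightarrow> complex) \<Rightarrow> real" where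
  "Lp_norm p f = (LINT x|torus_measure. norm (f x) powr p) powr (1 / p)"

text \<open>Operators between the Lebesgue spaces act on representatives, and linearity is required
  up to null sets. Together with the norm bound this makes \<open>T\<close> respect almost everywhere
  equality, so that it is a bounded linear operator on the spaces of equivalence classes.\<close>

definition bounded_linear_Lp ::
    "real \<Rightarrow> real \<Rightarrow> ((real ^ 'n::finite \<Rightarrow> complex) \<Rightarrow> real ^ 'n \<Rightarrow> complex) \<Rightarrow> bool" where
  "bounded_linear_Lp p r T \<longleftrightarrow>
     (\<forall>f\<in>Lp_torus p. T f \<in> Lp_torus r) \<and>
     (\<forall>f\<in>Lp_torus p. \<forall>g\<in>Lp_torus p.
        AE x in torus_measure. T (\<lambda>y. f y + g y) x = T f x + T g x) \<and>
     (\<forall>c. \<forall>f\<in>Lp_torus p. AE x in torus_measure. T (\<lambda>y. c * f y) x = c * T f x) \<and>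
     (\<exists>K. \<forall>f\<in>Lp_torus p. Lp_norm r (T f) \<le> K * Lp_norm p f)"

definition extends_to_bounded_Lp ::
    "real \<Rightarrow> real \<Rightarrow> ((real ^ 'n::finite \<Rightarrow> complex) \<Rightarrow> real ^ 'n \<Rightarrow> complex) \<Rightarrow> bool" where
  "extends_to_bounded_Lp p r A \<longleftrightarrow>
     (\<exists>T. bounded_linear_Lp p r T \<and>
        (\<forall>f\<in>smooth_torus. AE x in torus_measure. T f x = A f x))"

end

theory Submission
  imports Defs
begin

text \<open>Since the torus has measure one, it suffices to bound the operator on \<open>L\<^sup>p\<close>. Cut the symbol
  into dyadic pieces supported where \<open>\<langle>\<xi>\<rangle> \<approx> 2\<^sup>j\<close>, with corresponding operators \<open>T\<^sub>j\<close>. The order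
  \<open>-n\<epsilon>/2\<close> is exactly what makes the \<open>T\<^sub>j\<close> uniformly bounded on \<open>L\<^sup>\<infinity>\<close>: this is Cauchy--Schwarz
  on the kernel against the weight \<open>1 + \<Sum>\<^sub>i (2\<^bsup>j(1-\<epsilon>)\<^esup>|e\<^bsup>2\<pi>iz\<^sub>i\<^esup> - 1|)\<^bsup>2k\<^esup>\<close>, whose inverse is integrable because
  \<open>2k > n\<close>. On \<open>L\<^sup>2\<close> there is room to spare: freeze the variable \<open>x\<close> of the symbol on a grid of
  mesh \<open>h = 2\<^bsup>-j\<epsilon>/2\<^esup>\<close>. The frozen operators are Fourier multipliers of norm \<open>2\<^bsup>-jn\<epsilon>/2\<^esup>\<close>, and by the
  Lipschitz bound in \<open>x\<close> the error gains a positive power of \<open>h\<close> in the kernel estimate. Hence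
  \<open>T\<^sub>j\<close> decays geometrically on \<open>L\<^sup>2\<close>, by interpolation also on \<open>L\<^sup>p\<close> for \<open>2 \<le> p < \<infinity>\<close>, and the
  sum over \<open>j\<close> converges. Only pure differences \<open>\<Delta>\<^sub>i\<^sup>l\<close> and first order derivatives of the symbol enter.\<close>

subsection \<open>Characters on the torus\<close>

definition chr :: "int ^ 'n::finite \<Rightarrow> real ^ 'n \<Rightarrow> complex" where
  "chr \<xi> x = exp (\<i> * complex_of_real (2 * pi * (x \<bullet> of_lattice \<xi>)))"

lemma of_lattice_add: "of_lattice (x + y) = of_lattice x + of_lattice y"
  and of_lattice_0 [simp]: "of_lattice 0 = 0"
  and of_lattice_axis: "of_lattice (axis i 1) = axis i 1"
  and of_lattice_minus: "of_lattice (- x) = - of_lattice x"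
  by (auto simp: of_lattice_def vec_eq_iff axis_def)

lemma norm_chr [simp]: "norm (chr \<xi> x) = 1"
  by (simp add: chr_def norm_exp_i_times)

lemma cnj_chr: "cnj (chr \<xi> x) = exp (- (\<i> * complex_of_real (2 * pi * (x \<bullet> of_lattice \<xi>))))"
  by (simp add: chr_def exp_cnj)

lemma chr_add: "chr \<xi> (x + y) = chr \<xi> x * chr \<xi> y"
  by (simp add: chr_def inner_add_left distrib_left exp_add)

lemma chr_add_left: "chr (\<xi> + \<eta>) x = chr \<xi> x * chr \<eta> x"
  by (simp add: chr_def of_lattice_add inner_add_right distrib_left exp_add)

lemma chr_minus: "chr \<xi> (- x) = cnj (chr \<xi> x)"
  by (simp add: cnj_chr) (simp add: chr_def)

lemma chr_minus_left: "chr (- \<xi>) x = cnj (chr \<xi> x)"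
  by (simp add: cnj_chr) (simp add: chr_def of_lattice_minus)

lemma chr_0 [simp]: "chr 0 x = 1"
  by (simp add: chr_def)

lemma continuous_on_chr [continuous_intros]:
  assumes "continuous_on A f" shows "continuous_on A (\<lambda>x. chr \<xi> (f x))"
  unfolding chr_def by (intro continuous_intros assms)

lemma chr_lattice [simp]: "chr \<xi> (of_lattice m) = 1"
proof -
  define z where "z = (\<Sum>i\<in>UNIV. m $ i * \<xi> $ i)"
  have "of_lattice m \<bullet> of_lattice \<xi> = real_of_int z"
    by (simp add: inner_vec_def of_lattice_def z_def)
  then show ?thesis
    unfolding chr_def using exp_integer_2pi[of "real_of_int z"] by (simp add: mult_ac)
qed

lemma chr_periodic: "periodic (chr \<xi>)"
  by (simp add: periodic_def chr_add)

lemma fourier_chr: "fourier f \<xi> = (LINT x|torus_measure. cnj (chr \<xi> x) * f x)"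
  by (simp add: fourier_def cnj_chr)

lemma emeasure_torus: "emeasure torus_measure (cbox 0 (1::real^'n::finite)) = 1"
proof -
  have "emeasure lborel (cbox 0 (1::real^'n)) = 1"
    by (subst emeasure_lborel_cbox)
      (auto simp: Basis_vec_def inner_axis intro!: prod.neutral cong: prod.cong_simp)
  then show ?thesis
    by (simp add: emeasure_restrict_space)
qed

lemma space_torus [simp]: "space torus_measure = cbox 0 1"
  by simp

lemma finite_measure_torus: "finite_measure (torus_measure :: (real^'n::finite) measure)"
  by (rule finite_measureI) (simp add: emeasure_torus)

lemma integrable_torus_continuous:
  fixes g :: "real^'n::finite \<Rightarrow> complex"
  shows "continuous_on UNIV g \<Longrightarrow> integrable torus_measure g"
  by (intro continuous_imp_integrable) (auto intro: continuous_on_subset)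

lemma measurable_torus_continuous:
  fixes g :: "real^'n::finite \<Rightarrow> 'b::euclidean_space"
  assumes "continuous_on UNIV g" shows "g \<in> borel_measurable torus_measure"
proof -
  have "g \<in> borel_measurable borel" using assms by (rule borel_measurable_continuous_onI)
  then have "g \<in> borel_measurable lborel" by simp
  then have "g \<in> borel_measurable lebesgue" by (rule measurable_completion)
  then show ?thesis by (rule measurable_restrict_space1)
qed

text \<open>The box elongated by h in direction i is cut at height 1 and at height h. Each cut
  leaves a unit cube and a slab of thickness h; the two slabs differ by a period, so the integrals
  over the two cubes agree.\<close>

lemma torus_integral_shift:
  fixes g :: "real^'n::finite \<Rightarrow> complex"
  assumes g: "continuous_on UNIV g" and per: "periodic g" and h: "0 \<le> h" "h \<le> 1"
  shows "(LINT x|torus_measure. g (x + h *\<^sub>R axis i 1)) = (LINT x|torus_measure. g x)"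
proof -
  define e where "e = (axis i 1 :: real^'n)"
  have eB: "e \<in> Basis" by (auto simp: e_def Basis_vec_def)
  have int: "g integrable_on cbox a b" for a b
    by (rule integrable_continuous) (auto intro: continuous_on_subset[OF g])
  have gs: "continuous_on UNIV (\<lambda>x. g (x + h *\<^sub>R e))"
    by (intro continuous_on_compose2[OF g] continuous_intros) auto
  have split: "integral (cbox 0 (1 + h *\<^sub>R e)) g =
      integral (cbox 0 (1 + h *\<^sub>R e) \<inter> {x. x \<bullet> e \<le> c}) g +
      integral (cbox 0 (1 + h *\<^sub>R e) \<inter> {x. x \<bullet> e \<ge> c}) g" for c
    using integral_split[OF int eB] by blast
  have xe: "x \<bullet> e = x $ i" for x by (simp add: e_def inner_axis)
  have e1: "cbox 0 (1 + h *\<^sub>R e) \<inter> {x. x \<bullet> e \<le> 1} = cbox 0 1"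
    unfolding xe interval_split_cart[unfolded interval_cbox_cart] using h
    by (intro arg_cong2[where f = cbox]) (auto simp: vec_eq_iff e_def axis_def)
  have e2: "cbox 0 (1 + h *\<^sub>R e) \<inter> {x. x \<bullet> e \<ge> 1} = cbox (0 + e) (1 + (h - 1) *\<^sub>R e + e)"
    unfolding xe interval_split_cart[unfolded interval_cbox_cart] using h
    by (intro arg_cong2[where f = cbox]) (auto simp: vec_eq_iff e_def axis_def)
  have e3: "cbox 0 (1 + h *\<^sub>R e) \<inter> {x. x \<bullet> e \<ge> h} = cbox (0 + h *\<^sub>R e) (1 + h *\<^sub>R e)"
    unfolding xe interval_split_cart[unfolded interval_cbox_cart] using h
    by (intro arg_cong2[where f = cbox]) (auto simp: vec_eq_iff e_def axis_def)
  have e4: "cbox 0 (1 + h *\<^sub>R e) \<inter> {x. x \<bullet> e \<le> h} = cbox 0 (1 + (h - 1) *\<^sub>R e)"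
    unfolding xe interval_split_cart[unfolded interval_cbox_cart] using h
    by (intro arg_cong2[where f = cbox]) (auto simp: vec_eq_iff e_def axis_def)
  have per1: "g (x + e) = g x" for x
    using per unfolding periodic_def e_def by (metis of_lattice_axis)
  have shift: "integral (cbox (a + c) (b + c)) g = integral (cbox a b) (\<lambda>x. g (x + c))" for a b c
    using integral_shift_cbox[of "a + c" c "b + c" g] by simp
  then have "integral (cbox (0 + e) (1 + (h - 1) *\<^sub>R e + e)) g = integral (cbox 0 (1 + (h - 1) *\<^sub>R e)) (\<lambda>x. g (x + e))" .
  also have "\<dots> = integral (cbox 0 (1 + (h - 1) *\<^sub>R e)) g" by (simp add: per1)
  finally have A: "integral (cbox 0 1) g = integral (cbox (0 + h *\<^sub>R e) (1 + h *\<^sub>R e)) g"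
    using split[of 1] split[of h] unfolding e1 e2 e3 e4 by simp
  have "integral (cbox (0 + h *\<^sub>R e) (1 + h *\<^sub>R e)) g = integral (cbox 0 1) (\<lambda>x. g (x + h *\<^sub>R e))"
    by (rule shift)
  with A show ?thesis
    by (simp add: lebesgue_integral_eq_integral integrable_torus_continuous g gs flip: e_def)
qed

text \<open>In a direction with nonzero frequency m_i, translation by half a wavelength, 1/(2|m_i|)
  <= 1, multiplies the character by -1. Its integral therefore equals its own negative.\<close>

lemma integral_chr:
  fixes m :: "int^'n::finite"
  shows "(LINT x|torus_measure. chr m x) = (if m = 0 then 1 else 0)"
proof (cases "m = 0")
  case True
  then show ?thesis
    using emeasure_torus[where 'n = 'n] by (simp add: measure_def del: emeasure_restrict_space space_restrict_space)
next
  case False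
  then obtain i where i: "m $ i \<noteq> 0" by (auto simp: vec_eq_iff)
  define h where "h = 1 / (2 * \<bar>real_of_int (m $ i)\<bar>)"
  have "\<bar>real_of_int (m $ i)\<bar> \<ge> 1" using i by linarith
  then have h: "0 \<le> h" "h \<le> 1" by (auto simp: h_def field_simps)
  have "chr m (h *\<^sub>R axis i 1) = exp (\<i> * complex_of_real (2 * pi * (h * m $ i)))"
    by (simp add: chr_def inner_axis' of_lattice_def)
  also have "2 * pi * (h * m $ i) = pi * sgn (m $ i)"
    using i by (simp add: h_def sgn_if)
  also have "exp (\<i> * complex_of_real (pi * sgn (m $ i))) = - 1"
    using i by (auto simp: sgn_if exp_minus mult.commute)
  finally have hm: "chr m (h *\<^sub>R axis i 1) = -1" .
  have "(LINT x|torus_measure. chr m x) = (LINT x|torus_measure. chr m (x + h *\<^sub>R axis i 1))"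
    by (rule torus_integral_shift[symmetric]) (intro continuous_intros chr_periodic h)+
  also have "\<dots> = - (LINT x|torus_measure. chr m x)"
    by (simp add: chr_add hm)
  finally show ?thesis using False by simp
qed

lemma integral_cnj_chr_chr:
  "(LINT x|torus_measure. cnj (chr \<xi> x) * chr \<eta> x) = (if \<xi> = \<eta> then 1 else 0)"
proof -
  have "cnj (chr \<xi> x) * chr \<eta> x = chr (\<eta> - \<xi>) x" for x
    by (simp flip: chr_minus_left chr_add_left)
  then show ?thesis by (simp add: integral_chr)
qed

lemma parseval_trig:
  fixes c :: "int^'n::finite \<Rightarrow> complex"
  assumes "finite S"
  shows "(LINT x|torus_measure. (norm (\<Sum>\<xi>\<in>S. c \<xi> * chr \<xi> x))\<^sup>2) = (\<Sum>\<xi>\<in>S. (norm (c \<xi>))\<^sup>2)"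
proof -
  let ?M = "torus_measure :: (real^'n) measure"
  have int: "integrable ?M (\<lambda>x. cnj (chr \<xi> x) * chr \<eta> x)" for \<xi> \<eta>
    by (intro integrable_torus_continuous continuous_intros)
  have "complex_of_real (LINT x|?M. (norm (\<Sum>\<xi>\<in>S. c \<xi> * chr \<xi> x))\<^sup>2)
     = (LINT x|?M. complex_of_real ((norm (\<Sum>\<xi>\<in>S. c \<xi> * chr \<xi> x))\<^sup>2))"
    by (rule integral_complex_of_real[symmetric])
  also have "\<dots> = (LINT x|?M. (\<Sum>\<xi>\<in>S. \<Sum>\<eta>\<in>S. (cnj (c \<xi>) * c \<eta>) * (cnj (chr \<xi> x) * chr \<eta> x)))"
    by (intro Bochner_Integration.integral_cong refl)
      (subst complex_norm_square, simp only: cnj_sum sum_product complex_cnj_mult, subst sum.swap, simp only: mult_ac)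
  also have "\<dots> = (\<Sum>\<xi>\<in>S. \<Sum>\<eta>\<in>S. (cnj (c \<xi>) * c \<eta>) * (LINT x|?M. cnj (chr \<xi> x) * chr \<eta> x))"
    by (simp add: Bochner_Integration.integral_sum int)
  also have "\<dots> = (\<Sum>\<xi>\<in>S. complex_of_real ((norm (c \<xi>))\<^sup>2))"
  proof (intro sum.cong refl)
    fix \<xi> assume "\<xi> \<in> S"
    then have "(\<Sum>\<eta>\<in>S. (cnj (c \<xi>) * c \<eta>) * (LINT x|?M. cnj (chr \<xi> x) * chr \<eta> x)) = cnj (c \<xi>) * c \<xi>"
      using assms by (simp add: integral_cnj_chr_chr if_distrib[of "\<lambda>z. _ * z"] cong: if_cong)
    then show "(\<Sum>\<eta>\<in>S. (cnj (c \<xi>) * c \<eta>) * (LINT x|?M. cnj (chr \<xi> x) * chr \<eta> x)) = complex_of_real ((norm (c \<xi>))\<^sup>2)"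
      by (metis complex_norm_square mult.commute of_real_power)
  qed
  also have "\<dots> = complex_of_real (\<Sum>\<xi>\<in>S. (norm (c \<xi>))\<^sup>2)" by simp
  finally show ?thesis by (simp only: of_real_eq_iff)
qed

subsection \<open>Weighted pointwise bounds for Fourier multipliers\<close>

lemma measure_torus [simp]: "measure torus_measure (cbox 0 (1::real^'n::finite)) = 1"
  using emeasure_torus[where 'n = 'n]
  by (simp add: measure_def del: emeasure_restrict_space space_restrict_space)

lemma integrable_torus_const [simp]: "integrable torus_measure (\<lambda>x. c :: 'a::{banach,second_countable_topology})"
  by (rule finite_measure.integrable_const[OF finite_measure_torus])

text \<open>Periodicity is left out: functions satisfying this predicate are seen only through
  integrals and bounds over the unit cube.\<close>

definition L2 :: "(real^'n::finite \<Rightarrow> complex) \<Rightarrow> bool" where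
  "L2 f \<longleftrightarrow> f \<in> borel_measurable torus_measure \<and> integrable torus_measure (\<lambda>x. (norm (f x))\<^sup>2)"

lemma L2_integrable: assumes "L2 f" shows "integrable torus_measure f"
proof (rule Bochner_Integration.integrable_bound)
  show "integrable torus_measure (\<lambda>x. 1 + (norm (f x))\<^sup>2)"
    using assms by (intro Bochner_Integration.integrable_add) (auto simp: L2_def)
  show "f \<in> borel_measurable torus_measure" using assms by (simp add: L2_def)
  have "norm (f x) \<le> 1 + (norm (f x))\<^sup>2" for x
    using zero_le_power2[of "norm (f x) - 1"] norm_ge_zero[of "f x"] unfolding power2_diff
    by (simp add: power2_eq_square del: norm_ge_zero)
  then show "AE x in torus_measure. norm (f x) \<le> norm (1 + (norm (f x))\<^sup>2)" by simp
qed

lemma chr_diff: "chr \<xi> (x - y) = chr \<xi> x * cnj (chr \<xi> y)"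
  using chr_add[of \<xi> x "- y"] by (simp add: chr_minus)

lemma integrable_times_bounded:
  fixes f u :: "real^'n::finite \<Rightarrow> complex"
  assumes f: "integrable torus_measure f" and u: "u \<in> borel_measurable torus_measure"
    and B: "\<And>x. norm (u x) \<le> B"
  shows "integrable torus_measure (\<lambda>x. u x * f x)"
proof (rule Bochner_Integration.integrable_bound)
  show "integrable torus_measure (\<lambda>x. B *\<^sub>R norm (f x))"
    using f by (intro integrable_scaleR_right integrable_norm)
  show "(\<lambda>x. u x * f x) \<in> borel_measurable torus_measure"
    using f u by measurable
  show "AE x in torus_measure. norm (u x * f x) \<le> norm (B *\<^sub>R norm (f x))"
    using B order_trans[OF norm_ge_zero B]
    by (intro AE_I2) (auto simp: norm_mult intro!: mult_right_mono)
qed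

lemma integrable_cnj_chr:
  "integrable torus_measure f \<Longrightarrow> integrable torus_measure (\<lambda>x. cnj (chr \<xi> x) * f x)"
  by (rule integrable_times_bounded[where B = 1])
     (auto intro!: measurable_torus_continuous continuous_intros)

text \<open>Expansion of 0 <= ||f - g||^2 for the partial Fourier sum g; the cross term and ||g||^2
  both equal \<open>Q\<close>.\<close>

lemma bessel:
  assumes f: "L2 f" and S: "finite S"
  shows "(\<Sum>\<xi>\<in>S. (norm (fourier f \<xi>))\<^sup>2) \<le> (LINT x|torus_measure. (norm (f x))\<^sup>2)"
proof -
  let ?M = "torus_measure :: (real^'a) measure"
  define g where "g = (\<lambda>x. \<Sum>\<xi>\<in>S. fourier f \<xi> * chr \<xi> x)"
  define Q where "Q = (\<Sum>\<xi>\<in>S. (norm (fourier f \<xi>))\<^sup>2)"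
  have fi: "integrable ?M f" by (rule L2_integrable[OF f])
  have gc: "continuous_on UNIV g" unfolding g_def by (intro continuous_intros)
  have G: "(LINT x|?M. (norm (g x))\<^sup>2) = Q"
    unfolding g_def Q_def by (rule parseval_trig[OF S])
  have Gi: "integrable ?M (\<lambda>x. (norm (g x))\<^sup>2)"
    by (intro continuous_imp_integrable continuous_intros continuous_on_subset[OF gc]) auto
  have e: "cnj (g x) * f x = (\<Sum>\<xi>\<in>S. cnj (fourier f \<xi>) * (cnj (chr \<xi> x) * f x))" for x
    by (simp add: g_def cnj_sum sum_distrib_right sum_distrib_left mult_ac)
  have ci: "integrable ?M (\<lambda>x. cnj (g x) * f x)"
    unfolding e by (intro Bochner_Integration.integrable_sum integrable_mult_right integrable_cnj_chr fi)
  have "(LINT x|?M. cnj (g x) * f x) = (\<Sum>\<xi>\<in>S. cnj (fourier f \<xi>) * fourier f \<xi>)"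
    unfolding e by (simp add: Bochner_Integration.integral_sum integrable_cnj_chr fi flip: fourier_chr)
  also have "\<dots> = complex_of_real Q"
    unfolding Q_def by (simp only: of_real_sum complex_norm_square mult.commute)
  finally have C: "(LINT x|?M. Re (cnj (g x) * f x)) = Q"
    using integral_Re[OF ci] by simp
  have "0 \<le> (LINT x|?M. (norm (f x - g x))\<^sup>2)" by simp
  also have "\<dots> = (LINT x|?M. (norm (f x))\<^sup>2 + (norm (g x))\<^sup>2 - 2 * Re (cnj (g x) * f x))"
    by (intro Bochner_Integration.integral_cong refl)
      (simp only: cmod_power2, simp add: power2_eq_square algebra_simps)
  also have "\<dots> = (LINT x|?M. (norm (f x))\<^sup>2) + Q - 2 * Q"
    using f Gi ci by (simp add: L2_def G C integrable_Re del: times_complex.sel complex_cnj)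
  finally show ?thesis by (simp add: Q_def)
qed

text \<open>The convolution kernel of the multiplier \<open>b\<close>. Summation over the support
  avoids fixing a frequency box, so that \<open>b\<close> and its differences, whose supports
  differ, can be compared. For infinite support the value is the default 0.\<close>

definition kern :: "(int^'n::finite \<Rightarrow> complex) \<Rightarrow> real^'n \<Rightarrow> complex" where
  "kern b z = (\<Sum>\<xi> | b \<xi> \<noteq> 0. b \<xi> * chr \<xi> z)"

lemma kern_eq:
  assumes "finite S" "{\<xi>. b \<xi> \<noteq> 0} \<subseteq> S"
  shows "kern b z = (\<Sum>\<xi>\<in>S. b \<xi> * chr \<xi> z)"
  unfolding kern_def by (rule sum.mono_neutral_left) (use assms in auto)

lemma finite_support_difference:
  assumes "finite {\<xi>. b \<xi> \<noteq> 0}"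
  shows "finite {\<xi>. difference i b \<xi> \<noteq> 0}"
proof -
  have "{\<xi>. difference i b \<xi> \<noteq> 0} \<subseteq> {\<xi>. b \<xi> \<noteq> 0} \<union> (\<lambda>\<xi>. \<xi> - axis i 1) ` {\<xi>. b \<xi> \<noteq> 0}"
  proof
    fix \<xi> assume "\<xi> \<in> {\<xi>. difference i b \<xi> \<noteq> 0}"
    then have "b \<xi> \<noteq> 0 \<or> b (\<xi> + axis i 1) \<noteq> 0" by (auto simp: difference_def)
    moreover have "\<xi> = (\<xi> + axis i 1) - axis i 1" by simp
    ultimately show "\<xi> \<in> {\<xi>. b \<xi> \<noteq> 0} \<union> (\<lambda>\<xi>. \<xi> - axis i 1) ` {\<xi>. b \<xi> \<noteq> 0}" by blast
  qed
  then show ?thesis using assms by (meson finite_UnI finite_imageI finite_subset)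
qed

lemma cnj_chr_mult: "cnj (chr \<xi> x) * chr \<xi> x = 1"
  by (simp flip: chr_minus_left chr_add_left)

text \<open>Summation by parts: a shift of the frequency variable multiplies the kernel by a
  conjugate character. The shifted set S + e still covers the support of \<open>b\<close>, because
  where \<open>b\<close> vanishes at \<xi> - e but not at \<xi>, the difference at \<xi> - e is
  nonzero.\<close>

lemma kern_difference:
  assumes fin: "finite {\<xi>. b \<xi> \<noteq> 0}"
  shows "kern (difference i b) z = (cnj (chr (axis i 1) z) - 1) * kern b z"
proof -
  define S where "S = {\<xi>. b \<xi> \<noteq> 0} \<union> {\<xi>. difference i b \<xi> \<noteq> 0}"
  define e where "e = (axis i 1 :: int^'a)"
  have S: "finite S" using fin finite_support_difference[OF fin] by (simp add: S_def)
  have "kern (difference i b) z = (\<Sum>\<xi>\<in>S. b (\<xi> + e) * chr \<xi> z) - (\<Sum>\<xi>\<in>S. b \<xi> * chr \<xi> z)"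
    by (subst kern_eq[OF S], force simp: S_def) (auto simp: difference_def e_def left_diff_distrib sum_subtractf)
  also have "(\<Sum>\<xi>\<in>S. b \<xi> * chr \<xi> z) = kern b z"
    by (rule kern_eq[OF S, symmetric]) (auto simp: S_def)
  also have "(\<Sum>\<xi>\<in>S. b (\<xi> + e) * chr \<xi> z) = (\<Sum>\<xi>\<in>(\<lambda>\<xi>. \<xi> + e) ` S. b \<xi> * (cnj (chr e z) * chr \<xi> z))"
    using cnj_chr_mult[of e z]
    by (subst sum.reindex) (auto simp: inj_on_def chr_add_left mult.left_commute[of "cnj (chr e z)"])
  also have "\<dots> = cnj (chr e z) * (\<Sum>\<xi>\<in>(\<lambda>\<xi>. \<xi> + e) ` S. b \<xi> * chr \<xi> z)"
    by (simp add: sum_distrib_left mult_ac)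
  also have "(\<Sum>\<xi>\<in>(\<lambda>\<xi>. \<xi> + e) ` S. b \<xi> * chr \<xi> z) = kern b z"
  proof (rule kern_eq[symmetric])
    show "{\<xi>. b \<xi> \<noteq> 0} \<subseteq> (\<lambda>\<xi>. \<xi> + e) ` S"
    proof
      fix \<xi> assume *: "\<xi> \<in> {\<xi>. b \<xi> \<noteq> 0}"
      have "b (\<xi> - e) \<noteq> 0 \<or> difference i b (\<xi> - e) \<noteq> 0"
        using * by (auto simp: difference_def e_def)
      then have "\<xi> - e \<in> S" by (auto simp: S_def)
      then show "\<xi> \<in> (\<lambda>\<xi>. \<xi> + e) ` S" by (rule rev_image_eqI) simp
    qed
  qed (use S in simp)
  finally show ?thesis by (simp add: e_def algebra_simps)
qed

lemma finite_support_differences: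
  "finite {\<xi>. b \<xi> \<noteq> 0} \<Longrightarrow> finite {\<xi>. (difference i ^^ k) b \<xi> \<noteq> 0}"
  by (induction k) (auto intro: finite_support_difference)

lemma kern_differences:
  assumes fin: "finite {\<xi>. b \<xi> \<noteq> 0}"
  shows "kern ((difference i ^^ k) b) z = (cnj (chr (axis i 1) z) - 1) ^ k * kern b z"
  using fin by (induction k) (auto simp: kern_difference finite_support_differences)

lemma continuous_on_kern [continuous_intros]:
  "continuous_on A f \<Longrightarrow> continuous_on A (\<lambda>x. kern b (f x))"
  unfolding kern_def by (intro continuous_intros)

lemma kern_L2:
  assumes S: "finite S" "{\<xi>. b \<xi> \<noteq> 0} \<subseteq> S"
  shows "(LINT y|torus_measure. (norm (kern b (x - y)))\<^sup>2) = (\<Sum>\<xi>\<in>S. (norm (b \<xi>))\<^sup>2)"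
proof -
  have "norm (kern b (x - y)) = norm (\<Sum>\<xi>\<in>S. cnj (b \<xi> * chr \<xi> x) * chr \<xi> y)" for y
  proof -
    have "kern b (x - y) = cnj (\<Sum>\<xi>\<in>S. cnj (b \<xi> * chr \<xi> x) * chr \<xi> y)"
      unfolding kern_eq[OF S] cnj_sum
      by (intro sum.cong refl) (simp add: chr_diff)
    then show ?thesis by (metis complex_mod_cnj)
  qed
  then have "(LINT y|torus_measure. (norm (kern b (x - y)))\<^sup>2)
     = (\<Sum>\<xi>\<in>S. (norm (cnj (b \<xi> * chr \<xi> x)))\<^sup>2)"
    by (simp only: parseval_trig[OF S(1)])
  then show ?thesis by (simp add: norm_mult)
qed

text \<open>A periodic substitute for (1 + |tz|)^(2k), with |exp(2 pi i z_i) - 1| in place of the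
  distance of z_i to the integers. By \<open>kern_differences\<close> this form converts weighted
  kernel norms exactly into norms of k-th differences of the symbol.\<close>

definition weight :: "nat \<Rightarrow> real \<Rightarrow> real^'n::finite \<Rightarrow> real" where
  "weight k t z = 1 + (\<Sum>i\<in>UNIV. (t * norm (chr (axis i 1) z - 1)) ^ (2 * k))"

lemma weight_ge_1: "0 \<le> t \<Longrightarrow> weight k t z \<ge> 1"
  unfolding weight_def by (simp add: sum_nonneg)

lemma continuous_on_weight [continuous_intros]:
  "continuous_on A f \<Longrightarrow> continuous_on A (\<lambda>x. weight k t (f x))"
  unfolding weight_def by (intro continuous_intros)

text \<open>Cauchy-Schwarz for the convolution of \<open>kern b\<close> with \<open>f\<close>, the
  weight w being distributed as sqrt w and 1 / sqrt w. The factor with \<open>f\<close> stays an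
  integral, so that the same estimate serves twice: with bounded \<open>f\<close> for the sup norm,
  and integrated in x for the L2 norm.\<close>

lemma multiplier_pointwise_bound:
  fixes b :: "int^'n::finite \<Rightarrow> complex"
  assumes f: "L2 f" and S: "finite S" and b: "\<And>\<xi>. \<xi> \<notin> S \<Longrightarrow> b \<xi> = 0"
    and db: "\<And>i \<xi>. \<xi> \<notin> S \<Longrightarrow> (difference i ^^ k) b \<xi> = 0" and t: "0 \<le> t"
    and D: "(\<Sum>\<xi>\<in>S. (norm (b \<xi>))\<^sup>2)
        + t ^ (2 * k) * (\<Sum>i\<in>UNIV. \<Sum>\<xi>\<in>S. (norm ((difference i ^^ k) b \<xi>))\<^sup>2) \<le> D"
  shows "ennreal ((norm (\<Sum>\<xi>\<in>S. b \<xi> * fourier f \<xi> * chr \<xi> x))\<^sup>2)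
     \<le> ennreal D * (\<integral>\<^sup>+y. ennreal ((norm (f y))\<^sup>2 / weight k t (x - y)) \<partial>torus_measure)"
proof -
  let ?M = "torus_measure :: (real^'n) measure"
  let ?w = "\<lambda>y. weight k t (x - y)"
  have supp: "{\<xi>. b \<xi> \<noteq> 0} \<subseteq> S" using b by auto
  have suppd: "{\<xi>. (difference i ^^ k) b \<xi> \<noteq> 0} \<subseteq> S" for i using db by auto
  have fin: "finite {\<xi>. b \<xi> \<noteq> 0}" using supp S by (rule finite_subset)
  have fi: "integrable ?M f" by (rule L2_integrable[OF f])
  have wpos: "?w y > 0" for y using weight_ge_1[OF t, of k "x - y"] by linarith
  have cK: "continuous_on UNIV (\<lambda>y. kern b (x - y))" by (intro continuous_intros)
  have cw: "continuous_on UNIV ?w" by (intro continuous_intros)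
  note [measurable] = measurable_torus_continuous[OF cK] measurable_torus_continuous[OF cw]
  have [measurable]: "f \<in> borel_measurable ?M" using f by (simp add: L2_def)
  have "(\<Sum>\<xi>\<in>S. b \<xi> * fourier f \<xi> * chr \<xi> x) = (\<Sum>\<xi>\<in>S. LINT y|?M. b \<xi> * chr \<xi> x * (cnj (chr \<xi> y) * f y))"
    unfolding fourier_chr by (simp, simp only: mult_ac)
  also have "\<dots> = (LINT y|?M. (\<Sum>\<xi>\<in>S. b \<xi> * chr \<xi> x * (cnj (chr \<xi> y) * f y)))"
    by (rule Bochner_Integration.integral_sum[symmetric]) (intro integrable_mult_right integrable_cnj_chr fi)
  also have "\<dots> = (LINT y|?M. kern b (x - y) * f y)"
    unfolding kern_eq[OF S supp] sum_distrib_right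
    by (intro Bochner_Integration.integral_cong sum.cong refl)
       (simp add: chr_diff)
  finally have rep: "(\<Sum>\<xi>\<in>S. b \<xi> * fourier f \<xi> * chr \<xi> x) = (LINT y|?M. kern b (x - y) * f y)" .
  have int: "integrable ?M (\<lambda>y. kern b (x - y) * f y)"
  proof -
    have "norm (kern b z) \<le> (\<Sum>\<xi>\<in>S. norm (b \<xi>))" for z
      unfolding kern_eq[OF S supp] by (rule order_trans[OF norm_sum]) (simp add: norm_mult)
    then show ?thesis by (intro integrable_times_bounded[OF fi]) auto
  qed
  \<comment> \<open>Each summand of the weight turns the kernel of \<open>b\<close> into that of a
    pure k-th difference, so Parseval applies term by term.\<close>
  have Kw: "(norm (kern b z))\<^sup>2 * weight k t z
      = (norm (kern b z))\<^sup>2 + t ^ (2 * k) * (\<Sum>i\<in>UNIV. (norm (kern ((difference i ^^ k) b) z))\<^sup>2)" for z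
  proof -
    have "norm (cnj (chr (axis i 1) z) - 1) = norm (chr (axis i 1) z - 1)" for i
      by (metis complex_cnj_diff complex_cnj_one complex_mod_cnj)
    then show ?thesis
      by (simp add: weight_def kern_differences[OF fin] norm_mult norm_power power_mult_distrib
          distrib_left sum_distrib_left mult_ac power_mult[symmetric])
  qed
  have Kint: "integrable ?M (\<lambda>y. (norm (kern c (x - y)))\<^sup>2)" for c
    by (intro continuous_imp_integrable continuous_intros)
  have "(\<integral>\<^sup>+y. (ennreal (norm (kern b (x - y)) * sqrt (?w y)))\<^sup>2 \<partial>?M)
      = (\<integral>\<^sup>+y. ennreal ((norm (kern b (x - y)))\<^sup>2 * ?w y) \<partial>?M)"
    by (intro nn_integral_cong) (simp add: ennreal_power power_mult_distrib less_imp_le[OF wpos])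
  also have "\<dots> = ennreal (LINT y|?M. (norm (kern b (x - y)))\<^sup>2 * ?w y)"
    by (rule nn_integral_eq_integral)
       (auto intro!: continuous_imp_integrable continuous_intros simp: less_imp_le[OF wpos])
  also have "(LINT y|?M. (norm (kern b (x - y)))\<^sup>2 * ?w y) = (\<Sum>\<xi>\<in>S. (norm (b \<xi>))\<^sup>2)
        + t ^ (2 * k) * (\<Sum>i\<in>UNIV. \<Sum>\<xi>\<in>S. (norm ((difference i ^^ k) b \<xi>))\<^sup>2)"
    unfolding Kw by (simp add: Kint kern_L2[OF S supp] kern_L2[OF S suppd])
  also have "ennreal \<dots> \<le> ennreal D" using D by (rule ennreal_leI)
  finally have A: "(\<integral>\<^sup>+y. (ennreal (norm (kern b (x - y)) * sqrt (?w y)))\<^sup>2 \<partial>?M) \<le> ennreal D" .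
  have B: "(\<integral>\<^sup>+y. (ennreal (norm (f y) / sqrt (?w y)))\<^sup>2 \<partial>?M)
      = (\<integral>\<^sup>+y. ennreal ((norm (f y))\<^sup>2 / ?w y) \<partial>?M)"
    by (intro nn_integral_cong) (simp add: ennreal_power power_divide less_imp_le[OF wpos])
  have "ennreal (norm (LINT y|?M. kern b (x - y) * f y)) \<le> (\<integral>\<^sup>+y. ennreal (norm (kern b (x - y) * f y)) \<partial>?M)"
    by (rule integral_norm_bound_ennreal[OF int])
  also have "\<dots> = (\<integral>\<^sup>+y. ennreal (norm (kern b (x - y)) * sqrt (?w y)) * ennreal (norm (f y) / sqrt (?w y)) \<partial>?M)"
    by (intro nn_integral_cong) (simp add: ennreal_mult[symmetric] norm_mult less_imp_neq[OF wpos, symmetric] less_imp_le[OF wpos])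
  finally have "(ennreal (norm (LINT y|?M. kern b (x - y) * f y)))\<^sup>2
      \<le> (\<integral>\<^sup>+y. ennreal (norm (kern b (x - y)) * sqrt (?w y)) * ennreal (norm (f y) / sqrt (?w y)) \<partial>?M)\<^sup>2"
    by (rule power_mono) simp
  also have "\<dots> \<le> (\<integral>\<^sup>+y. (ennreal (norm (kern b (x - y)) * sqrt (?w y)))\<^sup>2 \<partial>?M) *
       (\<integral>\<^sup>+y. (ennreal (norm (f y) / sqrt (?w y)))\<^sup>2 \<partial>?M)"
    by (rule Cauchy_Schwarz_nn_integral) measurable
  also have "\<dots> \<le> ennreal D * (\<integral>\<^sup>+y. ennreal ((norm (f y))\<^sup>2 / ?w y) \<partial>?M)"
    unfolding B by (rule mult_right_mono[OF A]) simp
  finally show ?thesis unfolding rep by (simp add: ennreal_power)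
qed

section \<open>Integrability of the inverse weight\<close>

lemma dist_lattice_le_chr:
  assumes "\<bar>u\<bar> \<le> (1::real)"
  shows "\<exists>s\<in>{-1, 0, 1::int}. \<bar>u - of_int s\<bar> \<le> norm (exp (\<i> * complex_of_real (2 * pi * u)) - 1)"
proof -
  \<comment> \<open>A crude form of Jordan's inequality. Halving the angle keeps the cosine above
    sqrt 2 / 2, both in the mean value theorem for sin (v / 2) and in the double angle formula.
    Since pi >= 2, it is enough for the constant 1 in the claim.\<close>
  have sin_ge: "sin v \<ge> v / 2" if v: "0 \<le> v" "v \<le> pi / 2" for v :: real
  proof -
    have c: "cos w \<ge> sqrt 2 / 2" if "0 \<le> w" "w \<le> v / 2" for w
      using cos_monotone_0_pi_le[of w "pi / 4"] that v by (simp add: cos_45)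
    have "sin (v / 2) \<ge> (v / 2) * (sqrt 2 / 2)"
    proof (cases "v = 0")
      case False
      have "\<exists>z>0. z < v / 2 \<and> sin (v / 2) - sin 0 = (v / 2 - 0) * cos z"
        using False v by (intro MVT2) (auto intro!: derivative_eq_intros)
      then obtain z where z: "0 < z" "z < v / 2" "sin (v / 2) = v / 2 * cos z" by auto
      have "v / 2 * (sqrt 2 / 2) \<le> v / 2 * cos z" using c[of z] z v by (intro mult_left_mono) auto
      then show ?thesis using z(3) by linarith
    qed simp
    then have "sin (v / 2) * cos (v / 2) \<ge> ((v / 2) * (sqrt 2 / 2)) * (sqrt 2 / 2)"
      using c[of "v / 2"] v pi_gt_zero by (intro mult_mono sin_ge_zero) auto
    moreover have "((v / 2) * (sqrt 2 / 2)) * (sqrt 2 / 2) = v / 4" by (simp add: mult.assoc)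
    moreover have "sin v = 2 * (sin (v / 2) * cos (v / 2))" using sin_double[of "v / 2"] by simp
    ultimately show ?thesis by linarith
  qed
  \<comment> \<open>The chord on the unit circle is twice the sine of half the angle.\<close>
  have E: "norm (exp (\<i> * complex_of_real (2 * pi * u)) - 1) = 2 * \<bar>sin (pi * u)\<bar>"
    using dist_exp_i_1[of "2 * pi * u"] by simp
  have main: "2 * \<bar>sin (pi * r)\<bar> \<ge> \<bar>r\<bar>" if "\<bar>r\<bar> \<le> 1 / 2" for r :: real
  proof -
    have p: "sin (pi * \<bar>r\<bar>) \<ge> pi * \<bar>r\<bar> / 2" using that by (intro sin_ge) auto
    have "pi * \<bar>r\<bar> \<ge> 1 * \<bar>r\<bar>" using pi_ge_two by (intro mult_right_mono) auto
    moreover have "\<bar>sin (pi * r)\<bar> = \<bar>sin (pi * \<bar>r\<bar>)\<bar>" by (simp add: abs_if)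
    ultimately show ?thesis using p by linarith
  qed
  have per: "\<bar>sin (pi * (u - of_int s))\<bar> = \<bar>sin (pi * u)\<bar>" if "s \<in> {-1, 0, 1::int}" for s
    using that by (auto simp: algebra_simps sin_add sin_diff)
  obtain s where s: "s \<in> {-1, 0, 1::int}" "\<bar>u - of_int s\<bar> \<le> 1 / 2"
  proof -
    consider "u < - 1/2" | "\<bar>u\<bar> \<le> 1 / 2" | "u > 1 / 2" by linarith
    then show ?thesis using assms that[of "-1"] that[of 0] that[of 1] by cases auto
  qed
  then show ?thesis using main[of "u - of_int s"] per[of s] unfolding E by auto
qed

lemma nn_integral_torus_le:
  fixes g :: "real^'n::finite \<Rightarrow> ennreal"
  assumes [measurable]: "g \<in> borel_measurable borel"
  shows "(\<integral>\<^sup>+x. g x \<partial>torus_measure) \<le> (\<integral>\<^sup>+x. g x \<partial>lborel)"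
proof -
  have "(\<integral>\<^sup>+x. g x \<partial>torus_measure) = (\<integral>\<^sup>+x. g x * indicator (cbox 0 1) x \<partial>lebesgue)"
    by (rule nn_integral_restrict_space) simp
  also have "\<dots> \<le> (\<integral>\<^sup>+x. g x \<partial>lebesgue)"
    by (intro nn_integral_mono) (auto simp: indicator_def)
  also have "\<dots> = (\<integral>\<^sup>+x. g x \<partial>lborel)" by (simp add: nn_integral_completion)
  finally show ?thesis .
qed

lemma emeasure_cube_radius:
  fixes c :: "real^'n::finite"
  assumes "r \<ge> 0"
  shows "emeasure lborel (cbox (c - r *\<^sub>R 1) (c + r *\<^sub>R 1)) = ennreal ((2 * r) ^ CARD('n))"
proof -
  have "emeasure lborel (cbox (c - r *\<^sub>R 1) (c + r *\<^sub>R 1)) = ennreal (\<Prod>b\<in>Basis. ((c + r *\<^sub>R 1) - (c - r *\<^sub>R 1 :: real^'n)) \<bullet> b)"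
    using assms by (subst emeasure_lborel_cbox)
      (auto simp: Basis_vec_def inner_axis)
  also have "(\<Prod>b\<in>Basis. ((c + r *\<^sub>R 1) - (c - r *\<^sub>R 1 :: real^'n)) \<bullet> b) = (\<Prod>b\<in>(Basis :: (real^'n) set). 2 * r)"
    by (intro prod.cong refl) (auto simp: Basis_vec_def inner_axis)
  finally show ?thesis by simp
qed

lemma weight_minus: "weight k t (- z) = weight k t z"
proof -
  have "norm (cnj (chr (axis i 1) z) - 1) = norm (chr (axis i 1) z - 1)" for i
    by (metis complex_cnj_diff complex_cnj_one complex_mod_cnj)
  then show ?thesis by (simp add: weight_def chr_minus)
qed

text \<open>A dyadic decomposition around the lattice translates of x. Two points of the unit cube
  differ by at most 1 in each coordinate, so the nearest lattice point has entries -1, 0, 1. The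
  largest term m of the weight determines the level l: m <= 2^l places y in a cube of radius 2^l /
  t, while m > 2^(l-1) makes the weight at least 4^(k(l-1)). The off-by-one in l is the factor
  4^k.\<close>

lemma inverse_weight_le:
  fixes x y :: "real^'n::finite"
  assumes x: "x \<in> cbox 0 1" and y: "y \<in> cbox 0 1" and t: "0 < t"
  obtains s :: "int^'n" and l where "\<And>i. s $ i \<in> {-1, 0, 1}"
    and "y \<in> cbox (x - of_lattice s - (2 ^ l / t) *\<^sub>R 1) (x - of_lattice s + (2 ^ l / t) *\<^sub>R 1)"
    and "1 / weight k t (x - y) \<le> 4 ^ k * (1 / 4 ^ k) ^ l"
proof -
  define z where "z = x - y"
  have z: "\<bar>z $ i\<bar> \<le> 1" for i
    using x y by (auto simp: z_def mem_box_cart abs_le_iff; smt (verit))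
  have ci: "chr (axis i 1) z = exp (\<i> * complex_of_real (2 * pi * z $ i))" for i
    by (simp add: chr_def of_lattice_axis inner_axis)
  have "\<forall>i. \<exists>s. s \<in> {-1, 0, 1::int} \<and> \<bar>z $ i - of_int s\<bar> \<le> norm (chr (axis i 1) z - 1)"
    unfolding ci using dist_lattice_le_chr[OF z] by blast
  then obtain s0 where s0: "\<And>i. s0 i \<in> {-1, 0, 1::int}"
    "\<And>i. \<bar>z $ i - of_int (s0 i)\<bar> \<le> norm (chr (axis i 1) z - 1)" by metis
  define s where "s = (\<chi> i. s0 i)"
  define m where "m = Max (range (\<lambda>i. t * norm (chr (axis i 1) z - 1)))"
  have mi: "t * norm (chr (axis i 1) z - 1) \<le> m" for i unfolding m_def by (intro Max_ge) auto
  have "m \<in> range (\<lambda>i. t * norm (chr (axis i 1) z - 1))" unfolding m_def by (intro Max_in) auto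
  then obtain j where j: "m = t * norm (chr (axis j 1) z - 1)" by auto
  have m0: "m \<ge> 0" using t by (simp add: j)
  have wm: "weight k t z \<ge> 1 + m ^ (2 * k)"
    unfolding weight_def j using t by (intro add_left_mono member_le_sum) auto
  define l where "l = (LEAST l. m \<le> 2 ^ l)"
  have "\<exists>l. m \<le> 2 ^ l" using real_arch_pow[of 2 m] by (auto intro: less_imp_le)
  then have ml: "m \<le> 2 ^ l" unfolding l_def by (rule LeastI_ex)
  have low: "1 / weight k t z \<le> 4 ^ k * (1 / 4 ^ k) ^ l"
  \<comment> \<open>At level 0 there is no lower bound on m, and the summand 1 of the weight is used
    instead.\<close>
  proof (cases l)
    case 0
    have "1 / weight k t z \<le> 1" using weight_ge_1[of t k z] t by simp
    also have "1 \<le> (4::real) ^ k" by simp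
    finally show ?thesis using 0 by simp
  next
    case (Suc l')
    then have "\<not> m \<le> 2 ^ l'" using not_less_Least[of l' "\<lambda>l. m \<le> 2 ^ l"] by (simp add: l_def)
    then have "(2 ^ l') ^ (2 * k) \<le> m ^ (2 * k)" by (intro power_mono) auto
    moreover have e: "((2::real) ^ l') ^ (2 * k) = ((2\<^sup>2) ^ k) ^ l'"
      by (simp only: power_mult[symmetric] mult_ac)
    ultimately have "(4 ^ k) ^ l' \<le> weight k t z"
      using wm by (simp del: power_even_eq)
    then have "1 / weight k t z \<le> 1 / (4 ^ k) ^ l'" using weight_ge_1[of t k z] t by (intro divide_left_mono) auto
    also have "\<dots> = 4 ^ k * (1 / 4 ^ k) ^ l" by (simp add: Suc power_one_over)
    finally show ?thesis .
  qed
  have "\<bar>z $ i - of_int (s $ i)\<bar> \<le> 2 ^ l / t" for i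
  proof -
    have "t * \<bar>z $ i - of_int (s $ i)\<bar> \<le> t * norm (chr (axis i 1) z - 1)"
      using s0(2)[of i] t by (simp add: s_def)
    then have "t * \<bar>z $ i - of_int (s $ i)\<bar> \<le> 2 ^ l" using mi[of i] ml by linarith
    then show ?thesis using t by (simp add: field_simps)
  qed
  then have "y \<in> cbox (x - of_lattice s - (2 ^ l / t) *\<^sub>R 1) (x - of_lattice s + (2 ^ l / t) *\<^sub>R 1)"
    by (auto simp: mem_box_cart of_lattice_def z_def abs_le_iff; smt (verit))
  then show ?thesis using that[of s l] s0(1) low by (simp add: s_def z_def)
qed

lemma finite_vec_components:
  "finite {s::int^'n::finite. \<forall>i. s $ i \<in> A}" if "finite A"
proof -
  have "{s::int^'n. \<forall>i. s $ i \<in> A} \<subseteq> vec_lambda ` (UNIV \<rightarrow>\<^sub>E A)"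
    by (auto simp: image_iff) (metis PiE_I UNIV_I vec_lambda_eta vec_nth_inverse)
  then show ?thesis by (rule finite_subset) (intro finite_imageI finite_PiE, use that in auto)
qed

text \<open>The l-th cubes have volume (2 * 2^l / t)^n and carry the value 4^k * 4^(-kl). Their
  contributions form a geometric series of ratio 2^n / 4^k, summed over the finitely many lattice
  translates in \<open>S\<close>.\<close>

lemma nn_integral_inverse_weight:
  assumes k: "CARD('n::finite) < 2 * k"
  shows "\<exists>C>0. \<forall>t>0. \<forall>x\<in>cbox 0 (1::real^'n).
    (\<integral>\<^sup>+y. ennreal (1 / weight k t (x - y)) \<partial>torus_measure) \<le> ennreal (C * (1 / t) ^ CARD('n))"
proof -
  let ?n = "CARD('n)"
  define S where "S = {s::int^'n. \<forall>i. s $ i \<in> {-1, 0, 1}}"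
  have S: "finite S" unfolding S_def by (intro finite_vec_components) auto
  have "0 \<in> S" by (simp add: S_def)
  then have cS: "card S > 0" using S by (auto simp: card_gt_0_iff)
  define C :: real where "C = real (card S) * 4 ^ k * 2 ^ ?n * 2"
  \<comment> \<open>Integrality improves n < 2k to n + 1 <= 2k, so the ratio is at most 1/2; hence
    the last factor 2 in \<open>C\<close>.\<close>
  have q: "(2::real) ^ ?n / 4 ^ k \<le> 1 / 2"
  proof -
    have "(2::real) ^ (?n + 1) \<le> 2 ^ (2 * k)" using k by (intro power_increasing) auto
    moreover have "(2::real) ^ (2 * k) = 4 ^ k" by (subst power_mult) simp
    ultimately show ?thesis by (simp add: field_simps)
  qed
  have q1: "(2::real) ^ ?n < 4 ^ k"
  proof -
    have "(2::real) ^ ?n / 4 ^ k < 1" using q by linarith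
    then show ?thesis by simp
  qed
  have "(\<integral>\<^sup>+y. ennreal (1 / weight k t (x - y)) \<partial>torus_measure) \<le> ennreal (C * (1 / t) ^ ?n)"
    if t: "0 < t" and x: "x \<in> cbox 0 (1::real^'n)" for t x
  proof -
    define B where "B = (\<lambda>l s. cbox (x - of_lattice s - (2 ^ l / t) *\<^sub>R 1) (x - of_lattice s + (2 ^ l / t) *\<^sub>R (1::real^'n)))"
    define g where "g = (\<lambda>y. \<Sum>l. \<Sum>s\<in>S. ennreal (4 ^ k * (1 / 4 ^ k) ^ l) * indicator (B l s) y)"
    have [measurable]: "B l s \<in> sets borel" for l s by (simp add: B_def)
    have [measurable]: "g \<in> borel_measurable borel" unfolding g_def by measurable
    have "(\<integral>\<^sup>+y. ennreal (1 / weight k t (x - y)) \<partial>torus_measure) \<le> (\<integral>\<^sup>+y. g y \<partial>torus_measure)"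
    proof (rule nn_integral_mono)
      fix y :: "real^'n" assume "y \<in> space torus_measure"
      then have y: "y \<in> cbox 0 1" by simp
      obtain s l where sl: "\<And>i. s $ i \<in> {-1, 0, 1}" "y \<in> B l s"
        "1 / weight k t (x - y) \<le> 4 ^ k * (1 / 4 ^ k) ^ l"
        using inverse_weight_le[OF x y t, of k] unfolding B_def by metis
      have "ennreal (1 / weight k t (x - y)) \<le> ennreal (4 ^ k * (1 / 4 ^ k) ^ l) * indicator (B l s) y"
        using sl by (simp add: ennreal_leI)
      also have "\<dots> \<le> (\<Sum>s\<in>S. ennreal (4 ^ k * (1 / 4 ^ k) ^ l) * indicator (B l s) y)"
        by (rule member_le_sum) (use sl S in \<open>auto simp: S_def\<close>)
      also have "\<dots> = (\<Sum>l\<in>{l}. (\<Sum>s\<in>S. ennreal (4 ^ k * (1 / 4 ^ k) ^ l) * indicator (B l s) y))" by simp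
      also have "\<dots> \<le> g y" unfolding g_def by (rule sum_le_suminf) auto
      finally show "ennreal (1 / weight k t (x - y)) \<le> g y" .
    qed
    also have "\<dots> \<le> (\<integral>\<^sup>+y. g y \<partial>lborel)" by (rule nn_integral_torus_le) measurable
    also have "\<dots> = (\<Sum>l. \<Sum>s\<in>S. ennreal (4 ^ k * (1 / 4 ^ k) ^ l) * emeasure lborel (B l s))"
      unfolding g_def by (subst nn_integral_suminf) (auto simp: nn_integral_sum nn_integral_cmult_indicator)
    also have "\<dots> = (\<Sum>l. ennreal (real (card S) * 4 ^ k * 2 ^ ?n * (1 / t) ^ ?n * (2 ^ ?n / 4 ^ k) ^ l))"
    proof (intro arg_cong[where f = suminf] ext)
      fix l
      have e: "emeasure lborel (B l s) = ennreal ((2 * (2 ^ l / t)) ^ ?n)" for s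
        unfolding B_def using t by (intro emeasure_cube_radius) auto
      have "(\<Sum>s\<in>S. ennreal (4 ^ k * (1 / 4 ^ k) ^ l) * emeasure lborel (B l s))
          = ennreal (real (card S) * ((4 ^ k * (1 / 4 ^ k) ^ l) * (2 * (2 ^ l / t)) ^ ?n))"
        unfolding e using t by (simp add: ennreal_mult ennreal_of_nat_eq_real_of_nat)
      also have "real (card S) * ((4 ^ k * (1 / 4 ^ k) ^ l) * (2 * (2 ^ l / t)) ^ ?n)
        = real (card S) * 4 ^ k * 2 ^ ?n * (1 / t) ^ ?n * (2 ^ ?n / 4 ^ k) ^ l"
        by (simp add: power_mult_distrib power_divide power_one_over field_simps flip: power_mult)
      finally show "(\<Sum>s\<in>S. ennreal (4 ^ k * (1 / 4 ^ k) ^ l) * emeasure lborel (B l s))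
        = ennreal (real (card S) * 4 ^ k * 2 ^ ?n * (1 / t) ^ ?n * (2 ^ ?n / 4 ^ k) ^ l)" .
    qed
    also have "\<dots> = ennreal (\<Sum>l. real (card S) * 4 ^ k * 2 ^ ?n * (1 / t) ^ ?n * (2 ^ ?n / 4 ^ k) ^ l)"
      using q1 t by (intro suminf_ennreal2 summable_mult summable_geometric) auto
    also have "(\<Sum>l. real (card S) * 4 ^ k * 2 ^ ?n * (1 / t) ^ ?n * (2 ^ ?n / 4 ^ k) ^ l)
        = real (card S) * 4 ^ k * 2 ^ ?n * (1 / t) ^ ?n * (1 / (1 - 2 ^ ?n / 4 ^ k))"
      using q1 by (subst suminf_mult) (auto simp: suminf_geometric summable_geometric)
    also have "ennreal \<dots> \<le> ennreal (C * (1 / t) ^ ?n)"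
    proof (rule ennreal_leI)
      have "1 / (1 - 2 ^ ?n / 4 ^ k) \<le> (2::real)" using q q1 by (simp add: field_simps)
      then have "real (card S) * 4 ^ k * 2 ^ ?n * (1 / t) ^ ?n * (1 / (1 - 2 ^ ?n / 4 ^ k))
         \<le> real (card S) * 4 ^ k * 2 ^ ?n * (1 / t) ^ ?n * 2"
        using t by (intro mult_left_mono) auto
      then show "real (card S) * 4 ^ k * 2 ^ ?n * (1 / t) ^ ?n * (1 / (1 - 2 ^ ?n / 4 ^ k)) \<le> C * (1 / t) ^ ?n"
        by (simp add: C_def mult_ac)
    qed
    finally show ?thesis .
  qed
  moreover have "C > 0" using cS by (simp add: C_def)
  ultimately show ?thesis by blast
qed

lemma measurable_weight_pair:
  assumes f [measurable]: "f \<in> borel_measurable (torus_measure :: (real^'n::finite) measure)"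
  shows "(\<lambda>p. ennreal ((norm (f (snd p) :: complex))\<^sup>2 / weight k t (fst p - snd p)))
    \<in> borel_measurable (torus_measure \<Otimes>\<^sub>M torus_measure)"
proof -
  let ?M = "torus_measure :: (real^'n) measure"
  have id: "(\<lambda>x. x) \<in> measurable ?M borel"
    by (intro measurable_torus_continuous continuous_intros)
  have wb: "weight k t \<in> borel_measurable borel"
    by (intro borel_measurable_continuous_onI continuous_intros)
  have w [measurable]: "(\<lambda>p. weight k t (fst p - snd p)) \<in> borel_measurable (?M \<Otimes>\<^sub>M ?M)"
    by (rule measurable_compose[OF borel_measurable_diff[OF
          measurable_compose[OF measurable_fst id] measurable_compose[OF measurable_snd id]] wb])
  have [measurable]: "(\<lambda>p. f (snd p)) \<in> borel_measurable (?M \<Otimes>\<^sub>M ?M)"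
    by (rule measurable_compose[OF measurable_snd f])
  show ?thesis by measurable
qed

text \<open>Schur's test for the kernel 1 / weight. Tonelli leaves an integral in the other
  variable, and evenness of the weight brings it back to the hypothesis \<open>C\<close>.\<close>

lemma nn_integral_torus_swap:
  fixes f :: "real^'n::finite \<Rightarrow> complex"
  assumes [measurable]: "f \<in> borel_measurable torus_measure" and t: "0 < t"
    and C: "\<And>x. x \<in> cbox 0 (1::real^'n) \<Longrightarrow>
      (\<integral>\<^sup>+y. ennreal (1 / weight k t (x - y)) \<partial>torus_measure) \<le> C"
  shows "(\<integral>\<^sup>+x. (\<integral>\<^sup>+y. ennreal ((norm (f y))\<^sup>2 / weight k t (x - y)) \<partial>torus_measure) \<partial>torus_measure)
     \<le> C * (\<integral>\<^sup>+y. ennreal ((norm (f y))\<^sup>2) \<partial>torus_measure)"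
proof -
  let ?M = "torus_measure :: (real^'n) measure"
  interpret M: finite_measure ?M by (rule finite_measure_torus)
  interpret P: pair_sigma_finite ?M ?M ..
  have [measurable]: "(\<lambda>y. weight k t (x - y)) \<in> borel_measurable ?M" for x
    by (intro measurable_torus_continuous continuous_intros)
  have [measurable]: "(\<lambda>x. weight k t (x - y)) \<in> borel_measurable ?M" for y
    by (intro measurable_torus_continuous continuous_intros)
  have wpos: "weight k t z > 0" for z using weight_ge_1[of t k z] t by linarith
  have eq: "ennreal ((norm (f y))\<^sup>2 / weight k t (x - y))
      = ennreal ((norm (f y))\<^sup>2) * ennreal (1 / weight k t (y - x))" for x y
    using weight_minus[of k t "x - y"] by (simp add: ennreal_mult[symmetric] less_imp_le[OF wpos])
  have "(\<integral>\<^sup>+x. (\<integral>\<^sup>+y. ennreal ((norm (f y))\<^sup>2 / weight k t (x - y)) \<partial>?M) \<partial>?M)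
      = (\<integral>\<^sup>+y. (\<integral>\<^sup>+x. ennreal ((norm (f y))\<^sup>2 / weight k t (x - y)) \<partial>?M) \<partial>?M)"
    by (rule P.Fubini'[symmetric]) (use measurable_weight_pair[OF assms(1)] in \<open>simp add: case_prod_beta'\<close>)
  also have "\<dots> = (\<integral>\<^sup>+y. ennreal ((norm (f y))\<^sup>2) * (\<integral>\<^sup>+x. ennreal (1 / weight k t (y - x)) \<partial>?M) \<partial>?M)"
    unfolding eq by (simp add: nn_integral_cmult)
  also have "\<dots> \<le> (\<integral>\<^sup>+y. C * ennreal ((norm (f y))\<^sup>2) \<partial>?M)"
    by (rule nn_integral_mono, subst mult.commute, rule mult_right_mono) (use C in auto)
  also have "\<dots> = C * (\<integral>\<^sup>+y. ennreal ((norm (f y))\<^sup>2) \<partial>?M)" by (simp add: nn_integral_cmult)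
  finally show ?thesis .
qed

subsection \<open>Finite differences and dyadic cutoffs\<close>

lemma difference_add: "difference i (\<lambda>\<xi>. f \<xi> + g \<xi>) = (\<lambda>\<xi>. difference i f \<xi> + difference i g \<xi>)"
  by (auto simp: difference_def)

lemma differences_add:
  "(difference i ^^ l) (\<lambda>\<xi>. f \<xi> + g \<xi>) = (\<lambda>\<xi>. (difference i ^^ l) f \<xi> + (difference i ^^ l) g \<xi>)"
  by (induction l) (auto simp: difference_add)

lemma differences_diff:
  "(difference i ^^ l) (\<lambda>\<xi>. f \<xi> - g \<xi>) = (\<lambda>\<xi>. (difference i ^^ l) f \<xi> - (difference i ^^ l) g \<xi>)"
  by (induction l) (auto simp: difference_def)

lemma differences_shift:
  "(difference i ^^ l) (\<lambda>\<xi>. f (\<xi> + v)) \<xi> = (difference i ^^ l) f (\<xi> + v)"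
  by (induction l arbitrary: \<xi>) (auto simp: difference_def add_ac)

text \<open>Induction with the discrete Leibniz rule; (2r)^l absorbs the binomial sum. The shift is
  always put on \<open>g\<close>, so \<open>f\<close> is controlled only at \<xi> while
  \<open>g\<close> is controlled everywhere. This asymmetry matters: bounds on the symbol depend on
  its frequency, those on the cutoff are uniform.\<close>

lemma norm_differences_mult_le:
  fixes f g :: "int^'n::finite \<Rightarrow> complex"
  assumes "\<And>m. m \<le> l \<Longrightarrow> norm ((difference i ^^ m) f \<xi>) \<le> A * r ^ m"
    and "\<And>m \<eta>. m \<le> l \<Longrightarrow> norm ((difference i ^^ m) g \<eta>) \<le> B * r ^ m"
    and "0 \<le> A" "0 \<le> B" "0 \<le> r"
  shows "norm ((difference i ^^ l) (\<lambda>\<eta>. f \<eta> * g \<eta>) \<xi>) \<le> A * B * (2 * r) ^ l"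
  using assms
proof (induction l arbitrary: f g A B)
  case 0
  then show ?case using 0(1)[of 0] 0(2)[of 0 \<xi>] by (auto simp: norm_mult intro!: mult_mono)
next
  case (Suc l)
  have f1: "norm ((difference i ^^ m) (difference i f) \<xi>) \<le> (A * r) * r ^ m" if "m \<le> l" for m
    using Suc.prems(1)[of "Suc m"] that by (simp add: funpow_swap1 mult_ac)
  have g1: "norm ((difference i ^^ m) (\<lambda>\<eta>. g (\<eta> + axis i 1)) \<eta>) \<le> B * r ^ m" if "m \<le> l" for m \<eta>
    using Suc.prems(2)[of m] that by (simp add: differences_shift)
  have g2: "norm ((difference i ^^ m) (difference i g) \<eta>) \<le> (B * r) * r ^ m" if "m \<le> l" for m \<eta>
    using Suc.prems(2)[of "Suc m"] that by (simp add: funpow_swap1 mult_ac)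
  have f2: "norm ((difference i ^^ m) f \<xi>) \<le> A * r ^ m" if "m \<le> l" for m
    using Suc.prems(1)[of m] that by simp
  have "difference i (\<lambda>\<eta>. f \<eta> * g \<eta>) = (\<lambda>\<eta>. difference i f \<eta> * g (\<eta> + axis i 1) + f \<eta> * difference i g \<eta>)"
    by (auto simp: difference_def algebra_simps)
  then have e: "(difference i ^^ Suc l) (\<lambda>\<eta>. f \<eta> * g \<eta>) \<xi>
     = (difference i ^^ l) (\<lambda>\<eta>. difference i f \<eta> * g (\<eta> + axis i 1)) \<xi>
     + (difference i ^^ l) (\<lambda>\<eta>. f \<eta> * difference i g \<eta>) \<xi>"
    by (simp only: funpow_Suc_right o_def differences_add)
  have "norm ((difference i ^^ l) (\<lambda>\<eta>. difference i f \<eta> * g (\<eta> + axis i 1)) \<xi>) \<le> (A * r) * B * (2 * r) ^ l"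
    by (rule Suc.IH[OF f1 g1]) (use Suc.prems in auto)
  moreover have "norm ((difference i ^^ l) (\<lambda>\<eta>. f \<eta> * difference i g \<eta>) \<xi>) \<le> A * (B * r) * (2 * r) ^ l"
    by (rule Suc.IH[OF f2 g2]) (use Suc.prems in auto)
  ultimately show ?case
    unfolding e by (intro norm_triangle_le) (simp add: algebra_simps)
qed

text \<open>Only the values of \<open>f\<close> at \<xi>, \<xi> + e_i, ..., \<xi> + l e_i enter.
  Here \<open>of_nat s\<close> is a constant vector and the product is componentwise, so that
  \<open>of_nat s * axis i 1\<close> is s e_i.\<close>

lemma differences_eq_0:
  assumes "\<And>s. s \<le> l \<Longrightarrow> f (\<xi> + of_nat s * axis i 1) = 0"
  shows "(difference i ^^ l) f \<xi> = 0"
  using assms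
proof (induction l arbitrary: \<xi>)
  case 0
  then show ?case using 0[of 0] by simp
next
  case (Suc l)
  have "f (\<xi> + axis i 1 + of_nat s * axis i 1) = 0" if "s \<le> l" for s
    using Suc.prems[of "Suc s"] that by (simp add: algebra_simps)
  then show ?case using Suc.IH[of \<xi>] Suc.IH[of "\<xi> + axis i 1"] Suc.prems
    by (simp add: difference_def)
qed

text \<open>Averaging the indicator of an interval \<open>m\<close> times over windows of length \<open>L\<close> makes its differences
  of order \<open>l \<le> m\<close> as small as those of a smooth cutoff at scale \<open>L\<close>.\<close>

primrec cutoff1 :: "nat \<Rightarrow> nat \<Rightarrow> nat \<Rightarrow> int \<Rightarrow> real" where
  "cutoff1 L N 0 t = (if \<bar>t\<bar> \<le> int N then 1 else 0)"
| "cutoff1 L N (Suc m) t = (\<Sum>s<L. cutoff1 L N m (t + int s)) / real L"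

lemma cutoff1_bounds:
  assumes "L > 0" shows "0 \<le> cutoff1 L N m t \<and> cutoff1 L N m t \<le> 1"
proof (induction m arbitrary: t)
  case (Suc m)
  have "(\<Sum>s<L. cutoff1 L N m (t + int s)) \<le> (\<Sum>s<L. 1)" by (intro sum_mono) (use Suc in auto)
  then show ?case using Suc assms by (auto intro!: divide_nonneg_nonneg sum_nonneg)
qed auto

text \<open>The averaging windows look forward, so every average shortens the plateau at its right
  end and lengthens the support at its left end, by at most L each time.\<close>

lemma cutoff1_eq_1:
  assumes "L > 0"
  shows "- int N \<le> t \<Longrightarrow> t + int (m * L) \<le> int N \<Longrightarrow> cutoff1 L N m t = 1"
proof (induction m arbitrary: t)
  case (Suc m)
  have "cutoff1 L N m (t + int s) = 1" if "s < L" for s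
    by (rule Suc.IH) (use Suc.prems that in \<open>auto simp: algebra_simps\<close>)
  then show ?case using assms by simp
qed auto

lemma cutoff1_eq_0:
  shows "t > int N \<or> t < - int N - int (m * L) \<Longrightarrow> cutoff1 L N m t = 0"
proof (induction m arbitrary: t)
  case (Suc m)
  have "cutoff1 L N m (t + int s) = 0" if "s < L" for s
    by (rule Suc.IH) (use Suc.prems that in \<open>auto simp: algebra_simps\<close>)
  then show ?case by simp
qed auto

definition diff1 :: "(int \<Rightarrow> real) \<Rightarrow> int \<Rightarrow> real" where
  "diff1 f t = f (t + 1) - f t"

text \<open>The difference of a moving average telescopes to a quotient over a step of length
  L.\<close>

lemma diff1_cutoff1:
  assumes "L > 0"
  shows "diff1 (cutoff1 L N (Suc m)) = (\<lambda>t. (cutoff1 L N m (t + int L) - cutoff1 L N m t) / real L)"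
proof
  fix t
  have "(\<Sum>s<L. cutoff1 L N m (t + 1 + int s)) = (\<Sum>s<L. cutoff1 L N m (t + int (Suc s)))"
    by (simp add: add_ac)
  then have "(\<Sum>s<L. cutoff1 L N m (t + 1 + int s)) - (\<Sum>s<L. cutoff1 L N m (t + int s))
      = cutoff1 L N m (t + int L) - cutoff1 L N m t"
    using sum_lessThan_telescope[of "\<lambda>s. cutoff1 L N m (t + int s)" L]
    by (simp add: sum_subtractf)
  then show "diff1 (cutoff1 L N (Suc m)) t = (cutoff1 L N m (t + int L) - cutoff1 L N m t) / real L"
    by (simp add: diff1_def diff_divide_distrib[symmetric])
qed

lemma diff1_funpow_quotient:
  "(diff1 ^^ l) (\<lambda>t. (f (t + v) - f t) / c) t = ((diff1 ^^ l) f (t + v) - (diff1 ^^ l) f t) / c"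
  by (induction l arbitrary: t) (auto simp: diff1_def add_ac diff_divide_distrib)

text \<open>Each difference consumes one average and leaves two values divided by L, a factor 2 / L.
  This explains the restriction to at most as many differences as averages.\<close>

lemma abs_diff1_cutoff1_le:
  assumes "L > 0"
  shows "l \<le> m \<Longrightarrow> \<bar>(diff1 ^^ l) (cutoff1 L N m) t\<bar> \<le> (2 / real L) ^ l"
proof (induction l arbitrary: m t)
  case 0
  then show ?case using cutoff1_bounds[OF assms] by (simp add: abs_le_iff)
next
  case (Suc l)
  then obtain m' where m': "m = Suc m'" "l \<le> m'" by (cases m) auto
  have "(diff1 ^^ Suc l) (cutoff1 L N m) t
     = ((diff1 ^^ l) (cutoff1 L N m') (t + int L) - (diff1 ^^ l) (cutoff1 L N m') t) / real L"
    unfolding m'(1) funpow_Suc_right o_def diff1_cutoff1[OF assms] diff1_funpow_quotient ..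
  also have "\<bar>\<dots>\<bar> \<le> ((2 / real L) ^ l + (2 / real L) ^ l) / real L"
    unfolding abs_divide abs_of_nat
    using Suc.IH[OF m'(2), of "t + int L"] Suc.IH[OF m'(2), of t]
    by (intro divide_right_mono) auto
  finally show ?case by simp
qed

text \<open>The scale is L = 2^j, and k averages allow k differences. They move the edges by kL, so
  the half-width 2kL of the initial interval leaves a plateau of half-width kL and a support of
  half-width 3kL.\<close>

definition cutoff :: "nat \<Rightarrow> nat \<Rightarrow> int^'n::finite \<Rightarrow> real" where
  "cutoff k j \<xi> = (\<Prod>i\<in>UNIV. cutoff1 (2 ^ j) (2 * k * 2 ^ j) k (\<xi> $ i))"

lemma cutoff_bounds: "0 \<le> cutoff k j \<xi>" "cutoff k j \<xi> \<le> 1"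
  unfolding cutoff_def using cutoff1_bounds[of "2 ^ j"] by (auto intro!: prod_nonneg prod_le_1)

lemma cutoff_eq_1:
  assumes "\<And>i. \<bar>\<xi> $ i\<bar> \<le> int (k * 2 ^ j)"
  shows "cutoff k j \<xi> = 1"
proof -
  have "cutoff1 (2 ^ j) (2 * k * 2 ^ j) k (\<xi> $ i) = 1" for i
    by (rule cutoff1_eq_1) (use assms[of i] in auto)
  then show ?thesis by (simp add: cutoff_def)
qed

lemma cutoff_eq_0:
  assumes "\<bar>\<xi> $ i\<bar> > int (3 * k * 2 ^ j)"
  shows "cutoff k j \<xi> = 0"
proof -
  have "cutoff1 (2 ^ j) (2 * k * 2 ^ j) k (\<xi> $ i) = 0"
    by (rule cutoff1_eq_0) (use assms in auto)
  then show ?thesis by (auto simp: cutoff_def)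
qed

lemma differences_prod:
  fixes g :: "int \<Rightarrow> real"
  shows "(difference i ^^ l) (\<lambda>\<xi>. complex_of_real (\<Prod>i\<in>UNIV. g (\<xi> $ i))) \<xi>
    = complex_of_real ((diff1 ^^ l) g (\<xi> $ i) * (\<Prod>i'\<in>UNIV - {i}. g (\<xi> $ i')))"
proof (induction l arbitrary: \<xi>)
  case 0
  then show ?case by (subst prod.remove[of _ i]) auto
next
  case (Suc l)
  have "(\<Prod>i'\<in>UNIV - {i}. g ((\<xi> + axis i 1) $ i')) = (\<Prod>i'\<in>UNIV - {i}. g (\<xi> $ i'))"
    by (intro prod.cong) (auto simp: axis_def)
  moreover have "(difference i ^^ Suc l) F \<xi> = (difference i ^^ l) F (\<xi> + axis i 1) - (difference i ^^ l) F \<xi>" for F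
    by (simp add: difference_def[of i "(difference i ^^ l) F" \<xi>])
  moreover have "(diff1 ^^ Suc l) g t = (diff1 ^^ l) g (t + 1) - (diff1 ^^ l) g t" for t
    by (simp add: diff1_def[of "(diff1 ^^ l) g" t])
  ultimately show ?case
    by (simp only: Suc left_diff_distrib of_real_diff) (simp add: axis_def of_nat_index)
qed

lemma norm_differences_cutoff_le:
  assumes "l \<le> k"
  shows "norm ((difference i ^^ l) (\<lambda>\<xi>. complex_of_real (cutoff k j \<xi>)) \<xi>) \<le> (2 / 2 ^ j) ^ l"
proof -
  let ?c = "cutoff1 (2 ^ j) (2 * k * 2 ^ j) k"
  have "\<bar>(diff1 ^^ l) ?c (\<xi> $ i) * (\<Prod>i'\<in>UNIV - {i}. ?c (\<xi> $ i'))\<bar> \<le> (2 / 2 ^ j) ^ l * 1"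
    unfolding abs_mult using abs_diff1_cutoff1_le[of "2 ^ j" l k "2 * k * 2 ^ j" "\<xi> $ i"] assms
      cutoff1_bounds[of "2 ^ j"]
    by (intro mult_mono) (auto simp: abs_prod intro!: prod_le_1 prod_nonneg)
  then show ?thesis unfolding cutoff_def differences_prod norm_of_real by simp
qed

section \<open>Dyadic shells and their supports\<close>

definition shell :: "nat \<Rightarrow> nat \<Rightarrow> int^'n::finite \<Rightarrow> real" where
  "shell k j \<xi> = (case j of 0 \<Rightarrow> cutoff k 0 \<xi> | Suc j' \<Rightarrow> cutoff k j \<xi> - cutoff k j' \<xi>)"

lemma sum_shell: "(\<Sum>j\<le>J. shell k j \<xi>) = cutoff k J \<xi>"
  by (induction J) (auto simp: shell_def)

lemma abs_shell_le_1: "\<bar>shell k j \<xi>\<bar> \<le> 1"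
proof (cases j)
  case (Suc j')
  then show ?thesis using cutoff_bounds[of k j \<xi>] cutoff_bounds[of k j' \<xi>] by (auto simp: shell_def)
qed (use cutoff_bounds[of k 0 \<xi>] in \<open>auto simp: shell_def\<close>)

lemma shell_nonzero:
  fixes \<xi> :: "int^'n::finite"
  assumes "shell k j \<xi> \<noteq> 0"
  shows "\<bar>\<xi> $ i\<bar> \<le> int (3 * k * 2 ^ j)" and "j = Suc j' \<Longrightarrow> \<exists>i. \<bar>\<xi> $ i\<bar> > int (k * 2 ^ j')"
proof -
  show "\<bar>\<xi> $ i\<bar> \<le> int (3 * k * 2 ^ j)"
  proof (rule ccontr)
    assume "\<not> ?thesis"
    then have i: "\<bar>\<xi> $ i\<bar> > int (3 * k * 2 ^ j)" by simp
    then have "cutoff k j \<xi> = 0" by (rule cutoff_eq_0)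
    moreover have "cutoff k j' \<xi> = 0" if "j = Suc j'" for j'
    proof (rule cutoff_eq_0)
      have "3 * k * 2 ^ j' \<le> 3 * k * 2 ^ j" using that by simp
      then have "int (3 * k * 2 ^ j') \<le> int (3 * k * 2 ^ j)" by (simp only: of_nat_le_iff)
      then show "\<bar>\<xi> $ i\<bar> > int (3 * k * 2 ^ j')" using i by linarith
    qed
    ultimately show False using assms by (cases j) (auto simp: shell_def)
  qed
  show "\<exists>i. \<bar>\<xi> $ i\<bar> > int (k * 2 ^ j')" if j: "j = Suc j'"
  proof (rule ccontr)
    assume "\<not> ?thesis"
    then have i: "\<bar>\<xi> $ i\<bar> \<le> int (k * 2 ^ j')" for i by (meson not_le)
    have "int (k * 2 ^ j') \<le> int (k * 2 ^ j)" using j by (simp only: of_nat_le_iff) simp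
    then have "cutoff k j \<xi> = 1" by (intro cutoff_eq_1) (use i order_trans in blast)
    moreover have "cutoff k j' \<xi> = 1" by (rule cutoff_eq_1[OF i])
    ultimately show False using assms j by (simp add: shell_def)
  qed
qed

lemma norm_differences_shell_le:
  assumes "l \<le> k"
  shows "norm ((difference i ^^ l) (\<lambda>\<xi>. complex_of_real (shell k j \<xi>)) \<xi>) \<le> 2 * (4 / 2 ^ j) ^ l"
proof (cases j)
  case 0
  have "norm ((difference i ^^ l) (\<lambda>\<xi>. complex_of_real (cutoff k 0 \<xi>)) \<xi>) \<le> (2 / 2 ^ 0) ^ l"
    by (rule norm_differences_cutoff_le[OF assms])
  also have "\<dots> \<le> 4 ^ l" by (simp add: power_mono)
  also have "\<dots> \<le> 2 * 4 ^ l" by simp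
  finally show ?thesis by (simp add: 0 shell_def)
next
  case (Suc j')
  have "norm ((difference i ^^ l) (\<lambda>\<xi>. complex_of_real (cutoff k j \<xi>)) \<xi>) \<le> (2 / 2 ^ j) ^ l"
    by (rule norm_differences_cutoff_le[OF assms])
  moreover have "(2 / 2 ^ j) ^ l \<le> (4 / 2 ^ j :: real) ^ l"
    by (intro power_mono divide_right_mono) auto
  moreover have "norm ((difference i ^^ l) (\<lambda>\<xi>. complex_of_real (cutoff k j' \<xi>)) \<xi>) \<le> (2 / 2 ^ j') ^ l"
    by (rule norm_differences_cutoff_le[OF assms])
  moreover have "(2 / 2 ^ j' :: real) = 4 / 2 ^ j" by (simp add: Suc)
  moreover have "(difference i ^^ l) (\<lambda>\<xi>. complex_of_real (shell k j \<xi>)) \<xi> =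
     (difference i ^^ l) (\<lambda>\<xi>. complex_of_real (cutoff k j \<xi>)) \<xi> - (difference i ^^ l) (\<lambda>\<xi>. complex_of_real (cutoff k j' \<xi>)) \<xi>"
    by (simp add: shell_def Suc differences_diff)
  ultimately show ?thesis
    by (auto intro!: order_trans[OF norm_triangle_ineq4])
qed

definition lattice_box :: "nat \<Rightarrow> (int^'n::finite) set" where
  "lattice_box M = {\<xi>. \<forall>i. \<xi> $ i \<in> {- int M..int M}}"

lemma finite_lattice_box [simp]: "finite (lattice_box M)"
  unfolding lattice_box_def by (rule finite_vec_components) simp

lemma card_lattice_box_le: "card (lattice_box M :: (int^'n::finite) set) \<le> (2 * M + 1) ^ CARD('n)"
proof -
  let ?A = "{- int M..int M}"
  have "(lattice_box M :: (int^'n) set) \<subseteq> vec_lambda ` (UNIV \<rightarrow>\<^sub>E ?A)"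
    unfolding lattice_box_def
    by (auto simp: image_iff) (metis (no_types, lifting) PiE_I UNIV_I atLeastAtMost_iff vec_lambda_eta)
  then have "card (lattice_box M :: (int^'n) set) \<le> card (vec_lambda ` (UNIV \<rightarrow>\<^sub>E ?A) :: (int^'n) set)"
    by (intro card_mono finite_imageI finite_PiE) auto
  also have "\<dots> \<le> card (UNIV \<rightarrow>\<^sub>E ?A :: ('n \<Rightarrow> int) set)" by (intro card_image_le finite_PiE) auto
  also have "\<dots> = (2 * M + 1) ^ CARD('n)" by (simp add: card_PiE nat_add_distrib nat_mult_distrib)
  finally show ?thesis .
qed

text \<open>The margin k of the box accounts for the at most k unit steps by which a difference
  looks ahead.\<close>

lemma shell_differences_support:
  fixes f :: "int^'n::finite \<Rightarrow> complex"
  assumes "\<xi> \<notin> lattice_box (3 * k * 2 ^ j + k)" "l \<le> k"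
  shows "(difference i ^^ l) (\<lambda>\<xi>. f \<xi> * complex_of_real (shell k j \<xi>)) \<xi> = 0"
proof (rule differences_eq_0)
  fix s assume s: "s \<le> l"
  obtain i' where "\<xi> $ i' \<notin> {- int (3 * k * 2 ^ j + k)..int (3 * k * 2 ^ j + k)}"
    using assms(1) unfolding lattice_box_def by blast
  then have i': "\<bar>\<xi> $ i'\<bar> > int (3 * k * 2 ^ j + k)" unfolding atLeastAtMost_iff by linarith
  have "\<bar>(\<xi> + of_nat s * axis i 1) $ i' - \<xi> $ i'\<bar> \<le> int s" by (simp add: axis_def of_nat_index)
  then have "\<bar>(\<xi> + of_nat s * axis i 1) $ i'\<bar> > int (3 * k * 2 ^ j)"
    using i' s assms(2) by simp
  then have "shell k j (\<xi> + of_nat s * axis i 1) = 0" using shell_nonzero(1) by (meson not_le)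
  then show "f (\<xi> + of_nat s * axis i 1) * complex_of_real (shell k j (\<xi> + of_nat s * axis i 1)) = 0" by simp
qed

lemma jbracket_ge_1: "jbracket \<xi> \<ge> 1"
  by (simp add: jbracket_def)

lemma jbracket_ge_component: "jbracket \<xi> \<ge> \<bar>real_of_int (\<xi> $ i)\<bar>"
proof -
  have "\<bar>of_lattice \<xi> $ i\<bar> \<le> norm (of_lattice \<xi>)" by (rule component_le_norm_cart)
  also have "\<dots> \<le> jbracket \<xi>" unfolding jbracket_def by (rule real_le_rsqrt) simp
  finally show ?thesis by (simp add: of_lattice_def)
qed

text \<open>Differences of a piece at \<xi> see the shell at \<xi> + s e_i, whereas the symbol
  bounds involve the bracket at \<xi>. For j >= 3 some coordinate exceeds k 2^(j-1) at the shifted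
  point, and losing k by the shift still leaves 2^(j-2). For j <= 2 the trivial bound 1 is
  enough.\<close>

lemma jbracket_ge_near_shell:
  fixes \<xi> :: "int^'n::finite"
  assumes nz: "shell k j (\<xi> + of_nat s * axis i 1) \<noteq> 0" and s: "s \<le> k" and k: "k > 0"
  shows "jbracket \<xi> \<ge> 2 ^ j / 4"
proof (cases "j \<le> 2")
  case True
  then have "j = 0 \<or> j = 1 \<or> j = 2" by auto
  then show ?thesis using jbracket_ge_1[of \<xi>] by auto
next
  case False
  define m where "m = j - 3"
  have j: "j = Suc (Suc (Suc m))" using False by (simp add: m_def)
  obtain i' where i': "\<bar>(\<xi> + of_nat s * axis i 1) $ i'\<bar> > int (k * 2 ^ Suc (Suc m))"
    using shell_nonzero(2)[OF nz j] by auto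
  have "\<bar>(\<xi> + of_nat s * axis i 1) $ i' - \<xi> $ i'\<bar> \<le> int k" using s by (simp add: axis_def of_nat_index)
  then have "\<bar>\<xi> $ i'\<bar> \<ge> int (k * 2 ^ Suc (Suc m)) - int k" using i' by linarith
  moreover have "k * 2 ^ Suc (Suc m) \<ge> k + 2 ^ Suc m"
  proof -
    have "k * 2 ^ Suc (Suc m) = k * 2 ^ Suc m + k * 2 ^ Suc m" by simp
    moreover have "k * 2 ^ Suc m \<ge> k" by simp
    moreover have "k * 2 ^ Suc m \<ge> 2 ^ Suc m" using k by simp
    ultimately show ?thesis by linarith
  qed
  ultimately have "\<bar>\<xi> $ i'\<bar> \<ge> int (2 ^ Suc m)" by linarith
  then have "real_of_int \<bar>\<xi> $ i'\<bar> \<ge> real_of_int (int (2 ^ Suc m))" by (simp only: of_int_le_iff)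
  then show ?thesis using jbracket_ge_component[of \<xi> i'] by (simp add: j)
qed

subsection \<open>Dyadic pieces of the symbol\<close>

text \<open>For a multi-index supported in one coordinate all other factors are identities, so the
  unspecified enumeration \<open>coords\<close> drops out.\<close>

lemma foldr_funpow_single:
  assumes "distinct js"
  shows "foldr (\<lambda>j. F j ^^ (if j = i then l else 0)) js f = (if i \<in> set js then (F i ^^ l) f else f)"
  using assms by (induction js) auto

lemma coords_props: "distinct (coords :: 'n::finite list)" "set (coords :: 'n list) = UNIV"
proof -
  have "\<exists>js :: 'n list. distinct js \<and> set js = UNIV"
    using finite_distinct_list[OF finite, of "UNIV :: 'n set"] by auto
  from someI_ex[OF this] show "distinct (coords :: 'n list)" "set (coords :: 'n list) = UNIV"
    by (auto simp: coords_def)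
qed

lemma differences_single: "differences (\<lambda>j. if j = i then l else 0) f = (difference i ^^ l) f"
  unfolding differences_def by (subst foldr_funpow_single) (auto simp: coords_props)

lemma partials_single: "partials (\<lambda>j. if j = i then l else 0) f = (partial i ^^ l) f"
  unfolding partials_def by (subst foldr_funpow_single) (auto simp: coords_props)

lemma mi_order_single: "mi_order (\<lambda>j. if j = i then l else 0) = l"
  by (simp add: mi_order_def)

section \<open>Lipschitz bounds from derivatives along the axes\<close>

lemma has_vector_derivative_axis:
  assumes "\<And>y. (\<lambda>t. g (y + t *\<^sub>R axis i 1)) differentiable (at 0)"
  shows "((\<lambda>t. g (x + t *\<^sub>R axis i 1)) has_vector_derivative partial i g (x + s *\<^sub>R axis i 1)) (at s)"
proof -
  have "((\<lambda>t. g ((x + s *\<^sub>R axis i 1) + t *\<^sub>R axis i 1)) has_vector_derivative partial i g (x + s *\<^sub>R axis i 1)) (at 0)"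
    using assms unfolding vector_derivative_works partial_def .
  moreover have shift: "((\<lambda>t. t - s) has_vector_derivative 1) (at s)"
    by (auto intro!: derivative_eq_intros simp: has_real_derivative_iff_has_vector_derivative[symmetric])
  ultimately have "((\<lambda>t. g ((x + s *\<^sub>R axis i 1) + (t - s) *\<^sub>R axis i 1)) has_vector_derivative partial i g (x + s *\<^sub>R axis i 1)) (at s)"
    using vector_diff_chain_at[of "\<lambda>t. t - s" 1 s "\<lambda>t. g ((x + s *\<^sub>R axis i 1) + t *\<^sub>R axis i 1)", OF shift]
    by (simp add: o_def)
  then show ?thesis by (simp add: algebra_simps)
qed

lemma lipschitz_axis:
  fixes g :: "real^'n::finite \<Rightarrow> complex"
  assumes d: "\<And>y. (\<lambda>t. g (y + t *\<^sub>R axis i 1)) differentiable (at 0)"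
    and B: "\<And>y. norm (partial i g y) \<le> B"
  shows "norm (g (x + t *\<^sub>R axis i 1) - g x) \<le> B * \<bar>t\<bar>"
proof -
  have "norm (g (x + t *\<^sub>R axis i 1) - g (x + 0 *\<^sub>R axis i 1)) \<le> B * norm (t - 0)"
  proof (rule differentiable_bound[where S = UNIV])
    fix s :: real
    show "((\<lambda>t. g (x + t *\<^sub>R axis i 1)) has_derivative (\<lambda>u. u *\<^sub>R partial i g (x + s *\<^sub>R axis i 1))) (at s within UNIV)"
      using has_vector_derivative_axis[OF d] by (simp add: has_vector_derivative_def)
    show "onorm (\<lambda>u. u *\<^sub>R partial i g (x + s *\<^sub>R axis i 1)) \<le> B"
      by (rule onorm_le) (use B in \<open>auto simp: mult.commute[of B] intro!: mult_left_mono\<close>)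
  qed auto
  then show ?thesis by simp
qed

lemma lipschitz_coordinates:
  fixes g :: "real^'n::finite \<Rightarrow> complex"
  assumes d: "\<And>i y. (\<lambda>t. g (y + t *\<^sub>R axis i 1)) differentiable (at 0)"
    and B: "\<And>i y. norm (partial i g y) \<le> B"
  shows "norm (g x - g y) \<le> B * (\<Sum>i\<in>UNIV. \<bar>x $ i - y $ i\<bar>)"
proof -
  \<comment> \<open>Since only derivatives along the axes are available, the path from x to y
    changes one coordinate at a time; \<open>z A\<close> is the corner at which the coordinates in
    \<open>A\<close> have been replaced.\<close>
  define z where "z = (\<lambda>A. (\<chi> i. if i \<in> A then y $ i else x $ i))"
  have "norm (g x - g (z A)) \<le> B * (\<Sum>i\<in>A. \<bar>x $ i - y $ i\<bar>)" if "finite A" for A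
    using that
  proof (induction A)
    case empty
    then show ?case by (simp add: z_def)
  next
    case (insert i A)
    have e: "z (insert i A) = z A + (y $ i - x $ i) *\<^sub>R axis i 1"
      using insert.hyps by (auto simp: z_def vec_eq_iff axis_def)
    have "norm (g (z (insert i A)) - g (z A)) \<le> B * \<bar>y $ i - x $ i\<bar>"
      unfolding e by (rule lipschitz_axis[OF d B])
    then have "norm (g x - g (z (insert i A))) \<le> B * (\<Sum>i\<in>A. \<bar>x $ i - y $ i\<bar>) + B * \<bar>y $ i - x $ i\<bar>"
      using norm_triangle_ineq[of "g x - g (z A)" "g (z A) - g (z (insert i A))"] insert.IH
      by (simp add: norm_minus_commute)
    then show ?case using insert.hyps by (simp add: algebra_simps abs_minus_commute)
  qed
  from this[of UNIV] show ?thesis by (simp add: z_def)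
qed

definition piece :: "nat \<Rightarrow> (real^'n::finite \<Rightarrow> int^'n \<Rightarrow> complex) \<Rightarrow> nat \<Rightarrow> real^'n \<Rightarrow> int^'n \<Rightarrow> complex" where
  "piece k a j x = (\<lambda>\<xi>. a x \<xi> * complex_of_real (shell k j \<xi>))"

lemma piece_support:
  "\<xi> \<notin> lattice_box (3 * k * 2 ^ j + k) \<Longrightarrow> l \<le> k \<Longrightarrow> (difference i ^^ l) (piece k a j x) \<xi> = 0"
  unfolding piece_def by (rule shell_differences_support)

lemma piece_support0:
  "\<xi> \<notin> lattice_box (3 * k * 2 ^ j + k) \<Longrightarrow> piece k a j x \<xi> = 0"
  using piece_support[where l = 0] by simp

lemma jbracket_powr_le:
  assumes "jbracket \<xi> \<ge> 2 ^ j / 4" and "0 \<le> u" "u \<le> U"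
  shows "jbracket \<xi> powr (- u) \<le> 4 powr U * (2 ^ j) powr (- u)"
proof -
  have powr_quarter: "(Q / 4) powr (- u) = 4 powr u * Q powr (- u)" if "Q > 0" for Q :: real
    using that by (simp add: powr_divide powr_minus_divide)
  have "jbracket \<xi> powr (- u) \<le> (2 ^ j / 4) powr (- u)"
    by (rule powr_mono2') (use assms in auto)
  also have "\<dots> = 4 powr u * (2 ^ j) powr (- u)"
    using powr_quarter[of "2 ^ j"] by simp
  also have "\<dots> \<le> 4 powr U * (2 ^ j) powr (- u)"
    using assms by (intro mult_right_mono powr_mono) auto
  finally show ?thesis .
qed

text \<open>Either the shell vanishes at all points seen by the difference, or the bracket at \<xi>
  is at least 2^j / 4 and the Leibniz bound applies.\<close>

lemma norm_differences_piece_le: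
  fixes a :: "real^'n::finite \<Rightarrow> int^'n \<Rightarrow> complex"
  assumes k: "k > 0" and eps: "0 < \<epsilon>" "\<epsilon> < 1" and C: "0 \<le> C" and \<mu>: "0 \<le> \<mu>"
    and a: "\<And>i l x \<xi>. l \<le> k \<Longrightarrow> norm ((difference i ^^ l) (a x) \<xi>) \<le> C * jbracket \<xi> powr (- \<mu> - (1 - \<epsilon>) * real l)"
    and l: "l \<le> k"
  shows "norm ((difference i ^^ l) (piece k a j x) \<xi>)
     \<le> (C * 4 powr \<mu> * 2 * 8 ^ l) * (2 ^ j) powr (- \<mu> - (1 - \<epsilon>) * real l)"
proof (cases "\<exists>s\<le>l. shell k j (\<xi> + of_nat s * axis i 1) \<noteq> 0")
  case False
  then have "(difference i ^^ l) (piece k a j x) \<xi> = 0"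
    by (intro differences_eq_0) (auto simp: piece_def)
  then show ?thesis using C by simp
next
  case True
  then obtain s where s: "s \<le> l" "shell k j (\<xi> + of_nat s * axis i 1) \<noteq> 0" by auto
  have J: "jbracket \<xi> \<ge> 2 ^ j / 4" by (rule jbracket_ge_near_shell[OF s(2)]) (use s l k in auto)
  \<comment> \<open>A common rate for both factors. The cutoff varies at the faster decaying rate 4
    / 2^j, and the 4 also absorbs the loss 4^m from replacing the bracket by 2^j. Leibniz doubles
    it, which gives 8^l.\<close>
  define r where "r = 4 * (2 ^ j) powr (- (1 - \<epsilon>))"
  have rpow: "r ^ m = 4 ^ m * (2 ^ j) powr (- (1 - \<epsilon>) * real m)" for m
    by (simp add: r_def power_mult_distrib powr_power mult.commute)
  have r0: "0 \<le> r" by (simp add: r_def)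
  have fb: "norm ((difference i ^^ m) (a x) \<xi>) \<le> (C * 4 powr \<mu> * (2 ^ j) powr (- \<mu>)) * r ^ m" if m: "m \<le> l" for m
  proof -
    have "norm ((difference i ^^ m) (a x) \<xi>) \<le> C * jbracket \<xi> powr (- (\<mu> + (1 - \<epsilon>) * real m))"
      using a[of m i x \<xi>] m l by simp
    \<comment> \<open>The constant is taken at the larger exponent \<mu> + m so that it splits into
      4^\<mu> and 4^m.\<close>
    also have "\<dots> \<le> C * (4 powr (\<mu> + real m) * (2 ^ j) powr (- (\<mu> + (1 - \<epsilon>) * real m)))"
      using eps \<mu> C by (intro mult_left_mono jbracket_powr_le J) (auto intro: mult_left_le_one_le)
    also have "\<dots> = (C * 4 powr \<mu> * (2 ^ j) powr (- \<mu>)) * r ^ m"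
    proof -
      have 1: "4 powr (\<mu> + real m) = 4 powr \<mu> * 4 ^ m" by (simp add: powr_add powr_realpow)
      have 2: "Q powr (- (\<mu> + (1 - \<epsilon>) * real m)) = Q powr (- \<mu>) * Q powr (- (1 - \<epsilon>) * real m)" for Q :: real
        by (simp add: powr_add[symmetric] algebra_simps)
      show ?thesis unfolding rpow 1 2 by (simp only: mult_ac)
    qed
    finally show ?thesis .
  qed
  have gb: "norm ((difference i ^^ m) (\<lambda>\<xi>. complex_of_real (shell k j \<xi>)) \<eta>) \<le> 2 * r ^ m" if m: "m \<le> l" for m \<eta>
  proof -
    have "norm ((difference i ^^ m) (\<lambda>\<xi>. complex_of_real (shell k j \<xi>)) \<eta>) \<le> 2 * (4 / 2 ^ j) ^ m"
      by (rule norm_differences_shell_le) (use m l in auto)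
    also have "\<dots> \<le> 2 * r ^ m"
    proof (intro mult_left_mono power_mono)
      have "(2 ^ j :: real) powr (-1) \<le> (2 ^ j) powr (- (1 - \<epsilon>))" using eps by (intro powr_mono) auto
      then show "4 / 2 ^ j \<le> r" by (simp add: r_def powr_minus divide_inverse)
    qed auto
    finally show ?thesis .
  qed
  have "norm ((difference i ^^ l) (piece k a j x) \<xi>) \<le> (C * 4 powr \<mu> * (2 ^ j) powr (- \<mu>)) * 2 * (2 * r) ^ l"
    unfolding piece_def by (rule norm_differences_mult_le[OF fb gb]) (use C r0 in auto)
  also have "(2 * r) ^ l = 8 ^ l * (2 ^ j) powr (- (1 - \<epsilon>) * real l)"
    by (simp add: power_mult_distrib rpow) (simp flip: power_mult_distrib)
  also have "(C * 4 powr \<mu> * (2 ^ j) powr (- \<mu>)) * 2 * (8 ^ l * (2 ^ j) powr (- (1 - \<epsilon>) * real l))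
     = (C * 4 powr \<mu> * 2 * 8 ^ l) * ((2 ^ j) powr (- \<mu>) * (2 ^ j) powr (- (1 - \<epsilon>) * real l))"
    by (simp only: mult_ac)
  also have "(2 ^ j) powr (- \<mu>) * (2 ^ j) powr (- (1 - \<epsilon>) * real l) = (2 ^ j :: real) powr (- \<mu> - (1 - \<epsilon>) * real l)"
    by (simp add: powr_add[symmetric] algebra_simps)
  finally show ?thesis .
qed

lemma piece_lipschitz:
  fixes a :: "real^'n::finite \<Rightarrow> int^'n \<Rightarrow> complex"
  assumes k: "k > 0" and C: "0 \<le> C" and \<mu>: "0 \<le> \<mu>"
    and a: "\<And>x y \<xi>. norm (a x \<xi> - a y \<xi>) \<le> C * jbracket \<xi> powr (- \<mu>) * (\<Sum>i\<in>UNIV. \<bar>x $ i - y $ i\<bar>)"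
  shows "norm (piece k a j x \<xi> - piece k a j y \<xi>) \<le> C * 4 powr \<mu> * (2 ^ j) powr (- \<mu>) * (\<Sum>i\<in>UNIV. \<bar>x $ i - y $ i\<bar>)"
proof (cases "shell k j \<xi> = 0")
  case True
  then show ?thesis using C by (simp add: piece_def sum_nonneg)
next
  case False
  fix i0 :: 'n
  have J: "jbracket \<xi> \<ge> 2 ^ j / 4"
    using jbracket_ge_near_shell[of k j \<xi> 0 i0] False k by simp
  have "norm (piece k a j x \<xi> - piece k a j y \<xi>) = norm (a x \<xi> - a y \<xi>) * \<bar>shell k j \<xi>\<bar>"
    by (simp add: piece_def left_diff_distrib[symmetric] norm_mult)
  also have "\<dots> \<le> norm (a x \<xi> - a y \<xi>) * 1" using abs_shell_le_1 by (intro mult_left_mono) auto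
  also have "\<dots> \<le> C * jbracket \<xi> powr (- \<mu>) * (\<Sum>i\<in>UNIV. \<bar>x $ i - y $ i\<bar>)" using a by simp
  also have "\<dots> \<le> C * (4 powr \<mu> * (2 ^ j) powr (- \<mu>)) * (\<Sum>i\<in>UNIV. \<bar>x $ i - y $ i\<bar>)"
    using C \<mu> by (intro mult_right_mono mult_left_mono jbracket_powr_le J) (auto simp: sum_nonneg)
  finally show ?thesis by (simp add: mult_ac)
qed

lemma card_piece_box:
  assumes "k > 0"
  shows "real (card (lattice_box (3 * k * 2 ^ j + k) :: (int^'n::finite) set)) \<le> (9 * real k) ^ CARD('n) * (2 ^ j) ^ CARD('n)"
proof -
  have "2 * (3 * k * 2 ^ j + k) + 1 \<le> 9 * k * 2 ^ j"
  proof -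
    have "k \<le> k * 2 ^ j" by simp
    moreover have "1 \<le> k * 2 ^ j" using assms by (simp add: Suc_le_eq)
    moreover have "2 * (3 * k * 2 ^ j + k) + 1 = 6 * (k * 2 ^ j) + 2 * k + 1" by simp
    moreover have "9 * k * 2 ^ j = 6 * (k * 2 ^ j) + 3 * (k * 2 ^ j)" by simp
    ultimately show ?thesis by linarith
  qed
  then have "card (lattice_box (3 * k * 2 ^ j + k) :: (int^'n) set) \<le> (9 * k * 2 ^ j) ^ CARD('n)"
    using card_lattice_box_le[where 'n = 'n and M = "3 * k * 2 ^ j + k"] by (meson order_trans power_mono le0)
  then have "real (card (lattice_box (3 * k * 2 ^ j + k) :: (int^'n) set)) \<le> real ((9 * k * 2 ^ j) ^ CARD('n))"
    by (simp only: of_nat_le_iff)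
  then show ?thesis by (simp add: power_mult_distrib)
qed

text \<open>The choice of \<open>t\<close> gives t^(2k) = 2^(2jk(1-\<epsilon>)) h^2. This supplies
  the factor h^2 missing from the difference term and cancels its additional decay, so both terms
  have the same order. Later h = 1 serves the sup norm and small h the freezing error.\<close>

lemma weighted_l2_bound:
  fixes b :: "int^'n::finite \<Rightarrow> complex"
  defines "n \<equiv> real CARD('n)"
  assumes k: "k > 0" and h: "0 < h" "h \<le> 1" and A: "0 \<le> A"
    and b0: "\<And>\<xi>. norm (b \<xi>) \<le> A * h * (2 ^ j) powr (- (n / 2 * \<epsilon>))"
    and bk: "\<And>i \<xi>. norm ((difference i ^^ k) b \<xi>) \<le> A * (2 ^ j) powr (- (n / 2 * \<epsilon>) - (1 - \<epsilon>) * real k)"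
    and t: "t = (2 ^ j) powr (1 - \<epsilon>) * h powr (1 / real k)"
    and S: "S = lattice_box (3 * k * 2 ^ j + k)"
  shows "(\<Sum>\<xi>\<in>S. (norm (b \<xi>))\<^sup>2) + t ^ (2 * k) * (\<Sum>i\<in>UNIV. \<Sum>\<xi>\<in>S. (norm ((difference i ^^ k) b \<xi>))\<^sup>2)
    \<le> ((9 * real k) ^ CARD('n) * (1 + n) * A\<^sup>2) * h\<^sup>2 * (2 ^ j) powr (n * (1 - \<epsilon>))"
proof -
  define Q where "Q = (2::real) ^ j"
  have Q: "Q > 0" by (simp add: Q_def)
  have cS: "real (card S) \<le> (9 * real k) ^ CARD('n) * Q powr n"
    using card_piece_box[OF k, of j, where 'n = 'n] Q by (simp add: S Q_def n_def powr_realpow)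
  have sq: "(Q powr u)\<^sup>2 = Q powr (2 * u)" for u by (simp add: power2_eq_square powr_add[symmetric])
  have "(\<Sum>\<xi>\<in>S. (norm (b \<xi>))\<^sup>2) \<le> (\<Sum>\<xi>\<in>S. (A * h * Q powr (- (n / 2 * \<epsilon>)))\<^sup>2)"
    using b0 by (intro sum_mono power_mono) (auto simp: Q_def)
  also have "\<dots> = real (card S) * (A\<^sup>2 * h\<^sup>2 * Q powr (- n * \<epsilon>))"
    by (simp add: power_mult_distrib sq)
  finally have 1: "(\<Sum>\<xi>\<in>S. (norm (b \<xi>))\<^sup>2) \<le> real (card S) * (A\<^sup>2 * h\<^sup>2 * Q powr (- n * \<epsilon>))" .
  have tk: "t ^ (2 * k) = Q powr (2 * (1 - \<epsilon>) * real k) * h\<^sup>2"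
  proof -
    have "t ^ (2 * k) = Q powr ((1 - \<epsilon>) * real (2 * k)) * h powr (1 / real k * real (2 * k))"
      unfolding t Q_def[symmetric] power_mult_distrib using Q h k by (subst (1 2) powr_power) (auto simp: algebra_simps)
    also have "h powr (1 / real k * real (2 * k)) = h\<^sup>2" using k h by (simp add: powr_numeral)
    finally show ?thesis by (simp add: mult_ac)
  qed
  have "(\<Sum>i\<in>UNIV. \<Sum>\<xi>\<in>S. (norm ((difference i ^^ k) b \<xi>))\<^sup>2)
     \<le> (\<Sum>i\<in>(UNIV::'n set). \<Sum>\<xi>\<in>S. (A * Q powr (- (n / 2 * \<epsilon>) - (1 - \<epsilon>) * real k))\<^sup>2)"
    using bk by (intro sum_mono power_mono) (auto simp: Q_def)
  also have "\<dots> = n * (real (card S) * (A\<^sup>2 * Q powr (- n * \<epsilon> - 2 * (1 - \<epsilon>) * real k)))"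
    by (simp add: power_mult_distrib sq n_def algebra_simps)
  finally have "t ^ (2 * k) * (\<Sum>i\<in>UNIV. \<Sum>\<xi>\<in>S. (norm ((difference i ^^ k) b \<xi>))\<^sup>2)
     \<le> t ^ (2 * k) * (n * (real (card S) * (A\<^sup>2 * Q powr (- n * \<epsilon> - 2 * (1 - \<epsilon>) * real k))))"
    unfolding tk by (intro mult_left_mono) auto
  also have "\<dots> = n * real (card S) * A\<^sup>2 * h\<^sup>2 * (Q powr (2 * (1 - \<epsilon>) * real k) * Q powr (- n * \<epsilon> - 2 * (1 - \<epsilon>) * real k))"
    unfolding tk by (simp only: mult_ac)
  also have "\<dots> = n * real (card S) * A\<^sup>2 * h\<^sup>2 * Q powr (- n * \<epsilon>)" by (simp add: powr_add[symmetric])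
  finally have "(\<Sum>\<xi>\<in>S. (norm (b \<xi>))\<^sup>2) + t ^ (2 * k) * (\<Sum>i\<in>UNIV. \<Sum>\<xi>\<in>S. (norm ((difference i ^^ k) b \<xi>))\<^sup>2)
     \<le> real (card S) * ((1 + n) * A\<^sup>2 * h\<^sup>2 * Q powr (- n * \<epsilon>))"
    using 1 by (simp add: algebra_simps)
  also have "\<dots> \<le> ((9 * real k) ^ CARD('n) * Q powr n) * ((1 + n) * A\<^sup>2 * h\<^sup>2 * Q powr (- n * \<epsilon>))"
    by (intro mult_right_mono cS) (auto simp: n_def)
  also have "\<dots> = ((9 * real k) ^ CARD('n) * (1 + n) * A\<^sup>2) * h\<^sup>2 * (Q powr n * Q powr (- n * \<epsilon>))"
    by (simp only: mult_ac)
  also have "Q powr n * Q powr (- n * \<epsilon>) = Q powr (n * (1 - \<epsilon>))"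
    by (simp add: powr_add[symmetric] algebra_simps)
  finally show ?thesis by (simp add: Q_def)
qed

subsection \<open>Interpolation between L2 and L-infinity\<close>

lemma nn_integral_powr_interval:
  assumes "q > 0" "s \<ge> 0"
  shows "(\<integral>\<^sup>+l. ennreal (l powr (q - 1)) * indicator {0..s} l \<partial>lborel) = ennreal (s powr q / q)"
  using nn_integral_has_integral_lebesgue'[OF _ has_integral_powr_from_0[of "q - 1" s]] assms by simp

text \<open>By Tonelli, the level integral of l^(p-3) up to c|h(x)| is a multiple of |h(x)|^(p-2),
  which the factor |h(x)|^2 completes to |h(x)|^p. Weighting each level by |h|^2 instead of
  measuring superlevel sets lets the L2 bound act directly on every level.\<close>

lemma layer_cake_L2_Lp:
  fixes h :: "real^'n::finite \<Rightarrow> complex"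
  assumes h [measurable]: "h \<in> borel_measurable torus_measure" and p: "2 < p" and c: "0 \<le> c"
  shows "(\<integral>\<^sup>+l. \<integral>\<^sup>+x. ennreal (l powr (p - 3)) * indicator {0..c * norm (h x)} l * ennreal ((norm (h x))\<^sup>2) \<partial>torus_measure \<partial>lborel)
    = ennreal (c powr (p - 2) / (p - 2)) * (\<integral>\<^sup>+x. ennreal (norm (h x) powr p) \<partial>torus_measure)"
proof -
  let ?M = "torus_measure :: (real^'n) measure"
  interpret M: finite_measure ?M by (rule finite_measure_torus)
  interpret P: pair_sigma_finite ?M lborel ..
  have [measurable]: "(\<lambda>p. h (fst p)) \<in> borel_measurable (?M \<Otimes>\<^sub>M lborel)"
    by (rule measurable_compose[OF measurable_fst h])
  have [measurable]: "(\<lambda>p :: (real^'n) \<times> real. snd p) \<in> borel_measurable (?M \<Otimes>\<^sub>M lborel)"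
    using measurable_snd[of ?M "lborel :: real measure"] by simp
  have ind: "indicator {0..c * norm (h x)} l = (if 0 \<le> l \<and> l \<le> c * norm (h x) then 1 else 0 :: ennreal)" for x l
    by (simp add: indicator_def)
  have "(\<integral>\<^sup>+l. \<integral>\<^sup>+x. ennreal (l powr (p - 3)) * indicator {0..c * norm (h x)} l * ennreal ((norm (h x))\<^sup>2) \<partial>?M \<partial>lborel)
     = (\<integral>\<^sup>+x. \<integral>\<^sup>+l. ennreal (l powr (p - 3)) * indicator {0..c * norm (h x)} l * ennreal ((norm (h x))\<^sup>2) \<partial>lborel \<partial>?M)"
    by (rule P.Fubini') (simp add: ind case_prod_beta')
  also have "\<dots> = (\<integral>\<^sup>+x. ennreal (c powr (p - 2) / (p - 2)) * ennreal (norm (h x) powr p) \<partial>?M)"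
  proof (rule nn_integral_cong)
    fix x
    have "(\<integral>\<^sup>+l. ennreal (l powr (p - 3)) * indicator {0..c * norm (h x)} l * ennreal ((norm (h x))\<^sup>2) \<partial>lborel)
       = (\<integral>\<^sup>+l. ennreal (l powr ((p - 2) - 1)) * indicator {0..c * norm (h x)} l \<partial>lborel) * ennreal ((norm (h x))\<^sup>2)"
      by (subst nn_integral_multc) auto
    also have "\<dots> = ennreal ((c * norm (h x)) powr (p - 2) / (p - 2)) * ennreal ((norm (h x))\<^sup>2)"
      using p c by (subst nn_integral_powr_interval) auto
    also have "\<dots> = ennreal (c powr (p - 2) / (p - 2) * (norm (h x) powr (p - 2) * norm (h x) powr 2))"
      using p c by (simp add: ennreal_mult[symmetric] powr_mult)
    also have "norm (h x) powr (p - 2) * norm (h x) powr 2 = norm (h x) powr p"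
      by (simp only: powr_add[symmetric]) simp
    finally show "(\<integral>\<^sup>+l. ennreal (l powr (p - 3)) * indicator {0..c * norm (h x)} l * ennreal ((norm (h x))\<^sup>2) \<partial>lborel)
       = ennreal (c powr (p - 2) / (p - 2)) * ennreal (norm (h x) powr p)"
      using p by (simp add: ennreal_mult[symmetric])
  qed
  also have "\<dots> = ennreal (c powr (p - 2) / (p - 2)) * (\<integral>\<^sup>+x. ennreal (norm (h x) powr p) \<partial>?M)"
    by (rule nn_integral_cmult) measurable
  finally show ?thesis .
qed

lemma L2_restrict:
  assumes f: "L2 f" and P: "{x \<in> space torus_measure. P x} \<in> sets torus_measure"
  shows "L2 (\<lambda>x. if P x then f x else 0)"
proof -
  have [measurable]: "f \<in> borel_measurable torus_measure" using f by (simp add: L2_def)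
  have m: "(\<lambda>x. if P x then f x else 0) \<in> borel_measurable torus_measure"
    by (rule measurable_If) (use P in auto)
  moreover have "integrable torus_measure (\<lambda>x. (norm (if P x then f x else 0))\<^sup>2)"
  proof (rule Bochner_Integration.integrable_bound)
    show "integrable torus_measure (\<lambda>x. (norm (f x))\<^sup>2)" using f by (simp add: L2_def)
    show "(\<lambda>x. (norm (if P x then f x else 0))\<^sup>2) \<in> borel_measurable torus_measure"
      using m by measurable
  qed auto
  ultimately show ?thesis by (simp add: L2_def)
qed

text \<open>Truncation at a height proportional to the level. The squared L2 bound \<open>A\<close>
  enters the p-th power estimate linearly, so geometric decay in L2 survives for every finite
  p.\<close>

lemma marcinkiewicz_L2_Linf:
  fixes T :: "(real^'n::finite \<Rightarrow> complex) \<Rightarrow> real^'n \<Rightarrow> complex"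
  assumes p: "2 < p" and A: "0 \<le> A" and B: "0 < B"
    and add: "\<And>f g x. L2 f \<Longrightarrow> L2 g \<Longrightarrow> T (\<lambda>x. f x + g x) x = T f x + T g x"
    and meas: "\<And>f. L2 f \<Longrightarrow> T f \<in> borel_measurable torus_measure"
    and Linf: "\<And>f m x. L2 f \<Longrightarrow> 0 \<le> m \<Longrightarrow> (\<And>y. y \<in> cbox 0 1 \<Longrightarrow> norm (f y) \<le> m) \<Longrightarrow> x \<in> cbox 0 1
      \<Longrightarrow> norm (T f x) \<le> B * m"
    and L2: "\<And>f. L2 f \<Longrightarrow> (\<integral>\<^sup>+x. ennreal ((norm (T f x))\<^sup>2) \<partial>torus_measure)
      \<le> ennreal A * (\<integral>\<^sup>+x. ennreal ((norm (f x))\<^sup>2) \<partial>torus_measure)"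
    and f: "L2 f"
  shows "(\<integral>\<^sup>+x. ennreal (norm (T f x) powr p) \<partial>torus_measure)
    \<le> ennreal (4 * A * (2 * B) powr (p - 2)) * (\<integral>\<^sup>+x. ennreal (norm (f x) powr p) \<partial>torus_measure)"
proof -
  let ?M = "torus_measure :: (real^'n) measure"
  have fm [measurable]: "f \<in> borel_measurable ?M" using f by (simp add: L2_def)
  note [measurable] = meas[OF f]
  have level: "(\<integral>\<^sup>+x. ennreal (l powr (p - 3)) * indicator {0..1 * norm (T f x)} l * ennreal ((norm (T f x))\<^sup>2) \<partial>?M)
    \<le> ennreal (4 * A) * (\<integral>\<^sup>+x. ennreal (l powr (p - 3)) * indicator {0..2 * B * norm (f x)} l * ennreal ((norm (f x))\<^sup>2) \<partial>?M)" for l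
  proof (cases "l > 0")
    case False
    \<comment> \<open>At l = 0 the convention 0 powr s = 0 removes the possible singularity;
      negative levels lie outside the interval.\<close>
    then have "l powr (p - 3) = 0 \<or> l < 0" by auto
    then show ?thesis by (auto simp: indicator_def)
  next
    case True
    define P where "P = (\<lambda>x. l \<le> 2 * B * norm (f x))"
    have Ps: "{x \<in> space ?M. P x} \<in> sets ?M" unfolding P_def by measurable
    have nPs: "{x \<in> space ?M. \<not> P x} \<in> sets ?M" unfolding P_def by measurable
    define f1 where "f1 = (\<lambda>x. if P x then f x else 0)"
    define f2 where "f2 = (\<lambda>x. if \<not> P x then f x else 0)"
    have f1: "L2 f1" unfolding f1_def by (rule L2_restrict[OF f Ps])
    have f2: "L2 f2" unfolding f2_def by (rule L2_restrict[OF f nPs])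
    have ff: "f = (\<lambda>x. f1 x + f2 x)" by (auto simp: f1_def f2_def)
    note [measurable] = meas[OF f1]
    have [measurable]: "f1 \<in> borel_measurable ?M" using f1 by (simp add: L2_def)
    have "(\<integral>\<^sup>+x. ennreal (l powr (p - 3)) * indicator {0..1 * norm (T f x)} l * ennreal ((norm (T f x))\<^sup>2) \<partial>?M)
       \<le> (\<integral>\<^sup>+x. ennreal (l powr (p - 3) * 4) * ennreal ((norm (T f1 x))\<^sup>2) \<partial>?M)"
    proof (rule nn_integral_mono)
      fix x :: "real^'n" assume "x \<in> space ?M"
      then have x: "x \<in> cbox 0 1" by simp
      show "ennreal (l powr (p - 3)) * indicator {0..1 * norm (T f x)} l * ennreal ((norm (T f x))\<^sup>2)
        \<le> ennreal (l powr (p - 3) * 4) * ennreal ((norm (T f1 x))\<^sup>2)"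
      proof (cases "l \<le> norm (T f x)")
        case l: True
        \<comment> \<open>The part of \<open>f\<close> below l / (2B) contributes at most half of
          the level l. Where |T f| >= l, the other part therefore dominates: |T f| <= 2 |T f1|, and
          squaring produces the 4 in the constant.\<close>
        have "norm (T f2 x) \<le> B * (l / (2 * B))"
          using True B by (intro Linf f2 x) (auto simp: f2_def P_def field_simps)
        then have "norm (T f2 x) \<le> l / 2" using B by simp
        moreover have "T f x = T f1 x + T f2 x" by (subst ff) (rule add[OF f1 f2])
        ultimately have "norm (T f x) \<le> 2 * norm (T f1 x)"
          using l norm_triangle_ineq[of "T f1 x" "T f2 x"] by simp
        then have "(norm (T f x))\<^sup>2 \<le> (2 * norm (T f1 x))\<^sup>2" by (intro power_mono) auto
        then have "l powr (p - 3) * (norm (T f x))\<^sup>2 \<le> l powr (p - 3) * (4 * (norm (T f1 x))\<^sup>2)"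
          by (intro mult_left_mono) (auto simp: power_mult_distrib)
        then show ?thesis using l True
          by (simp add: ennreal_mult[symmetric] mult_ac ennreal_leI)
      qed simp
    qed
    also have "\<dots> = ennreal (l powr (p - 3) * 4) * (\<integral>\<^sup>+x. ennreal ((norm (T f1 x))\<^sup>2) \<partial>?M)"
      by (rule nn_integral_cmult) measurable
    also have "\<dots> \<le> ennreal (l powr (p - 3) * 4) * (ennreal A * (\<integral>\<^sup>+x. ennreal ((norm (f1 x))\<^sup>2) \<partial>?M))"
      by (intro mult_left_mono L2 f1) simp
    also have "\<dots> = ennreal (4 * A) * (ennreal (l powr (p - 3)) * (\<integral>\<^sup>+x. ennreal ((norm (f1 x))\<^sup>2) \<partial>?M))"
      using A by (simp add: ennreal_mult mult_ac)
    also have "ennreal (l powr (p - 3)) * (\<integral>\<^sup>+x. ennreal ((norm (f1 x))\<^sup>2) \<partial>?M)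
      = (\<integral>\<^sup>+x. ennreal (l powr (p - 3)) * ennreal ((norm (f1 x))\<^sup>2) \<partial>?M)"
      by (rule nn_integral_cmult[symmetric]) measurable
    also have "\<dots> = (\<integral>\<^sup>+x. ennreal (l powr (p - 3)) * indicator {0..2 * B * norm (f x)} l * ennreal ((norm (f x))\<^sup>2) \<partial>?M)"
      using True by (intro nn_integral_cong) (auto simp: f1_def P_def indicator_def)
    finally show ?thesis .
  qed
  define X where "X = (\<integral>\<^sup>+x. ennreal (norm (T f x) powr p) \<partial>?M)"
  define Y where "Y = (\<integral>\<^sup>+x. ennreal (norm (f x) powr p) \<partial>?M)"
  have q: "p - 2 > 0" using p by simp
  have "ennreal (1 powr (p - 2) / (p - 2)) * X
     = (\<integral>\<^sup>+l. \<integral>\<^sup>+x. ennreal (l powr (p - 3)) * indicator {0..1 * norm (T f x)} l * ennreal ((norm (T f x))\<^sup>2) \<partial>?M \<partial>lborel)"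
    unfolding X_def by (rule layer_cake_L2_Lp[symmetric]) (use p meas[OF f] in auto)
  also have "\<dots> \<le> (\<integral>\<^sup>+l. ennreal (4 * A) * (\<integral>\<^sup>+x. ennreal (l powr (p - 3)) * indicator {0..2 * B * norm (f x)} l * ennreal ((norm (f x))\<^sup>2) \<partial>?M) \<partial>lborel)"
    by (rule nn_integral_mono) (rule level)
  also have "\<dots> = ennreal (4 * A) * (\<integral>\<^sup>+l. \<integral>\<^sup>+x. ennreal (l powr (p - 3)) * indicator {0..2 * B * norm (f x)} l * ennreal ((norm (f x))\<^sup>2) \<partial>?M \<partial>lborel)"
  proof (rule nn_integral_cmult)
    interpret M: finite_measure ?M by (rule finite_measure_torus)
    have [measurable]: "(\<lambda>p. f (snd p)) \<in> borel_measurable (lborel \<Otimes>\<^sub>M ?M)"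
      by (rule measurable_compose[OF measurable_snd fm])
    have [measurable]: "(\<lambda>p :: real \<times> (real^'n). fst p) \<in> borel_measurable (lborel \<Otimes>\<^sub>M ?M)"
      using measurable_fst[of "lborel :: real measure" ?M] by simp
    have ind: "indicator {0..2 * B * norm (f x)} l = (if 0 \<le> l \<and> l \<le> 2 * B * norm (f x) then 1 else 0 :: ennreal)" for x l
      by (simp add: indicator_def)
    have "(\<lambda>z. ennreal (fst z powr (p - 3)) * (if 0 \<le> fst z \<and> fst z \<le> 2 * B * norm (f (snd z)) then 1 else 0) * ennreal ((norm (f (snd z)))\<^sup>2))
      \<in> borel_measurable (lborel \<Otimes>\<^sub>M ?M)" by measurable
    from M.borel_measurable_nn_integral_fst[OF this]
    show "(\<lambda>l. \<integral>\<^sup>+x. ennreal (l powr (p - 3)) * indicator {0..2 * B * norm (f x)} l * ennreal ((norm (f x))\<^sup>2) \<partial>?M) \<in> borel_measurable lborel"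
      by (simp add: ind)
  qed
  also have "\<dots> = ennreal (4 * A) * (ennreal ((2 * B) powr (p - 2) / (p - 2)) * Y)"
    unfolding Y_def by (subst layer_cake_L2_Lp[OF fm p]) (use B in auto)
  finally have "ennreal (p - 2) * (ennreal (1 / (p - 2)) * X)
    \<le> ennreal (p - 2) * (ennreal (4 * A) * (ennreal ((2 * B) powr (p - 2) / (p - 2)) * Y))"
    by (intro mult_left_mono) auto
  moreover have "ennreal (p - 2) * (ennreal (1 / (p - 2)) * X) = X"
    using q by (simp add: mult.assoc[symmetric] ennreal_mult[symmetric])
  moreover have "ennreal (p - 2) * (ennreal (4 * A) * (ennreal ((2 * B) powr (p - 2) / (p - 2)) * Y))
     = ennreal (4 * A * (2 * B) powr (p - 2)) * Y"
  proof -
    have "4 * A * (2 * B) powr (p - 2) = (p - 2) * ((4 * A) * ((2 * B) powr (p - 2) / (p - 2)))"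
      using q by simp
    then show ?thesis
      using q A by (simp only: ennreal_mult mult_nonneg_nonneg divide_nonneg_pos powr_ge_zero mult.assoc less_imp_le)
  qed
  ultimately show ?thesis unfolding X_def Y_def by simp
qed

section \<open>Inclusions between Lebesgue spaces on the torus\<close>

lemma Lp_torus_L2:
  assumes "f \<in> Lp_torus p" "2 \<le> p"
  shows "L2 f"
proof -
  have "integrable torus_measure (\<lambda>x. (norm (f x))\<^sup>2)"
  proof (rule Bochner_Integration.integrable_bound)
    show "integrable torus_measure (\<lambda>x. 1 + norm (f x) powr p)"
      using assms by (intro Bochner_Integration.integrable_add) (auto simp: Lp_torus_def)
    show "(\<lambda>x. (norm (f x))\<^sup>2) \<in> borel_measurable torus_measure"
      using assms by (auto simp: Lp_torus_def)
    have "(norm (f x))\<^sup>2 \<le> 1 + norm (f x) powr p" for x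
    proof (cases "norm (f x) \<le> 1")
      case True
      then have "(norm (f x))\<^sup>2 \<le> 1\<^sup>2" by (intro power_mono) auto
      then show ?thesis by (simp add: add_increasing2)
    next
      case False
      then have "norm (f x) powr 2 \<le> norm (f x) powr p" using assms(2) by (intro powr_mono) auto
      then show ?thesis using False by (simp add: powr_numeral)
    qed
    then show "AE x in torus_measure. norm ((norm (f x))\<^sup>2) \<le> norm (1 + norm (f x) powr p)" by simp
  qed
  then show ?thesis using assms by (auto simp: L2_def Lp_torus_def)
qed

lemma Lp_nn_integral:
  assumes "integrable torus_measure (\<lambda>x. norm (f x) powr p)"
  shows "(\<integral>\<^sup>+x. ennreal (norm (f x) powr p) \<partial>torus_measure) = ennreal (LINT x|torus_measure. norm (f x) powr p)"
  by (rule nn_integral_eq_integral[OF assms]) simp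

text \<open>In place of Jensen's inequality, u^(r/p) <= 1 + u is integrated for the normalised
  function u = |g|^p / m. On a space of measure one this gives the factor 2 and hence
  2^(1/r).\<close>

lemma Lp_torus_mono:
  fixes g :: "real^'n::finite \<Rightarrow> complex"
  assumes g: "g \<in> Lp_torus p" and r: "0 < r" "r \<le> p"
  shows "g \<in> Lp_torus r" and "Lp_norm r g \<le> 2 powr (1 / r) * Lp_norm p g"
proof -
  let ?M = "torus_measure :: (real^'n) measure"
  have gm [measurable]: "g \<in> borel_measurable ?M" and gi: "integrable ?M (\<lambda>x. norm (g x) powr p)"
    using g by (auto simp: Lp_torus_def)
  have le: "u powr (r / p) \<le> 1 + u" if "u \<ge> 0" for u :: real
  proof (cases "u \<le> 1")
    case True
    then have "u powr (r / p) \<le> 1" using r that by (intro powr_le1) auto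
    then show ?thesis using that by simp
  next
    case False
    then have "u powr (r / p) \<le> u powr 1" using r by (intro powr_mono) auto
    then show ?thesis using False by simp
  qed
  have pr: "norm (g x) powr r = (norm (g x) powr p) powr (r / p)" for x
    using r by (simp add: powr_powr)
  have gr: "integrable ?M (\<lambda>x. norm (g x) powr r)"
  proof (rule Bochner_Integration.integrable_bound)
    show "integrable ?M (\<lambda>x. 1 + norm (g x) powr p)" using gi by (intro Bochner_Integration.integrable_add) auto
    show "(\<lambda>x. norm (g x) powr r) \<in> borel_measurable ?M" by measurable
    have "norm (g x) powr r \<le> 1 + norm (g x) powr p" for x unfolding pr by (rule le) simp
    then show "AE x in ?M. norm (norm (g x) powr r) \<le> norm (1 + norm (g x) powr p)" by simp
  qed
  then show "g \<in> Lp_torus r" using g by (auto simp: Lp_torus_def)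
  define m where "m = (LINT x|?M. norm (g x) powr p)"
  have m0: "m \<ge> 0" by (simp add: m_def)
  have "(LINT x|?M. norm (g x) powr r) \<le> 2 * m powr (r / p)"
  \<comment> \<open>The normalisation divides by m; for m = 0 the function vanishes almost
    everywhere.\<close>
  proof (cases "m = 0")
    case True
    then have "AE x in ?M. norm (g x) powr p = 0"
      unfolding m_def using integral_nonneg_eq_0_iff_AE[OF gi] by simp
    then have "AE x in ?M. norm (g x) powr r = 0" by auto
    then have "(LINT x|?M. norm (g x) powr r) = (LINT x|?M. 0)"
      by (intro integral_cong_AE) auto
    then show ?thesis using m0 by simp
  next
    case False
    then have m: "m > 0" using m0 by simp
    have "(LINT x|?M. norm (g x) powr r) \<le> (LINT x|?M. m powr (r / p) * (1 + norm (g x) powr p / m))"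
    proof (rule integral_mono[OF gr])
      show "integrable ?M (\<lambda>x. m powr (r / p) * (1 + norm (g x) powr p / m))"
        using gi by (intro integrable_mult_right Bochner_Integration.integrable_add integrable_divide) auto
      fix x
      have "norm (g x) powr r = m powr (r / p) * (norm (g x) powr p / m) powr (r / p)"
        unfolding pr using m by (simp add: powr_divide)
      also have "\<dots> \<le> m powr (r / p) * (1 + norm (g x) powr p / m)"
        using m by (intro mult_left_mono le) auto
      finally show "norm (g x) powr r \<le> m powr (r / p) * (1 + norm (g x) powr p / m)" .
    qed
    also have "\<dots> = m powr (r / p) * (1 + m / m)" using gi by (simp add: m_def)
    finally show ?thesis using m by simp
  qed
  then have "Lp_norm r g \<le> (2 * m powr (r / p)) powr (1 / r)"
    unfolding Lp_norm_def using r by (intro powr_mono2) auto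
  also have "\<dots> = 2 powr (1 / r) * m powr (1 / p)"
    using r m0 by (simp add: powr_mult powr_powr)
  finally show "Lp_norm r g \<le> 2 powr (1 / r) * Lp_norm p g" by (simp add: Lp_norm_def m_def)
qed

subsection \<open>The dyadic operators\<close>

lemma measurable_weight_integral:
  assumes "f \<in> borel_measurable (torus_measure :: (real^'n::finite) measure)"
  shows "(\<lambda>x. \<integral>\<^sup>+y. ennreal ((norm (f y :: complex))\<^sup>2 / weight k t (x - y)) \<partial>torus_measure)
    \<in> borel_measurable torus_measure"
proof -
  interpret M: finite_measure "torus_measure :: (real^'n) measure" by (rule finite_measure_torus)
  show ?thesis
    using M.borel_measurable_nn_integral_fst[OF measurable_weight_pair[OF assms, of k t]] by simp
qed

lemma L2_nn_integral:
  "L2 f \<Longrightarrow> (\<integral>\<^sup>+x. ennreal ((norm (f x))\<^sup>2) \<partial>torus_measure) = ennreal (LINT x|torus_measure. (norm (f x))\<^sup>2)"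
  unfolding L2_def by (intro nn_integral_eq_integral) auto

text \<open>The interface between symbol and operators: a single constant \<open>A\<close>,
  independent of the dyadic level, for size, pure k-th differences and Lipschitz dependence on
  x.\<close>

locale symbol_pieces =
  fixes a :: "real ^ 'n::finite \<Rightarrow> int ^ 'n \<Rightarrow> complex" and \<epsilon> A n :: real and k :: nat
  assumes n: "n = real CARD('n)" and k: "k = CARD('n) div 2 + 1" and eps: "0 < \<epsilon>" "\<epsilon> < 1" and A: "0 \<le> A"
    and per: "\<And>\<xi>. periodic (\<lambda>x. a x \<xi>)" and cont: "\<And>\<xi>. continuous_on UNIV (\<lambda>x. a x \<xi>)"
    and size: "\<And>j x \<xi>. norm (piece k a j x \<xi>) \<le> A * (2 ^ j) powr (- (n / 2 * \<epsilon>))"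
    and diffs: "\<And>i j x \<xi>. norm ((difference i ^^ k) (piece k a j x) \<xi>)
        \<le> A * (2 ^ j) powr (- (n / 2 * \<epsilon>) - (1 - \<epsilon>) * real k)"
    and lip: "\<And>j x y \<xi>. norm (piece k a j x \<xi> - piece k a j y \<xi>)
        \<le> A * (2 ^ j) powr (- (n / 2 * \<epsilon>)) * (\<Sum>i\<in>UNIV. \<bar>x $ i - y $ i\<bar>)"
begin

definition freq_box :: "nat \<Rightarrow> (int^'n) set" where
  "freq_box j = lattice_box (3 * k * 2 ^ j + k)"

definition T :: "nat \<Rightarrow> (real^'n \<Rightarrow> complex) \<Rightarrow> real^'n \<Rightarrow> complex" where
  "T j f x = (\<Sum>\<xi>\<in>freq_box j. piece k a j x \<xi> * fourier f \<xi> * chr \<xi> x)"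

lemma kpos: "k > 0" and nk: "CARD('n) < 2 * k" using k by auto

lemma finite_freq_box [simp]: "finite (freq_box j)" by (simp add: freq_box_def)

lemma multiplier_bound:
  defines "K \<equiv> (9 * real k) ^ CARD('n) * (1 + n)"
  assumes f: "L2 f" and h: "0 < h" "h \<le> 1" and A': "0 \<le> A'"
    and b0: "\<And>\<xi>. norm (b \<xi>) \<le> A' * h * (2 ^ j) powr (- (n / 2 * \<epsilon>))"
    and bk: "\<And>i \<xi>. norm ((difference i ^^ k) b \<xi>) \<le> A' * (2 ^ j) powr (- (n / 2 * \<epsilon>) - (1 - \<epsilon>) * real k)"
    and bs: "\<And>\<xi>. \<xi> \<notin> freq_box j \<Longrightarrow> b \<xi> = 0"
    and bks: "\<And>i \<xi>. \<xi> \<notin> freq_box j \<Longrightarrow> (difference i ^^ k) b \<xi> = 0"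
  shows "ennreal ((norm (\<Sum>\<xi>\<in>freq_box j. b \<xi> * fourier f \<xi> * chr \<xi> x))\<^sup>2)
    \<le> ennreal (K * A'\<^sup>2 * h\<^sup>2 * (2 ^ j) powr (n * (1 - \<epsilon>))) *
      (\<integral>\<^sup>+y. ennreal ((norm (f y))\<^sup>2 / weight k ((2 ^ j) powr (1 - \<epsilon>) * h powr (1 / real k)) (x - y)) \<partial>torus_measure)"
  unfolding K_def n
  by (rule multiplier_pointwise_bound[OF f finite_freq_box bs bks _
        weighted_l2_bound[OF kpos h A' b0[unfolded n] bk[unfolded n] refl freq_box_def]]) auto

text \<open>Kernel bound times integral of the inverse weight at scale t, up to constants: all
  powers of 2^j cancel and only h remains.\<close>

lemma scale_power:
  assumes h: "0 < h"
  shows "h\<^sup>2 * (2 ^ j) powr (n * (1 - \<epsilon>)) * (1 / ((2 ^ j) powr (1 - \<epsilon>) * h powr (1 / real k))) ^ CARD('n)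
    = h powr (2 - n / real k)"
proof -
  define Q where "Q = (2::real) ^ j"
  have Q: "Q > 0" by (simp add: Q_def)
  have "(Q powr (1 - \<epsilon>) * h powr (1 / real k)) ^ CARD('n) = Q powr (n * (1 - \<epsilon>)) * h powr (n / real k)"
    unfolding power_mult_distrib using Q h by (subst (1 2) powr_power) (auto simp: n)
  then have "h\<^sup>2 * Q powr (n * (1 - \<epsilon>)) * (1 / (Q powr (1 - \<epsilon>) * h powr (1 / real k))) ^ CARD('n)
     = h\<^sup>2 / h powr (n / real k)"
    using Q h by (simp add: power_divide)
  also have "\<dots> = h powr (2 - n / real k)" using h by (simp add: powr_diff powr_numeral)
  finally show ?thesis by (simp add: Q_def)
qed

text \<open>At a fixed x the value of \<open>T j f\<close> is that of the multiplier
  \<open>piece k a j x\<close>, so \<open>multiplier_bound\<close> with h = 1 applies although the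
  operator is not a convolution. The added 1 in the constant keeps it positive when A = 0.\<close>

lemma T_bounded:
  obtains B where "B > 0"
    and "\<And>j f m x. L2 f \<Longrightarrow> 0 \<le> m \<Longrightarrow> (\<And>y. y \<in> cbox 0 1 \<Longrightarrow> norm (f y) \<le> m) \<Longrightarrow> x \<in> cbox 0 1
      \<Longrightarrow> norm (T j f x) \<le> B * m"
proof -
  obtain W where W: "W > 0" "\<And>t x. t > 0 \<Longrightarrow> x \<in> cbox 0 (1::real^'n) \<Longrightarrow>
    (\<integral>\<^sup>+y. ennreal (1 / weight k t (x - y)) \<partial>torus_measure) \<le> ennreal (W * (1 / t) ^ CARD('n))"
    using nn_integral_inverse_weight[OF nk] by blast
  define K where "K = (9 * real k) ^ CARD('n) * (1 + n)"
  have K: "K \<ge> 0" by (simp add: K_def n)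
  have "norm (T j f x) \<le> (sqrt (K * W) * A + 1) * m"
    if f: "L2 f" and m: "0 \<le> m" and fm: "\<And>y. y \<in> cbox 0 1 \<Longrightarrow> norm (f y) \<le> m" and x: "x \<in> cbox 0 1" for j f m x
  proof -
    define t where "t = (2 ^ j :: real) powr (1 - \<epsilon>) * 1 powr (1 / real k)"
    have t: "t > 0" by (simp add: t_def)
    have w: "weight k t z > 0" for z :: "real^'n" using weight_ge_1[of t k z] t by linarith
    have [measurable]: "(\<lambda>y. weight k t (x - y)) \<in> borel_measurable torus_measure"
      by (intro measurable_torus_continuous continuous_intros)
    have "ennreal ((norm (T j f x))\<^sup>2) \<le> ennreal (K * A\<^sup>2 * 1\<^sup>2 * (2 ^ j) powr (n * (1 - \<epsilon>))) *
      (\<integral>\<^sup>+y. ennreal ((norm (f y))\<^sup>2 / weight k t (x - y)) \<partial>torus_measure)"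
      unfolding T_def K_def t_def
      by (rule multiplier_bound[OF f]) (use A size diffs kpos in \<open>auto simp: freq_box_def piece_support piece_support0\<close>)
    also have "\<dots> \<le> ennreal (K * A\<^sup>2 * 1\<^sup>2 * (2 ^ j) powr (n * (1 - \<epsilon>))) * (ennreal (m\<^sup>2) * ennreal (W * (1 / t) ^ CARD('n)))"
    proof (rule mult_left_mono)
      have "(\<integral>\<^sup>+y. ennreal ((norm (f y))\<^sup>2 / weight k t (x - y)) \<partial>torus_measure)
         \<le> (\<integral>\<^sup>+y. ennreal (m\<^sup>2) * ennreal (1 / weight k t (x - y)) \<partial>torus_measure)"
      proof (rule nn_integral_mono)
        fix y :: "real^'n" assume "y \<in> space torus_measure"
        then have "norm (f y) \<le> m" using fm by simp
        then have "(norm (f y))\<^sup>2 / weight k t (x - y) \<le> m\<^sup>2 * (1 / weight k t (x - y))"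
          using w[of "x - y"] by (simp add: divide_right_mono power_mono)
        then show "ennreal ((norm (f y))\<^sup>2 / weight k t (x - y)) \<le> ennreal (m\<^sup>2) * ennreal (1 / weight k t (x - y))"
          using w[of "x - y"] by (subst ennreal_mult[symmetric]) (auto intro: ennreal_leI)
      qed
      also have "\<dots> = ennreal (m\<^sup>2) * (\<integral>\<^sup>+y. ennreal (1 / weight k t (x - y)) \<partial>torus_measure)"
        by (rule nn_integral_cmult) measurable
      also have "\<dots> \<le> ennreal (m\<^sup>2) * ennreal (W * (1 / t) ^ CARD('n))"
        by (rule mult_left_mono[OF W(2)[OF t x]]) simp
      finally show "(\<integral>\<^sup>+y. ennreal ((norm (f y))\<^sup>2 / weight k t (x - y)) \<partial>torus_measure)
        \<le> ennreal (m\<^sup>2) * ennreal (W * (1 / t) ^ CARD('n))" .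
    qed simp
    also have "\<dots> = ennreal (K * A\<^sup>2 * 1\<^sup>2 * (2 ^ j) powr (n * (1 - \<epsilon>)) * (m\<^sup>2 * (W * (1 / t) ^ CARD('n))))"
      using K W(1) t by (simp add: ennreal_mult)
    also have "K * A\<^sup>2 * 1\<^sup>2 * (2 ^ j) powr (n * (1 - \<epsilon>)) * (m\<^sup>2 * (W * (1 / t) ^ CARD('n)))
        = K * W * A\<^sup>2 * m\<^sup>2 * (1\<^sup>2 * (2 ^ j) powr (n * (1 - \<epsilon>)) * (1 / t) ^ CARD('n))" by (simp only: mult_ac)
    also have "1\<^sup>2 * (2 ^ j) powr (n * (1 - \<epsilon>)) * (1 / t) ^ CARD('n) = 1 powr (2 - n / real k)"
      unfolding t_def by (rule scale_power) simp
    also have "K * W * A\<^sup>2 * m\<^sup>2 * 1 powr (2 - n / real k) = (sqrt (K * W) * A * m)\<^sup>2"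
      using K W(1) by (simp add: power_mult_distrib)
    finally have "(norm (T j f x))\<^sup>2 \<le> (sqrt (K * W) * A * m)\<^sup>2" by (subst (asm) ennreal_le_iff) auto
    then have "norm (T j f x) \<le> sqrt (K * W) * A * m"
      by (rule power2_le_imp_le) (use K W(1) A m in auto)
    then show ?thesis using m by (simp add: algebra_simps)
  qed
  moreover have "sqrt (K * W) * A + 1 > 0" using K W(1) A by (intro add_nonneg_pos) auto
  ultimately show ?thesis using that by blast
qed

lemma continuous_T: "continuous_on UNIV (T j f)"
  unfolding T_def piece_def by (intro continuous_intros cont)

section \<open>Decay on L2 by freezing the space variable\<close>

lemma frozen_L2:
  assumes f: "L2 f"
  shows "(\<integral>\<^sup>+x. ennreal ((norm (\<Sum>\<xi>\<in>freq_box j. piece k a j z \<xi> * fourier f \<xi> * chr \<xi> x))\<^sup>2) \<partial>torus_measure)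
    \<le> ennreal (A\<^sup>2 * (2 ^ j) powr (- n * \<epsilon>)) * (\<integral>\<^sup>+x. ennreal ((norm (f x))\<^sup>2) \<partial>torus_measure)"
proof -
  have "(\<integral>\<^sup>+x. ennreal ((norm (\<Sum>\<xi>\<in>freq_box j. piece k a j z \<xi> * fourier f \<xi> * chr \<xi> x))\<^sup>2) \<partial>torus_measure)
      = ennreal (LINT x|torus_measure. (norm (\<Sum>\<xi>\<in>freq_box j. piece k a j z \<xi> * fourier f \<xi> * chr \<xi> x))\<^sup>2)"
    by (rule nn_integral_eq_integral) (auto intro!: continuous_imp_integrable continuous_intros)
  also have "(LINT x|torus_measure. (norm (\<Sum>\<xi>\<in>freq_box j. piece k a j z \<xi> * fourier f \<xi> * chr \<xi> x))\<^sup>2)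
      = (\<Sum>\<xi>\<in>freq_box j. (norm (piece k a j z \<xi> * fourier f \<xi>))\<^sup>2)"
    by (rule parseval_trig) simp
  also have "\<dots> \<le> (\<Sum>\<xi>\<in>freq_box j. A\<^sup>2 * (2 ^ j) powr (- n * \<epsilon>) * (norm (fourier f \<xi>))\<^sup>2)"
  proof (rule sum_mono)
    fix \<xi>
    have "(norm (piece k a j z \<xi>))\<^sup>2 \<le> (A * (2 ^ j) powr (- (n / 2 * \<epsilon>)))\<^sup>2"
      by (intro power_mono size) simp
    also have "\<dots> = A\<^sup>2 * (2 ^ j) powr (- n * \<epsilon>)"
    proof -
      have "(Q powr (- (n / 2 * \<epsilon>)))\<^sup>2 = Q powr (- n * \<epsilon>)" for Q :: real
        by (simp add: power2_eq_square powr_add[symmetric] mult.commute)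
      then show ?thesis by (simp only: power_mult_distrib)
    qed
    finally show "(norm (piece k a j z \<xi> * fourier f \<xi>))\<^sup>2 \<le> A\<^sup>2 * (2 ^ j) powr (- n * \<epsilon>) * (norm (fourier f \<xi>))\<^sup>2"
      unfolding norm_mult power_mult_distrib by (rule mult_right_mono) simp
  qed
  also have "\<dots> \<le> A\<^sup>2 * (2 ^ j) powr (- n * \<epsilon>) * (LINT x|torus_measure. (norm (f x))\<^sup>2)"
    unfolding sum_distrib_left[symmetric] by (intro mult_left_mono bessel f) auto
  finally show ?thesis
    by (simp add: L2_nn_integral[OF f] ennreal_mult[symmetric] ennreal_leI)
qed

text \<open>Reusing \<open>lattice_box\<close> makes the grid cover the cube [-1,1]^n, which affects
  only the constant in the count.\<close>

definition grid :: "nat \<Rightarrow> (real^'n) set" where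
  "grid N = (\<lambda>m. \<chi> i. real_of_int (m $ i) / real N) ` lattice_box N"

lemma finite_grid [simp]: "finite (grid N)" by (simp add: grid_def)

lemma card_grid: "card (grid N) \<le> (2 * N + 1) ^ CARD('n)"
  unfolding grid_def using card_image_le[OF finite_lattice_box] card_lattice_box_le order_trans by blast

lemma grid_approx:
  assumes N: "N > 0" and x: "x \<in> cbox 0 1"
  obtains z where "z \<in> grid N" "\<And>i. \<bar>x $ i - z $ i\<bar> \<le> 1 / real N"
proof -
  define m where "m = (\<chi> i. \<lfloor>real N * x $ i\<rfloor>)"
  define z where "z = (\<chi> i. real_of_int (m $ i) / real N)"
  have x01: "0 \<le> x $ i" "x $ i \<le> 1" for i using x by (auto simp: mem_box_cart)
  have "m $ i \<in> {- int N..int N}" for i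
  proof -
    have "0 \<le> real N * x $ i" using x01 by simp
    moreover have "real N * x $ i \<le> real N * 1" using x01 by (intro mult_left_mono) auto
    ultimately show ?thesis unfolding m_def by simp linarith
  qed
  then have "z \<in> grid N" unfolding grid_def z_def by (auto simp: lattice_box_def)
  moreover have "\<bar>x $ i - z $ i\<bar> \<le> 1 / real N" for i
  proof -
    have "\<bar>real N * x $ i - real_of_int (m $ i)\<bar> \<le> 1" unfolding m_def by simp linarith
    then have "\<bar>real N * x $ i - real_of_int (m $ i)\<bar> / real N \<le> 1 / real N" by (simp add: divide_right_mono)
    moreover have "x $ i - z $ i = (real N * x $ i - real_of_int (m $ i)) / real N"
      using N by (simp add: z_def field_simps)
    ultimately show ?thesis by simp
  qed
  ultimately show ?thesis using that by blast
qed

text \<open>The scale \<open>t\<close> of the weight is shrunk by \<open>h\<^bsup>1/k\<^esup>\<close> because the error symbol gains the factor \<open>h\<close>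
  but its \<open>k\<close>-th differences gain nothing.\<close>

lemma T_pointwise_split:
  defines "K \<equiv> (9 * real k) ^ CARD('n) * (1 + n)" and "A' \<equiv> A * (n + 2)"
  assumes f: "L2 f" and N: "N > 0" and h: "h = 1 / real N" and x: "x \<in> cbox 0 1"
    and t: "t = (2 ^ j) powr (1 - \<epsilon>) * h powr (1 / real k)"
  shows "ennreal ((norm (T j f x))\<^sup>2)
   \<le> ennreal (2 * (K * A'\<^sup>2 * h\<^sup>2 * (2 ^ j) powr (n * (1 - \<epsilon>)))) *
      (\<integral>\<^sup>+y. ennreal ((norm (f y))\<^sup>2 / weight k t (x - y)) \<partial>torus_measure)
   + (\<Sum>z\<in>grid N. 2 * ennreal ((norm (\<Sum>\<xi>\<in>freq_box j. piece k a j z \<xi> * fourier f \<xi> * chr \<xi> x))\<^sup>2))"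
proof -
  have h1: "0 < h" "h \<le> 1" using N by (auto simp: h)
  obtain z where z: "z \<in> grid N" "\<And>i. \<bar>x $ i - z $ i\<bar> \<le> h" using grid_approx[OF N x] unfolding h by blast
  define F where "F = (\<lambda>z. \<Sum>\<xi>\<in>freq_box j. piece k a j z \<xi> * fourier f \<xi> * chr \<xi> x)"
  define b where "b = (\<lambda>\<xi>. piece k a j x \<xi> - piece k a j z \<xi>)"
  define R where "R = (\<Sum>\<xi>\<in>freq_box j. b \<xi> * fourier f \<xi> * chr \<xi> x)"
  have dec: "T j f x = R + F z"
    by (simp add: T_def R_def F_def b_def left_diff_distrib sum_subtractf)
  \<comment> \<open>The error symbol needs nA for its size, from the Lipschitz bound over n
    coordinates, and 2A for its differences, from the triangle inequality; \<open>A'\<close> covers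
    both.\<close>
  have A': "A' \<ge> 0" "A \<le> A'" "2 * A \<le> A'" "n * A \<le> A'" using A by (auto simp: A'_def n algebra_simps)
  have R: "ennreal ((norm R)\<^sup>2) \<le> ennreal (K * A'\<^sup>2 * h\<^sup>2 * (2 ^ j) powr (n * (1 - \<epsilon>))) *
      (\<integral>\<^sup>+y. ennreal ((norm (f y))\<^sup>2 / weight k t (x - y)) \<partial>torus_measure)"
    unfolding R_def K_def t
  proof (rule multiplier_bound[OF f h1 A'(1)])
    fix \<xi>
    have "(\<Sum>i\<in>UNIV. \<bar>x $ i - z $ i\<bar>) \<le> (\<Sum>i\<in>(UNIV::'n set). h)" by (intro sum_mono z)
    then have "(\<Sum>i\<in>UNIV. \<bar>x $ i - z $ i\<bar>) \<le> n * h" by (simp add: n)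
    then have "norm (b \<xi>) \<le> A * (2 ^ j) powr (- (n / 2 * \<epsilon>)) * (n * h)"
      unfolding b_def using A by (intro order_trans[OF lip] mult_left_mono) auto
    also have "\<dots> = (n * A) * (h * (2 ^ j) powr (- (n / 2 * \<epsilon>)))" by (simp only: mult_ac)
    also have "\<dots> \<le> A' * (h * (2 ^ j) powr (- (n / 2 * \<epsilon>)))" using A' h1 by (intro mult_right_mono) auto
    finally show "norm (b \<xi>) \<le> A' * h * (2 ^ j) powr (- (n / 2 * \<epsilon>))" by (simp only: mult_ac)
    fix i
    define u where "u = (2 ^ j :: real) powr (- (n / 2 * \<epsilon>) - (1 - \<epsilon>) * real k)"
    have "norm ((difference i ^^ k) b \<xi>) \<le> A * u + A * u"
      unfolding b_def differences_diff u_def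
      by (intro order_trans[OF norm_triangle_ineq4] add_mono diffs)
    also have "\<dots> = (2 * A) * u" by simp
    also have "\<dots> \<le> A' * u" using A' by (intro mult_right_mono) (auto simp: u_def)
    finally show "norm ((difference i ^^ k) b \<xi>) \<le> A' * (2 ^ j) powr (- (n / 2 * \<epsilon>) - (1 - \<epsilon>) * real k)"
      by (simp add: u_def)
  next
    fix \<xi> assume "\<xi> \<notin> freq_box j"
    then show "b \<xi> = 0" "(difference i ^^ k) b \<xi> = 0" for i
      by (auto simp: b_def freq_box_def piece_support0 piece_support differences_diff)
  qed
  have "(norm (R + F z))\<^sup>2 \<le> 2 * (norm R)\<^sup>2 + 2 * (norm (F z))\<^sup>2"
  proof -
    have "(norm (R + F z))\<^sup>2 \<le> (norm R + norm (F z))\<^sup>2" by (intro power_mono norm_triangle_ineq) simp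
    also have "\<dots> \<le> 2 * (norm R)\<^sup>2 + 2 * (norm (F z))\<^sup>2"
      using zero_le_power2[of "norm R - norm (F z)"] unfolding power2_diff power2_sum by linarith
    finally show ?thesis .
  qed
  then have "ennreal ((norm (T j f x))\<^sup>2) \<le> ennreal (2 * (norm R)\<^sup>2 + 2 * (norm (F z))\<^sup>2)"
    unfolding dec by (rule ennreal_leI)
  also have "\<dots> = 2 * ennreal ((norm R)\<^sup>2) + 2 * ennreal ((norm (F z))\<^sup>2)"
    by (simp add: ennreal_mult)
  \<comment> \<open>The point z depends on x. Adding the nonnegative terms of all other grid points
    replaces it by a sum of fixed multipliers, each of which can be integrated in x.\<close>
  also have "\<dots> \<le> 2 * (ennreal (K * A'\<^sup>2 * h\<^sup>2 * (2 ^ j) powr (n * (1 - \<epsilon>))) *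
      (\<integral>\<^sup>+y. ennreal ((norm (f y))\<^sup>2 / weight k t (x - y)) \<partial>torus_measure)) + (\<Sum>z\<in>grid N. 2 * ennreal ((norm (F z))\<^sup>2))"
    by (intro add_mono mult_left_mono R member_le_sum z) auto
  also have "2 * (ennreal (K * A'\<^sup>2 * h\<^sup>2 * (2 ^ j) powr (n * (1 - \<epsilon>))) *
      (\<integral>\<^sup>+y. ennreal ((norm (f y))\<^sup>2 / weight k t (x - y)) \<partial>torus_measure))
     = ennreal (2 * (K * A'\<^sup>2 * h\<^sup>2 * (2 ^ j) powr (n * (1 - \<epsilon>)))) *
      (\<integral>\<^sup>+y. ennreal ((norm (f y))\<^sup>2 / weight k t (x - y)) \<partial>torus_measure)"
    by (simp add: K_def n ennreal_mult mult.assoc[symmetric])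
  finally show ?thesis unfolding F_def .
qed

lemma T_L2:
  obtains B \<delta> where "B > 0" "\<delta> > 0"
    "\<And>j f. L2 f \<Longrightarrow> (\<integral>\<^sup>+x. ennreal ((norm (T j f x))\<^sup>2) \<partial>torus_measure)
       \<le> ennreal (B * (2 ^ j) powr (- \<delta>)) * (\<integral>\<^sup>+x. ennreal ((norm (f x))\<^sup>2) \<partial>torus_measure)"
proof -
  let ?M = "torus_measure :: (real^'n) measure"
  obtain W where W: "W > 0" "\<And>t x. t > 0 \<Longrightarrow> x \<in> cbox 0 (1::real^'n) \<Longrightarrow>
    (\<integral>\<^sup>+y. ennreal (1 / weight k t (x - y)) \<partial>torus_measure) \<le> ennreal (W * (1 / t) ^ CARD('n))"
    using nn_integral_inverse_weight[OF nk] by blast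
  define K where "K = (9 * real k) ^ CARD('n) * (1 + n)"
  define A' where "A' = A * (n + 2)"
  have K: "K \<ge> 0" by (simp add: K_def n)
  define \<kappa> where "\<kappa> = 2 - n / real k"
  have "real CARD('n) < real (2 * k)" using nk by (simp only: of_nat_less_iff)
  then have "n < 2 * real k" by (simp add: n)
  then have \<kappa>: "\<kappa> > 0" using kpos by (simp add: \<kappa>_def field_simps)
  \<comment> \<open>The first entry is the decay of h^\<kappa>. The second is what remains of
    2^(-jn\<epsilon>) after multiplication by a grid count of order 2^(jn\<epsilon>/2).\<close>
  define \<delta> where "\<delta> = min (\<epsilon> / 2 * \<kappa>) (n * \<epsilon> / 2)"
  have \<delta>: "\<delta> > 0" using \<kappa> eps by (simp add: \<delta>_def n)
  define B where "B = 2 * K * A'\<^sup>2 * W + 2 * 5 ^ CARD('n) * A\<^sup>2 + 1"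
  have "(\<integral>\<^sup>+x. ennreal ((norm (T j f x))\<^sup>2) \<partial>?M)
       \<le> ennreal (B * (2 ^ j) powr (- \<delta>)) * (\<integral>\<^sup>+x. ennreal ((norm (f x))\<^sup>2) \<partial>?M)" if f: "L2 f" for j f
  proof -
    define Q where "Q = (2::real) ^ j"
    have Q: "Q \<ge> 1" by (simp add: Q_def)
    define I where "I = (\<integral>\<^sup>+x. ennreal ((norm (f x))\<^sup>2) \<partial>?M)"
    define q where "q = Q powr (\<epsilon> / 2)"
    have q: "q \<ge> 1" using Q eps by (simp add: q_def ge_one_powr_ge_zero)
    define N where "N = nat \<lceil>q\<rceil>"
    have Nq: "q \<le> real N" "real N \<le> q + 1" using q by (simp_all add: N_def)
    have N: "N > 0" using Nq q by (cases N) auto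
    define h where "h = 1 / real N"
    have h: "0 < h" "h \<le> 1" using N by (auto simp: h_def)
    define t where "t = (2 ^ j) powr (1 - \<epsilon>) * h powr (1 / real k)"
    have t: "t > 0" using h by (simp add: t_def)
    define F where "F = (\<lambda>z x. \<Sum>\<xi>\<in>freq_box j. piece k a j z \<xi> * fourier f \<xi> * chr \<xi> x)"
    define J where "J = (\<lambda>x. \<integral>\<^sup>+y. ennreal ((norm (f y))\<^sup>2 / weight k t (x - y)) \<partial>?M)"
    define c where "c = 2 * (K * A'\<^sup>2 * h\<^sup>2 * (2 ^ j) powr (n * (1 - \<epsilon>)))"
    have c: "c \<ge> 0" using K by (simp add: c_def)
    have fm: "f \<in> borel_measurable ?M" using f by (simp add: L2_def)
    have [measurable]: "J \<in> borel_measurable ?M" unfolding J_def by (rule measurable_weight_integral[OF fm])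
    have [measurable]: "F z \<in> borel_measurable ?M" for z
      unfolding F_def by (intro measurable_torus_continuous continuous_intros)
    have "(\<integral>\<^sup>+x. ennreal ((norm (T j f x))\<^sup>2) \<partial>?M)
        \<le> (\<integral>\<^sup>+x. ennreal c * J x + (\<Sum>z\<in>grid N. 2 * ennreal ((norm (F z x))\<^sup>2)) \<partial>?M)"
      unfolding J_def c_def K_def A'_def F_def
      by (intro nn_integral_mono T_pointwise_split[OF f N h_def _ t_def]) simp
    also have "\<dots> = ennreal c * (\<integral>\<^sup>+x. J x \<partial>?M) + (\<Sum>z\<in>grid N. 2 * (\<integral>\<^sup>+x. ennreal ((norm (F z x))\<^sup>2) \<partial>?M))"
      by (simp add: nn_integral_add nn_integral_cmult nn_integral_sum)
    also have "\<dots> \<le> ennreal c * (ennreal (W * (1 / t) ^ CARD('n)) * I)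
        + (\<Sum>z\<in>grid N. 2 * (ennreal (A\<^sup>2 * (2 ^ j) powr (- n * \<epsilon>)) * I))"
      unfolding J_def F_def I_def
      by (intro add_mono mult_left_mono sum_mono frozen_L2[OF f] nn_integral_torus_swap[OF fm t] W(2)[OF t]) auto
    also have "\<dots> = ennreal (c * (W * (1 / t) ^ CARD('n)) + real (card (grid N)) * (2 * (A\<^sup>2 * (2 ^ j) powr (- n * \<epsilon>)))) * I"
      using c W(1) t by (simp add: ennreal_mult ennreal_of_nat_eq_real_of_nat distrib_left distrib_right mult_ac)
    also have "\<dots> \<le> ennreal (B * Q powr (- \<delta>)) * I"
    proof (intro mult_right_mono ennreal_leI)
      have "c * (W * (1 / t) ^ CARD('n)) = 2 * K * A'\<^sup>2 * W * (h\<^sup>2 * (2 ^ j) powr (n * (1 - \<epsilon>)) * (1 / t) ^ CARD('n))"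
        by (simp only: c_def mult_ac)
      also have "h\<^sup>2 * (2 ^ j) powr (n * (1 - \<epsilon>)) * (1 / t) ^ CARD('n) = h powr \<kappa>"
        unfolding t_def \<kappa>_def by (rule scale_power[OF h(1)])
      also have "h powr \<kappa> \<le> Q powr (- \<delta>)"
      proof -
        have "h \<le> 1 / q" unfolding h_def using Nq q by (intro divide_left_mono) auto
        then have "h powr \<kappa> \<le> (1 / q) powr \<kappa>" using h \<kappa> by (intro powr_mono2) auto
        also have "\<dots> = Q powr (- (\<epsilon> / 2 * \<kappa>))"
          using Q by (simp add: q_def powr_divide powr_powr powr_minus_divide)
        also have "\<dots> \<le> Q powr (- \<delta>)" using Q by (intro powr_mono) (auto simp: \<delta>_def)
        finally show ?thesis .
      qed
      finally have 1: "c * (W * (1 / t) ^ CARD('n)) \<le> 2 * K * A'\<^sup>2 * W * Q powr (- \<delta>)"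
        using K W(1) by (simp add: mult_left_mono)
      have "real (card (grid N)) \<le> real ((2 * N + 1) ^ CARD('n))" using card_grid by (simp only: of_nat_le_iff)
      also have "\<dots> = (2 * real N + 1) ^ CARD('n)" by (simp add: add.commute)
      \<comment> \<open>As N <= q + 1 and q >= 1, 2N + 1 <= 2q + 3 <= 5q.\<close>
      also have "\<dots> \<le> (5 * q) ^ CARD('n)" using Nq q by (intro power_mono) auto
      also have "\<dots> = 5 ^ CARD('n) * Q powr (n * (\<epsilon> / 2))"
        unfolding q_def power_mult_distrib using Q by (subst powr_power) (auto simp: n)
      finally have "real (card (grid N)) * (2 * (A\<^sup>2 * Q powr (- n * \<epsilon>)))
         \<le> (5 ^ CARD('n) * Q powr (n * (\<epsilon> / 2))) * (2 * (A\<^sup>2 * Q powr (- n * \<epsilon>)))"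
        by (intro mult_right_mono) auto
      also have "\<dots> = 2 * 5 ^ CARD('n) * A\<^sup>2 * (Q powr (n * (\<epsilon> / 2)) * Q powr (- n * \<epsilon>))"
        by (simp only: mult_ac)
      also have "Q powr (n * (\<epsilon> / 2)) * Q powr (- n * \<epsilon>) = Q powr (- (n * \<epsilon> / 2))"
        by (simp add: powr_add[symmetric] field_simps)
      also have "2 * 5 ^ CARD('n) * A\<^sup>2 * Q powr (- (n * \<epsilon> / 2)) \<le> 2 * 5 ^ CARD('n) * A\<^sup>2 * Q powr (- \<delta>)"
        using Q by (intro mult_left_mono powr_mono) (auto simp: \<delta>_def)
      finally have 2: "real (card (grid N)) * (2 * (A\<^sup>2 * Q powr (- n * \<epsilon>))) \<le> 2 * 5 ^ CARD('n) * A\<^sup>2 * Q powr (- \<delta>)" .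
      have "B * Q powr (- \<delta>) = 2 * K * A'\<^sup>2 * W * Q powr (- \<delta>) + 2 * 5 ^ CARD('n) * A\<^sup>2 * Q powr (- \<delta>) + Q powr (- \<delta>)"
        by (simp add: B_def algebra_simps)
      then show "c * (W * (1 / t) ^ CARD('n)) + real (card (grid N)) * (2 * (A\<^sup>2 * (2 ^ j) powr (- n * \<epsilon>))) \<le> B * Q powr (- \<delta>)"
        unfolding Q_def[symmetric] using 1 2 powr_ge_zero[of Q "- \<delta>"] by linarith
    qed simp
    finally show ?thesis by (simp add: Q_def I_def)
  qed
  moreover have "B > 0" using K W(1) by (simp add: B_def add_nonneg_pos)
  ultimately show ?thesis using that \<delta> by blast
qed

end

subsection \<open>Summation of the dyadic operators\<close>

lemma fourier_add:
  "integrable torus_measure f \<Longrightarrow> integrable torus_measure g \<Longrightarrow>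
    fourier (\<lambda>x. f x + g x) \<xi> = fourier f \<xi> + fourier g \<xi>"
  unfolding fourier_chr by (simp add: distrib_left integrable_cnj_chr)

lemma fourier_cmult: "fourier (\<lambda>x. c * f x) \<xi> = c * fourier f \<xi>"
proof -
  have e: "cnj (chr \<xi> x) * (c * f x) = c * (cnj (chr \<xi> x) * f x)" for x by simp
  show ?thesis unfolding fourier_chr e by simp
qed

text \<open>The geometric weights replace Minkowski's inequality: they reduce the sum to its largest weighted
  term, whose \<open>p\<close>-th power is at most the sum of the \<open>p\<close>-th powers.\<close>

lemma weighted_sum_bound:
  fixes s :: "nat \<Rightarrow> 'a::banach" and g :: real
  assumes p: "0 < p" and \<delta>: "0 < \<delta>" and g: "0 \<le> g"
    and le: "\<And>j. (2 ^ j) powr (\<delta> / 2) * norm (s j) powr p \<le> g"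
  shows "summable (\<lambda>j. norm (s j))"
    and "norm (\<Sum>j. s j) powr p \<le> (1 / (1 - 2 powr (- \<delta> / (2 * p)))) powr p * g"
proof -
  define \<sigma> where "\<sigma> = 2 powr (- \<delta> / (2 * p))"
  have "\<sigma> < 2 powr 0" unfolding \<sigma>_def using p \<delta> by (intro powr_less_mono) auto
  then have \<sigma>: "0 < \<sigma>" "\<sigma> < 1" by (auto simp: \<sigma>_def)
  have b: "norm (s j) \<le> g powr (1 / p) * \<sigma> ^ j" for j
  proof -
    have pj: "(2 ^ j :: real) powr u = (2 powr u) ^ j" for u
      by (simp add: powr_powr powr_realpow[symmetric] mult.commute)
    have "norm (s j) powr p \<le> g * (2 powr (- \<delta> / 2)) ^ j"
      using le[of j] unfolding pj by (simp add: powr_minus field_simps)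
    then have "(norm (s j) powr p) powr (1 / p) \<le> (g * (2 powr (- \<delta> / 2)) ^ j) powr (1 / p)"
      using p by (intro powr_mono2) auto
    also have "\<dots> = g powr (1 / p) * \<sigma> ^ j"
      using g p by (simp add: powr_mult \<sigma>_def powr_powr powr_realpow[symmetric] field_simps)
    finally show ?thesis using p by (simp add: powr_powr)
  qed
  have gs: "summable (\<lambda>j. g powr (1 / p) * \<sigma> ^ j)"
    using \<sigma> by (intro summable_mult summable_geometric) auto
  show s: "summable (\<lambda>j. norm (s j))"
    by (rule summable_comparison_test[OF _ gs]) (use b in auto)
  have "norm (\<Sum>j. s j) \<le> (\<Sum>j. norm (s j))" by (rule summable_norm[OF s])
  also have "\<dots> \<le> (\<Sum>j. g powr (1 / p) * \<sigma> ^ j)" by (intro suminf_le b s gs)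
  also have "\<dots> = g powr (1 / p) * (1 / (1 - \<sigma>))"
    using \<sigma> by (subst suminf_mult) (auto simp: suminf_geometric summable_geometric)
  finally have "norm (\<Sum>j. s j) powr p \<le> (g powr (1 / p) * (1 / (1 - \<sigma>))) powr p"
    using p by (intro powr_mono2) auto
  also have "\<dots> = (1 / (1 - \<sigma>)) powr p * g"
    using p g \<sigma> by (subst powr_mult) (simp_all add: powr_powr)
  finally show "norm (\<Sum>j. s j) powr p \<le> (1 / (1 - 2 powr (- \<delta> / (2 * p)))) powr p * g"
    by (simp only: \<sigma>_def)
qed

context symbol_pieces
begin

lemma T_add:
  "L2 f \<Longrightarrow> L2 g \<Longrightarrow> T j (\<lambda>x. f x + g x) x = T j f x + T j g x"
  unfolding T_def by (simp add: fourier_add L2_integrable algebra_simps sum.distrib)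

lemma T_cmult: "T j (\<lambda>x. c * f x) x = c * T j f x"
  unfolding T_def by (simp add: fourier_cmult sum_distrib_left mult_ac)

lemma T_periodic: "T j f (x + of_lattice m) = T j f x"
proof -
  have "a (x + of_lattice m) \<xi> = a x \<xi>" for \<xi> using per by (simp add: periodic_def)
  then show ?thesis by (simp add: T_def piece_def chr_add)
qed

lemma T_measurable [measurable]: "T j f \<in> borel_measurable torus_measure"
  by (rule measurable_torus_continuous[OF continuous_T])

text \<open>The endpoint p = 2 is the L2 bound itself and is split off because the interpolation
  requires p > 2.\<close>

lemma T_Lp:
  assumes p: "2 \<le> p"
  obtains C \<delta> where "C > 0" "\<delta> > 0"
    "\<And>j f. L2 f \<Longrightarrow> (\<integral>\<^sup>+x. ennreal (norm (T j f x) powr p) \<partial>torus_measure)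
       \<le> ennreal (C * (2 ^ j) powr (- \<delta>)) * (\<integral>\<^sup>+x. ennreal (norm (f x) powr p) \<partial>torus_measure)"
proof -
  obtain B where B: "B > 0" "\<And>j f m x. L2 f \<Longrightarrow> 0 \<le> m \<Longrightarrow> (\<And>y. y \<in> cbox 0 1 \<Longrightarrow> norm (f y) \<le> m) \<Longrightarrow> x \<in> cbox 0 1
      \<Longrightarrow> norm (T j f x) \<le> B * m" using T_bounded by blast
  obtain D \<delta> where D: "D > 0" "\<delta> > 0"
    "\<And>j f. L2 f \<Longrightarrow> (\<integral>\<^sup>+x. ennreal ((norm (T j f x))\<^sup>2) \<partial>torus_measure)
       \<le> ennreal (D * (2 ^ j) powr (- \<delta>)) * (\<integral>\<^sup>+x. ennreal ((norm (f x))\<^sup>2) \<partial>torus_measure)"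
    using T_L2 by blast
  show ?thesis
  proof (cases "p = 2")
    case True
    then show ?thesis using that[OF D(1,2)] D(3) by (simp add: powr_numeral)
  next
    case False
    then have p2: "2 < p" using p by simp
    show ?thesis
    proof (rule that[OF _ D(2)])
      show "4 * D * (2 * B) powr (p - 2) > 0" using D B by simp
      fix j and f :: "real^'n \<Rightarrow> complex" assume f: "L2 f"
      have "(\<integral>\<^sup>+x. ennreal (norm (T j f x) powr p) \<partial>torus_measure)
        \<le> ennreal (4 * (D * (2 ^ j) powr (- \<delta>)) * (2 * B) powr (p - 2)) * (\<integral>\<^sup>+x. ennreal (norm (f x) powr p) \<partial>torus_measure)"
        by (rule marcinkiewicz_L2_Linf[OF p2 _ B(1) T_add T_measurable B(2) D(3) f]) (use D in auto)
      then show "(\<integral>\<^sup>+x. ennreal (norm (T j f x) powr p) \<partial>torus_measure)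
        \<le> ennreal (4 * D * (2 * B) powr (p - 2) * (2 ^ j) powr (- \<delta>)) * (\<integral>\<^sup>+x. ennreal (norm (f x) powr p) \<partial>torus_measure)"
        by (simp only: mult_ac)
    qed
  qed
qed

text \<open>Where the series diverges, \<open>suminf\<close> has an unspecified value. For f in Lp
  with 2 <= p this happens only on a null set, which is why linearity holds almost everywhere;
  periodicity holds everywhere, because the terms themselves are periodic.\<close>

definition Op :: "(real^'n \<Rightarrow> complex) \<Rightarrow> real^'n \<Rightarrow> complex" where
  "Op f x = (\<Sum>j. T j f x)"

lemma Op_measurable [measurable]: "Op f \<in> borel_measurable torus_measure"
  unfolding Op_def by measurable

lemma Op_bound:
  assumes p: "2 \<le> p"
  obtains K where "K \<ge> 0"
    "\<And>f. f \<in> Lp_torus p \<Longrightarrow> AE x in torus_measure. summable (\<lambda>j. T j f x)"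
    "\<And>f. f \<in> Lp_torus p \<Longrightarrow> (\<integral>\<^sup>+x. ennreal (norm (Op f x) powr p) \<partial>torus_measure)
       \<le> ennreal K * (\<integral>\<^sup>+x. ennreal (norm (f x) powr p) \<partial>torus_measure)"
proof -
  let ?M = "torus_measure :: (real^'n) measure"
  obtain C \<delta> where C: "C > 0" and \<delta>: "\<delta> > 0" and TC:
    "\<And>j f. L2 f \<Longrightarrow> (\<integral>\<^sup>+x. ennreal (norm (T j f x) powr p) \<partial>torus_measure)
       \<le> ennreal (C * (2 ^ j) powr (- \<delta>)) * (\<integral>\<^sup>+x. ennreal (norm (f x) powr p) \<partial>torus_measure)"
    using T_Lp[OF p] by blast
  define \<rho> where "\<rho> = 2 powr (- \<delta> / 2)"
  have "\<rho> < 2 powr 0" unfolding \<rho>_def using \<delta> by (intro powr_less_mono) auto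
  then have \<rho>: "0 < \<rho>" "\<rho> < 1" by (auto simp: \<rho>_def)
  define D where "D = (1 / (1 - 2 powr (- \<delta> / (2 * p)))) powr p"
  \<comment> \<open>Half of the decay \<delta> is spent on the weight 2^(j\<delta>/2), and the other
    half makes the integral of \<open>G f\<close> a geometric series of ratio \<rho>. Wherever
    \<open>G f x\<close> is finite it bounds every weighted term at once, as
    \<open>weighted_sum_bound\<close> requires.\<close>
  define G where "G = (\<lambda>f x. \<Sum>j. ennreal ((2 ^ j) powr (\<delta> / 2) * norm (T j f x) powr p))"
  have Gm [measurable]: "G f \<in> borel_measurable ?M" for f unfolding G_def by measurable
  have Gint: "(\<integral>\<^sup>+x. G f x \<partial>?M) \<le> ennreal (C / (1 - \<rho>)) * (\<integral>\<^sup>+x. ennreal (norm (f x) powr p) \<partial>?M)"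
    if f: "L2 f" for f
  proof -
    let ?Y = "\<integral>\<^sup>+x. ennreal (norm (f x) powr p) \<partial>?M"
    have "(\<integral>\<^sup>+x. G f x \<partial>?M) = (\<Sum>j. \<integral>\<^sup>+x. ennreal ((2 ^ j) powr (\<delta> / 2) * norm (T j f x) powr p) \<partial>?M)"
      unfolding G_def by (rule nn_integral_suminf) measurable
    also have "\<dots> \<le> (\<Sum>j. ennreal (C * \<rho> ^ j) * ?Y)"
    proof (intro suminf_le)
      fix j
      have "(\<integral>\<^sup>+x. ennreal ((2 ^ j) powr (\<delta> / 2) * norm (T j f x) powr p) \<partial>?M)
        = ennreal ((2 ^ j) powr (\<delta> / 2)) * (\<integral>\<^sup>+x. ennreal (norm (T j f x) powr p) \<partial>?M)"
        by (subst nn_integral_cmult[symmetric]) (auto simp: ennreal_mult)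
      also have "\<dots> \<le> ennreal ((2 ^ j) powr (\<delta> / 2)) * (ennreal (C * (2 ^ j) powr (- \<delta>)) * ?Y)"
        by (intro mult_left_mono TC f) simp
      also have "\<dots> = ennreal ((2 ^ j) powr (\<delta> / 2) * (C * (2 ^ j) powr (- \<delta>))) * ?Y"
        using C by (simp add: ennreal_mult mult_ac)
      also have "(2 ^ j) powr (\<delta> / 2) * (C * (2 ^ j) powr (- \<delta>)) = C * ((2 ^ j) powr (\<delta> / 2) * (2 ^ j) powr (- \<delta>))"
        by simp
      also have "(2 ^ j :: real) powr (\<delta> / 2) * (2 ^ j) powr (- \<delta>) = (2 ^ j) powr (- \<delta> / 2)"
        by (simp add: powr_add[symmetric])
      also have "(2 ^ j :: real) powr (- \<delta> / 2) = \<rho> ^ j"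
        by (simp add: \<rho>_def powr_powr powr_realpow[symmetric] mult.commute)
      finally show "(\<integral>\<^sup>+x. ennreal ((2 ^ j) powr (\<delta> / 2) * norm (T j f x) powr p) \<partial>?M) \<le> ennreal (C * \<rho> ^ j) * ?Y" .
    qed auto
    also have "\<dots> = (\<Sum>j. ennreal (C * \<rho> ^ j)) * ?Y" by simp
    also have "(\<Sum>j. ennreal (C * \<rho> ^ j)) = ennreal (\<Sum>j. C * \<rho> ^ j)"
      using C \<rho> by (intro suminf_ennreal2 summable_mult summable_geometric) auto
    also have "(\<Sum>j. C * \<rho> ^ j) = C / (1 - \<rho>)"
      using \<rho> by (subst suminf_mult) (auto simp: suminf_geometric summable_geometric)
    finally show ?thesis .
  qed
  have pt: "summable (\<lambda>j. T j f x) \<and> ennreal (norm (Op f x) powr p) \<le> ennreal D * G f x" if fin: "G f x < \<infinity>" for f x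
  proof -
    obtain g where g: "g \<ge> 0" "G f x = ennreal g" using fin by (cases "G f x") auto
    have "(2 ^ j) powr (\<delta> / 2) * norm (T j f x) powr p \<le> g" for j
    proof -
      have "ennreal ((2 ^ j) powr (\<delta> / 2) * norm (T j f x) powr p)
        = (\<Sum>j\<in>{j}. ennreal ((2 ^ j) powr (\<delta> / 2) * norm (T j f x) powr p))" by simp
      also have "\<dots> \<le> G f x" unfolding G_def by (rule sum_le_suminf) auto
      finally show ?thesis using g by simp
    qed
    from weighted_sum_bound[OF _ \<delta> g(1) this] p
    have "summable (\<lambda>j. norm (T j f x))" "norm (\<Sum>j. T j f x) powr p \<le> D * g" by (auto simp: D_def)
    moreover have "D \<ge> 0" by (simp add: D_def)
    ultimately show ?thesis using g
      by (auto simp: Op_def ennreal_mult[symmetric] intro: summable_norm_cancel ennreal_leI)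
  qed
  have AEfin: "AE x in ?M. G f x < \<infinity>" if f: "f \<in> Lp_torus p" for f
  proof -
    have "(\<integral>\<^sup>+x. ennreal (norm (f x) powr p) \<partial>?M) < \<infinity>"
      using f by (subst Lp_nn_integral) (auto simp: Lp_torus_def)
    then have "(\<integral>\<^sup>+x. G f x \<partial>?M) < \<infinity>"
      by (intro order_le_less_trans[OF Gint[OF Lp_torus_L2[OF f p]]]) (simp add: ennreal_mult_less_top)
    then show ?thesis using nn_integral_PInf_AE[OF Gm, of f] by (auto simp: less_top)
  qed
  show ?thesis
  proof (rule that[of "D * (C / (1 - \<rho>))"])
    show "0 \<le> D * (C / (1 - \<rho>))" using C \<rho> by (simp add: D_def)
    fix f :: "real^'n \<Rightarrow> complex" assume f: "f \<in> Lp_torus p"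
    show "AE x in ?M. summable (\<lambda>j. T j f x)" using AEfin[OF f] by eventually_elim (use pt in auto)
    have "(\<integral>\<^sup>+x. ennreal (norm (Op f x) powr p) \<partial>?M) \<le> (\<integral>\<^sup>+x. ennreal D * G f x \<partial>?M)"
      by (rule nn_integral_mono_AE) (use AEfin[OF f] in eventually_elim, use pt in auto)
    also have "\<dots> = ennreal D * (\<integral>\<^sup>+x. G f x \<partial>?M)" by (rule nn_integral_cmult) measurable
    also have "\<dots> \<le> ennreal D * (ennreal (C / (1 - \<rho>)) * (\<integral>\<^sup>+x. ennreal (norm (f x) powr p) \<partial>?M))"
      by (intro mult_left_mono Gint Lp_torus_L2[OF f p]) simp
    also have "\<dots> = ennreal (D * (C / (1 - \<rho>))) * (\<integral>\<^sup>+x. ennreal (norm (f x) powr p) \<partial>?M)"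
      using C \<rho> by (subst ennreal_mult) (auto simp: D_def mult.assoc)
    finally show "(\<integral>\<^sup>+x. ennreal (norm (Op f x) powr p) \<partial>?M)
       \<le> ennreal (D * (C / (1 - \<rho>))) * (\<integral>\<^sup>+x. ennreal (norm (f x) powr p) \<partial>?M)" .
  qed
qed

lemma Op_bounded_linear:
  assumes p: "2 \<le> p" and r: "0 < r" "r \<le> p"
  shows "bounded_linear_Lp p r Op"
proof -
  let ?M = "torus_measure :: (real^'n) measure"
  obtain K where K: "K \<ge> 0"
    "\<And>f. f \<in> Lp_torus p \<Longrightarrow> AE x in ?M. summable (\<lambda>j. T j f x)"
    "\<And>f. f \<in> Lp_torus p \<Longrightarrow> (\<integral>\<^sup>+x. ennreal (norm (Op f x) powr p) \<partial>?M)
       \<le> ennreal K * (\<integral>\<^sup>+x. ennreal (norm (f x) powr p) \<partial>?M)"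
    using Op_bound[OF p] by blast
  have Opp: "Op f \<in> Lp_torus p \<and> Lp_norm p (Op f) \<le> K powr (1 / p) * Lp_norm p f" if f: "f \<in> Lp_torus p" for f
  proof -
    have fi: "integrable ?M (\<lambda>x. norm (f x) powr p)" using f by (simp add: Lp_torus_def)
    have le: "(\<integral>\<^sup>+x. ennreal (norm (Op f x) powr p) \<partial>?M) \<le> ennreal (K * (LINT x|?M. norm (f x) powr p))"
      using K(3)[OF f] K(1) by (simp add: Lp_nn_integral[OF fi] ennreal_mult)
    have "integrable ?M (\<lambda>x. norm (Op f x) powr p)"
    proof (rule integrableI_bounded)
      show "(\<lambda>x. norm (Op f x) powr p) \<in> borel_measurable ?M" by measurable
      show "(\<integral>\<^sup>+x. ennreal (norm (norm (Op f x) powr p)) \<partial>?M) < \<infinity>"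
        using le by (simp add: order_le_less_trans[OF _ ennreal_less_top])
    qed
    moreover from this have "(LINT x|?M. norm (Op f x) powr p) \<le> K * (LINT x|?M. norm (f x) powr p)"
      using le K(1) Lp_nn_integral[of "Op f" p] by simp
    then have "Lp_norm p (Op f) \<le> (K * (LINT x|?M. norm (f x) powr p)) powr (1 / p)"
      unfolding Lp_norm_def using p by (intro powr_mono2) auto
    moreover have "\<dots> = K powr (1 / p) * Lp_norm p f"
      using K(1) by (simp add: Lp_norm_def powr_mult)
    moreover have "periodic (Op f)" by (simp add: periodic_def Op_def T_periodic)
    ultimately show ?thesis by (simp add: Lp_torus_def)
  qed
  have "AE x in ?M. Op (\<lambda>y. f y + g y) x = Op f x + Op g x" if fg: "f \<in> Lp_torus p" "g \<in> Lp_torus p" for f g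
    using K(2)[OF fg(1)] K(2)[OF fg(2)]
    by eventually_elim (simp add: Op_def T_add Lp_torus_L2[OF fg(1) p] Lp_torus_L2[OF fg(2) p] suminf_add)
  moreover have "AE x in ?M. Op (\<lambda>y. c * f y) x = c * Op f x" if f: "f \<in> Lp_torus p" for c f
    using K(2)[OF f] by eventually_elim (simp add: Op_def T_cmult suminf_mult)
  moreover have "Lp_norm r (Op f) \<le> (2 powr (1 / r) * K powr (1 / p)) * Lp_norm p f" if f: "f \<in> Lp_torus p" for f
  proof -
    have "Lp_norm r (Op f) \<le> 2 powr (1 / r) * Lp_norm p (Op f)"
      using Lp_torus_mono(2)[OF _ r] Opp[OF f] by blast
    also have "\<dots> \<le> 2 powr (1 / r) * (K powr (1 / p) * Lp_norm p f)"
      using Opp[OF f] by (intro mult_left_mono) auto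
    finally show ?thesis by (simp add: mult.assoc)
  qed
  moreover have "Op f \<in> Lp_torus r" if "f \<in> Lp_torus p" for f
    using Lp_torus_mono(1)[OF _ r] Opp[OF that] by blast
  ultimately show ?thesis unfolding bounded_linear_Lp_def by blast
qed

end

subsection \<open>Fourier coefficients of smooth functions\<close>

lemma smooth_torus_D:
  assumes "f \<in> smooth_torus"
  shows "periodic f" "continuous_on UNIV f" "\<And>i y. (\<lambda>t. f (y + t *\<^sub>R axis i 1)) differentiable (at 0)"
proof -
  have "periodic f" "Ck 1 f" using assms by (auto simp: smooth_torus_def)
  then show "periodic f" "continuous_on UNIV f" "\<And>i y. (\<lambda>t. f (y + t *\<^sub>R axis i 1)) differentiable (at 0)"
    by simp_all
qed

lemma partial_smooth_torus:
  assumes f: "f \<in> smooth_torus"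
  shows "partial i f \<in> smooth_torus"
proof -
  have "Ck k (partial i f)" for k
  proof -
    have "Ck (Suc k) f" using f by (auto simp: smooth_torus_def simp del: Ck.simps)
    then show ?thesis by simp
  qed
  moreover have "partial i f (x + of_lattice m) = partial i f x" for x m
  proof -
    have "f (x + of_lattice m + t *\<^sub>R axis i 1) = f (x + t *\<^sub>R axis i 1)" for t
      using smooth_torus_D(1)[OF f] unfolding periodic_def by (metis add.assoc add.commute)
    then show ?thesis by (simp add: partial_def)
  qed
  ultimately show ?thesis by (simp add: smooth_torus_def periodic_def)
qed

lemma periodic_continuous_bounded:
  fixes g :: "real^'n::finite \<Rightarrow> complex"
  assumes g: "periodic g" "continuous_on UNIV g"
  obtains B where "B \<ge> 0" "\<And>x. norm (g x) \<le> B"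
proof -
  have "compact (g ` cbox 0 1)"
    by (intro compact_continuous_image compact_cbox continuous_on_subset[OF g(2)]) auto
  then obtain B where B: "\<And>x. x \<in> cbox 0 1 \<Longrightarrow> norm (g x) \<le> B"
    using compact_imp_bounded bounded_iff by (metis imageI)
  have "norm (g x) \<le> B" for x
  proof -
    define m where "m = (\<chi> i. \<lfloor>x $ i\<rfloor>)"
    have "g x = g ((x - of_lattice m) + of_lattice m)" by simp
    also have "\<dots> = g (x - of_lattice m)" using g(1) unfolding periodic_def by blast
    finally have "g x = g (x - of_lattice m)" .
    moreover have "x - of_lattice m \<in> cbox 0 1"
      by (auto simp: mem_box_cart of_lattice_def m_def) linarith
    ultimately show ?thesis using B by simp
  qed
  moreover have "B \<ge> 0" using order_trans[OF norm_ge_zero calculation] .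
  ultimately show ?thesis using that by blast
qed

lemma norm_fourier_le:
  fixes g :: "real^'n::finite \<Rightarrow> complex"
  assumes g: "continuous_on UNIV g" and B: "\<And>x. norm (g x) \<le> B"
  shows "norm (fourier g \<xi>) \<le> B"
proof -
  have gi: "integrable torus_measure g" by (rule integrable_torus_continuous[OF g])
  have "norm (fourier g \<xi>) \<le> (LINT x|torus_measure. norm (cnj (chr \<xi> x) * g x))"
    unfolding fourier_chr by (rule integral_norm_bound)
  also have "\<dots> \<le> (LINT x|(torus_measure :: (real^'n) measure). B)"
    by (rule integral_mono) (use B gi in \<open>auto simp: norm_mult\<close>)
  finally show ?thesis by simp
qed

lemma fourier_shift:
  fixes g :: "real^'n::finite \<Rightarrow> complex"
  assumes g: "periodic g" "continuous_on UNIV g" and h: "0 \<le> h" "h \<le> 1"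
  shows "fourier (\<lambda>x. g (x + h *\<^sub>R axis i 1)) \<xi> = chr \<xi> (h *\<^sub>R axis i 1) * fourier g \<xi>"
proof -
  let ?e = "h *\<^sub>R axis i 1 :: real^'n"
  let ?u = "\<lambda>x. cnj (chr \<xi> x) * g x"
  have c: "continuous_on UNIV ?u" by (intro continuous_intros g)
  have p: "periodic ?u" using g(1) chr_periodic[of \<xi>] by (simp add: periodic_def)
  have e: "cnj (chr \<xi> x) * g (x + ?e) = chr \<xi> ?e * ?u (x + ?e)" for x
    using cnj_chr_mult[of \<xi> ?e] by (simp add: chr_add mult_ac)
  have "fourier (\<lambda>x. g (x + ?e)) \<xi> = chr \<xi> ?e * (LINT x|torus_measure. ?u (x + ?e))"
    unfolding fourier_chr e by simp
  also have "(LINT x|torus_measure. ?u (x + ?e)) = fourier g \<xi>"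
    unfolding fourier_chr by (rule torus_integral_shift[OF c p h])
  finally show ?thesis .
qed

lemma has_vector_derivative_quotient:
  assumes "(F has_vector_derivative D) (at 0)"
  shows "((\<lambda>t. (F t - F 0) /\<^sub>R t) \<longlongrightarrow> D) (at 0)"
proof -
  have "((\<lambda>t. norm (F t - F 0 - t *\<^sub>R D) / norm t) \<longlongrightarrow> 0) (at 0)"
    using assms by (simp add: has_vector_derivative_def has_derivative_iff_norm)
  moreover have "\<forall>\<^sub>F t in at 0. norm (F t - F 0 - t *\<^sub>R D) / norm t = norm ((F t - F 0) /\<^sub>R t - D)"
  proof -
    have "norm (F t - F 0 - t *\<^sub>R D) / norm t = norm ((F t - F 0) /\<^sub>R t - D)" if "t \<noteq> 0" for t
    proof -
      have "(F t - F 0) /\<^sub>R t - D = (F t - F 0 - t *\<^sub>R D) /\<^sub>R t"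
        using that by (simp add: scaleR_diff_right)
      then show ?thesis by (simp add: divide_inverse mult.commute)
    qed
    then show ?thesis by (simp add: eventually_at_filter)
  qed
  ultimately have "((\<lambda>t. norm ((F t - F 0) /\<^sub>R t - D)) \<longlongrightarrow> 0) (at 0)"
    using tendsto_cong by fastforce
  then show ?thesis by (rule LIM_zero_cancel[OF tendsto_norm_zero_cancel])
qed

text \<open>Integration by parts through difference quotients: a translation acts on Fourier
  coefficients by a character value, and the Lipschitz bound dominates the quotients. The steps
  1/(m+1) stay in (0,1], the range covered by \<open>fourier_shift\<close>.\<close>

lemma fourier_partial:
  fixes f :: "real^'n::finite \<Rightarrow> complex"
  assumes f: "f \<in> smooth_torus"
  shows "fourier (partial i f) \<xi> = \<i> * complex_of_real (2 * pi * real_of_int (\<xi> $ i)) * fourier f \<xi>"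
proof -
  let ?e = "axis i 1 :: real^'n"
  let ?M = "torus_measure :: (real^'n) measure"
  define h where "h = (\<lambda>m. inverse (real (Suc m)))"
  have h: "h m > 0" "h m \<le> 1" for m by (auto simp: h_def field_simps)
  have h0: "h \<longlonglongrightarrow> 0" unfolding h_def by (rule LIMSEQ_inverse_real_of_nat)
  have h_at: "filterlim h (at 0) sequentially"
    by (rule filterlim_atI[OF h0]) (use h in \<open>simp add: less_imp_neq[symmetric]\<close>)
  note fD = smooth_torus_D[OF f]
  note pD = smooth_torus_D[OF partial_smooth_torus[OF f]]
  obtain B where B: "B \<ge> 0" "\<And>x. norm (partial i f x) \<le> B"
    using periodic_continuous_bounded[OF pD(1,2)] by metis
  define q where "q = (\<lambda>m x. (f (x + h m *\<^sub>R ?e) - f x) /\<^sub>R h m)"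
  have fi: "integrable ?M f" by (rule integrable_torus_continuous[OF fD(2)])
  have ci: "continuous_on UNIV (\<lambda>x. f (x + h m *\<^sub>R ?e))" for m
    by (intro continuous_on_compose2[OF fD(2)] continuous_intros) auto
  have lim1: "(\<lambda>m. LINT x|?M. cnj (chr \<xi> x) * q m x) \<longlonglongrightarrow> (LINT x|?M. cnj (chr \<xi> x) * partial i f x)"
  proof (rule integral_dominated_convergence[where w = "\<lambda>x. B"])
    show "(\<lambda>x. cnj (chr \<xi> x) * partial i f x) \<in> borel_measurable ?M"
      by (intro measurable_torus_continuous continuous_intros pD)
    show "(\<lambda>x. cnj (chr \<xi> x) * q m x) \<in> borel_measurable ?M" for m
      unfolding q_def by (intro measurable_torus_continuous continuous_intros ci fD)
    have "(\<lambda>m. q m x) \<longlonglongrightarrow> partial i f x" for x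
    proof -
      have "((\<lambda>t. f (x + t *\<^sub>R ?e)) has_vector_derivative partial i f x) (at 0)"
        using fD(3) unfolding vector_derivative_works partial_def .
      then have "((\<lambda>t. (f (x + t *\<^sub>R ?e) - f x) /\<^sub>R t) \<longlongrightarrow> partial i f x) (at 0)"
        by (drule_tac has_vector_derivative_quotient) simp
      then show ?thesis
        unfolding q_def by (rule filterlim_compose[OF _ h_at])
    qed
    then show "AE x in ?M. (\<lambda>m. cnj (chr \<xi> x) * q m x) \<longlonglongrightarrow> cnj (chr \<xi> x) * partial i f x"
      by (intro AE_I2 tendsto_mult tendsto_const)
    have "norm (q m x) \<le> B" for m x
    proof -
      have "norm (f (x + h m *\<^sub>R ?e) - f x) \<le> B * \<bar>h m\<bar>" by (rule lipschitz_axis[OF fD(3) B(2)])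
      moreover have "norm (q m x) = norm (f (x + h m *\<^sub>R ?e) - f x) / h m"
        using h[of m] by (simp add: q_def divide_inverse mult.commute)
      ultimately show ?thesis using h[of m] by (simp add: pos_divide_le_eq)
    qed
    then show "AE x in ?M. norm (cnj (chr \<xi> x) * q m x) \<le> B" for m by (simp add: norm_mult)
  qed simp
  have q: "(LINT x|?M. cnj (chr \<xi> x) * q m x) = ((chr \<xi> (h m *\<^sub>R ?e) - 1) /\<^sub>R h m) * fourier f \<xi>" for m
  proof -
    have "(LINT x|?M. cnj (chr \<xi> x) * q m x)
       = (LINT x|?M. (cnj (chr \<xi> x) * f (x + h m *\<^sub>R ?e) - cnj (chr \<xi> x) * f x) /\<^sub>R h m)"
      by (simp add: q_def algebra_simps scaleR_diff_right)
    also have "\<dots> = (fourier (\<lambda>x. f (x + h m *\<^sub>R ?e)) \<xi> - fourier f \<xi>) /\<^sub>R h m"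
      unfolding fourier_chr
      by (simp add: integrable_cnj_chr integrable_torus_continuous[OF ci] fi)
    also have "\<dots> = ((chr \<xi> (h m *\<^sub>R ?e) - 1) /\<^sub>R h m) * fourier f \<xi>"
      using h[of m] by (subst fourier_shift[OF fD(1,2)]) (auto simp: algebra_simps)
    finally show ?thesis .
  qed
  have lim2: "(\<lambda>m. (chr \<xi> (h m *\<^sub>R ?e) - 1) /\<^sub>R h m) \<longlonglongrightarrow> \<i> * complex_of_real (2 * pi * real_of_int (\<xi> $ i))"
  proof -
    define c where "c = \<i> * complex_of_real (2 * pi * real_of_int (\<xi> $ i))"
    have e: "chr \<xi> (t *\<^sub>R ?e) = exp (t *\<^sub>R c)" for t
    proof -
      have "(t *\<^sub>R ?e) \<bullet> of_lattice \<xi> = t * real_of_int (\<xi> $ i)" by (simp add: inner_axis' of_lattice_def)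
      then show ?thesis unfolding chr_def c_def by (simp add: scaleR_conv_of_real mult_ac)
    qed
    have "((\<lambda>t. exp (t *\<^sub>R c)) has_vector_derivative exp (0 *\<^sub>R c) * c) (at 0)"
      by (rule exp_scaleR_has_vector_derivative_right)
    then have "((\<lambda>t. (exp (t *\<^sub>R c) - 1) /\<^sub>R t) \<longlongrightarrow> c) (at 0)"
      by (drule_tac has_vector_derivative_quotient) simp
    then show ?thesis unfolding e c_def[symmetric] by (rule filterlim_compose[OF _ h_at])
  qed
  have "(\<lambda>m. LINT x|?M. cnj (chr \<xi> x) * q m x) \<longlonglongrightarrow> \<i> * complex_of_real (2 * pi * real_of_int (\<xi> $ i)) * fourier f \<xi>"
    unfolding q by (intro tendsto_mult lim2 tendsto_const)
  from LIMSEQ_unique[OF lim1 this] show ?thesis by (simp add: fourier_chr)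
qed

lemma fourier_partial_funpow:
  assumes "f \<in> smooth_torus"
  shows "(partial i ^^ N) f \<in> smooth_torus \<and>
    fourier ((partial i ^^ N) f) \<xi> = (\<i> * complex_of_real (2 * pi * real_of_int (\<xi> $ i))) ^ N * fourier f \<xi>"
  by (induction N) (use assms in \<open>auto simp: partial_smooth_torus fourier_partial\<close>)

text \<open>The N-th pure derivative multiplies the coefficient by (2 pi i \<xi>_i)^N, and its own
  coefficients are bounded by its supremum. The factor 2 pi >= 1 is dropped.\<close>

lemma fourier_decay:
  fixes f :: "real^'n::finite \<Rightarrow> complex"
  assumes f: "f \<in> smooth_torus"
  obtains B where "B \<ge> 0" "\<And>\<xi> i. \<bar>real_of_int (\<xi> $ i)\<bar> ^ N * norm (fourier f \<xi>) \<le> B" "\<And>\<xi>. norm (fourier f \<xi>) \<le> B"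
proof -
  have "\<exists>B\<ge>0. \<forall>\<xi>. \<bar>real_of_int (\<xi> $ i)\<bar> ^ N * norm (fourier f \<xi>) \<le> B" for i :: 'n
  proof -
    let ?g = "(partial i ^^ N) f"
    have g: "?g \<in> smooth_torus" using fourier_partial_funpow[OF f] by blast
    obtain B where B: "B \<ge> 0" "\<And>x. norm (?g x) \<le> B"
      using periodic_continuous_bounded[OF smooth_torus_D(1,2)[OF g]] by metis
    have "\<bar>real_of_int (\<xi> $ i)\<bar> ^ N * norm (fourier f \<xi>) \<le> B" for \<xi>
    proof -
      have "1 * \<bar>real_of_int (\<xi> $ i)\<bar> \<le> (2 * pi) * \<bar>real_of_int (\<xi> $ i)\<bar>"
        using pi_ge_two by (intro mult_right_mono) auto
      then have "\<bar>real_of_int (\<xi> $ i)\<bar> ^ N \<le> (2 * pi * \<bar>real_of_int (\<xi> $ i)\<bar>) ^ N" by (intro power_mono) auto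
      then have "\<bar>real_of_int (\<xi> $ i)\<bar> ^ N * norm (fourier f \<xi>) \<le> (2 * pi * \<bar>real_of_int (\<xi> $ i)\<bar>) ^ N * norm (fourier f \<xi>)"
        by (intro mult_right_mono) auto
      also have "\<dots> = norm (fourier ?g \<xi>)"
        using fourier_partial_funpow[OF f, where i = i and N = N and \<xi> = \<xi>] by (simp add: norm_mult norm_power abs_mult)
      also have "\<dots> \<le> B" by (rule norm_fourier_le[OF smooth_torus_D(2)[OF g] B(2)])
      finally show ?thesis .
    qed
    then show ?thesis using B by blast
  qed
  then obtain B where B: "\<And>i::'n. B i \<ge> 0" "\<And>i \<xi>. \<bar>real_of_int (\<xi> $ i)\<bar> ^ N * norm (fourier f \<xi>) \<le> B i" by metis
  obtain B0 where B0: "B0 \<ge> 0" "\<And>x. norm (f x) \<le> B0"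
    using periodic_continuous_bounded[OF smooth_torus_D(1,2)[OF f]] by metis
  show ?thesis
  proof (rule that[of "B0 + (\<Sum>i\<in>UNIV. B i)"])
    show "0 \<le> B0 + (\<Sum>i\<in>UNIV. B i)" using B B0 by (simp add: sum_nonneg)
    show "norm (fourier f \<xi>) \<le> B0 + (\<Sum>i\<in>UNIV. B i)" for \<xi>
      using norm_fourier_le[OF smooth_torus_D(2)[OF f] B0(2), of \<xi>] B sum_nonneg[of UNIV B] by fastforce
    show "\<bar>real_of_int (\<xi> $ i)\<bar> ^ N * norm (fourier f \<xi>) \<le> B0 + (\<Sum>i\<in>UNIV. B i)" for \<xi> i
      using B(2)[of \<xi> i] member_le_sum[of i UNIV B] B(1) B0(1) by fastforce
  qed
qed

lemma lattice_box_mono: "M \<le> M' \<Longrightarrow> lattice_box M \<subseteq> lattice_box M'"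
  by (auto simp: lattice_box_def) (meson of_nat_mono order_trans neg_le_iff_le)+

text \<open>The lattice is exhausted by growing cubes. The layer outside the m-th cube has at most
  (3(m+1))^n points, and decay of order n + 2 leaves the summable bound (m+1)^(-2).\<close>

lemma fourier_summable:
  fixes f :: "real^'n::finite \<Rightarrow> complex"
  assumes f: "f \<in> smooth_torus"
  shows "(\<lambda>\<xi>. norm (fourier f \<xi>)) summable_on UNIV"
proof -
  let ?n = "CARD('n)"
  obtain B where B: "B \<ge> 0" "\<And>\<xi> i. \<bar>real_of_int (\<xi> $ i)\<bar> ^ (?n + 2) * norm (fourier f \<xi>) \<le> B"
    "\<And>\<xi>. norm (fourier f \<xi>) \<le> B" using fourier_decay[OF f, where N = "?n + 2"] by metis
  have step: "(\<Sum>\<xi>\<in>lattice_box m. norm (fourier f \<xi>)) \<le> B + (\<Sum>l<m. B * 3 ^ ?n * inverse (real (Suc l) ^ 2))" for m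
  proof (induction m)
    case 0
    have "lattice_box 0 = {0 :: int^'n}" by (auto simp: lattice_box_def vec_eq_iff)
    then show ?case using B(3) by simp
  next
    case (Suc m)
    let ?D = "lattice_box (Suc m) - lattice_box m :: (int^'n) set"
    have sub: "lattice_box m \<subseteq> (lattice_box (Suc m) :: (int^'n) set)" by (rule lattice_box_mono) simp
    have b: "norm (fourier f \<xi>) \<le> B / real (Suc m) ^ (?n + 2)" if \<xi>: "\<xi> \<in> ?D" for \<xi>
    proof -
      obtain i where "\<xi> $ i \<notin> {- int m..int m}" using \<xi> unfolding lattice_box_def by blast
      then have "\<bar>\<xi> $ i\<bar> \<ge> int (Suc m)" unfolding atLeastAtMost_iff by linarith
      then have "real (Suc m) \<le> \<bar>real_of_int (\<xi> $ i)\<bar>" by linarith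
      then have "real (Suc m) ^ (?n + 2) * norm (fourier f \<xi>) \<le> \<bar>real_of_int (\<xi> $ i)\<bar> ^ (?n + 2) * norm (fourier f \<xi>)"
        by (intro mult_right_mono power_mono) auto
      also have "\<dots> \<le> B" by (rule B(2))
      finally show ?thesis by (simp add: pos_le_divide_eq mult.commute del: power_Suc of_nat_Suc)
    qed
    have "(\<Sum>\<xi>\<in>?D. norm (fourier f \<xi>)) \<le> (\<Sum>\<xi>\<in>?D. B / real (Suc m) ^ (?n + 2))"
      by (intro sum_mono b)
    also have "\<dots> = real (card ?D) * (B / real (Suc m) ^ (?n + 2))" by simp
    also have "\<dots> \<le> (3 * real (Suc m)) ^ ?n * (B / real (Suc m) ^ (?n + 2))"
    proof (intro mult_right_mono)
      have "card ?D \<le> card (lattice_box (Suc m) :: (int^'n) set)" by (intro card_mono) auto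
      also have "\<dots> \<le> (2 * Suc m + 1) ^ ?n" by (rule card_lattice_box_le)
      also have "\<dots> \<le> (3 * Suc m) ^ ?n" by (intro power_mono) auto
      finally have "real (card ?D) \<le> real ((3 * Suc m) ^ ?n)" by (simp only: of_nat_le_iff)
      then show "real (card ?D) \<le> (3 * real (Suc m)) ^ ?n" by simp
    qed (use B in auto)
    also have "\<dots> = B * 3 ^ ?n * inverse (real (Suc m) ^ 2)"
      by (simp add: power_mult_distrib power_add field_simps power2_eq_square del: of_nat_Suc)
    finally have "(\<Sum>\<xi>\<in>?D. norm (fourier f \<xi>)) \<le> B * 3 ^ ?n * inverse (real (Suc m) ^ 2)" .
    moreover have "(\<Sum>\<xi>\<in>lattice_box (Suc m). norm (fourier f \<xi>))
       = (\<Sum>\<xi>\<in>?D. norm (fourier f \<xi>)) + (\<Sum>\<xi>\<in>lattice_box m. norm (fourier f \<xi>))"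
      by (rule sum.subset_diff[OF sub]) simp
    ultimately show ?case using Suc.IH by simp
  qed
  have s: "summable (\<lambda>l. B * 3 ^ ?n * inverse (real (Suc l) ^ 2))"
    using inverse_power_summable[of 2, where 'a = real] by (intro summable_mult) (subst summable_Suc_iff, simp)
  define Z where "Z = B + (\<Sum>l. B * 3 ^ ?n * inverse (real (Suc l) ^ 2))"
  show ?thesis
  proof (rule nonneg_bdd_above_summable_on)
    show "bdd_above (sum (\<lambda>\<xi>. norm (fourier f \<xi>)) ` {F. F \<subseteq> UNIV \<and> finite F})"
    proof (rule bdd_aboveI2)
      fix F :: "(int^'n) set" assume "F \<in> {F. F \<subseteq> UNIV \<and> finite F}"
      then have F: "finite F" by simp
      \<comment> \<open>Inserting 0 keeps the maximum meaningful for empty F.\<close>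
      define m where "m = Max (insert 0 ((\<lambda>(\<xi>, i). nat \<bar>\<xi> $ i\<bar>) ` (F \<times> UNIV)))"
      have "F \<subseteq> lattice_box m"
      proof
        fix \<xi> assume "\<xi> \<in> F"
        then have "nat \<bar>\<xi> $ i\<bar> \<le> m" for i
          unfolding m_def using F by (intro Max_ge) auto
        then have "\<bar>\<xi> $ i\<bar> \<le> int m" for i by (simp add: nat_le_iff)
        then show "\<xi> \<in> lattice_box m" unfolding lattice_box_def by (simp add: abs_le_iff) (smt (verit))
      qed
      then have "(\<Sum>\<xi>\<in>F. norm (fourier f \<xi>)) \<le> (\<Sum>\<xi>\<in>lattice_box m. norm (fourier f \<xi>))"
        by (intro sum_mono2) auto
      also have "\<dots> \<le> B + (\<Sum>l<m. B * 3 ^ ?n * inverse (real (Suc l) ^ 2))" by (rule step)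
      also have "\<dots> \<le> Z" unfolding Z_def using B by (intro add_left_mono sum_le_suminf s) auto
      finally show "(\<Sum>\<xi>\<in>F. norm (fourier f \<xi>)) \<le> Z" .
    qed
  qed simp
qed

subsection \<open>The extension agrees with the pseudo-differential operator\<close>

text \<open>The partial sums telescope to the cutoff at level J, which is at most 1 and at each
  frequency eventually equal to 1. With absolutely summable coefficients and a bounded symbol,
  dominated convergence gives equality at every x.\<close>

lemma (in symbol_pieces) Op_smooth:
  assumes f: "f \<in> smooth_torus" and C0: "\<And>x \<xi>. norm (a x \<xi>) \<le> C0"
  shows "Op f x = pseudo_diff_op a f x"
proof -
  define g where "g = (\<lambda>\<xi>. chr \<xi> x * a x \<xi> * fourier f \<xi>)"
  have "(\<lambda>\<xi>. norm (g \<xi>)) summable_on UNIV"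
  proof (rule summable_on_comparison_test)
    show "(\<lambda>\<xi>. C0 * norm (fourier f \<xi>)) summable_on UNIV"
      by (intro summable_on_cmult_right fourier_summable f)
    show "norm (g \<xi>) \<le> C0 * norm (fourier f \<xi>)" for \<xi>
      using C0 by (auto simp: g_def norm_mult intro!: mult_right_mono)
  qed simp
  \<comment> \<open>Dominated convergence is applied to integrals over \<open>count_space\<close>;
    \<open>infsetsum\<close> links these with the unordered sum \<open>infsum\<close> of the
    definition.\<close>
  then have gs: "Infinite_Set_Sum.abs_summable_on g UNIV" by (simp only: abs_summable_equivalent)
  then have gi: "integrable (count_space UNIV) g" by (simp add: Infinite_Set_Sum.abs_summable_on_def)
  have part: "(\<Sum>j\<le>J. T j f x) = (\<integral>\<xi>. complex_of_real (cutoff k J \<xi>) * g \<xi> \<partial>count_space UNIV)" for J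
  proof -
    have sub: "{\<xi> \<in> UNIV. complex_of_real (cutoff k J \<xi>) * g \<xi> \<noteq> 0} \<subseteq> freq_box J"
    proof
      fix \<xi> assume nz: "\<xi> \<in> {\<xi> \<in> UNIV. complex_of_real (cutoff k J \<xi>) * g \<xi> \<noteq> 0}"
      have "\<xi> $ i \<in> {- int (3 * k * 2 ^ J + k)..int (3 * k * 2 ^ J + k)}" for i
      proof -
        have "\<bar>\<xi> $ i\<bar> \<le> int (3 * k * 2 ^ J)"
        proof (rule ccontr)
          assume "\<not> \<bar>\<xi> $ i\<bar> \<le> int (3 * k * 2 ^ J)"
          then have "cutoff k J \<xi> = 0" by (intro cutoff_eq_0[of k J \<xi> i]) linarith
          with nz show False by simp
        qed
        then show ?thesis unfolding atLeastAtMost_iff of_nat_add by linarith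
      qed
      then show "\<xi> \<in> freq_box J" unfolding freq_box_def lattice_box_def by blast
    qed
    have "T j f x = (\<Sum>\<xi>\<in>freq_box J. complex_of_real (shell k j \<xi>) * g \<xi>)" if "j \<le> J" for j
    proof -
      have sub: "freq_box j \<subseteq> freq_box J" unfolding freq_box_def using that by (intro lattice_box_mono) simp
      have "T j f x = (\<Sum>\<xi>\<in>freq_box j. complex_of_real (shell k j \<xi>) * g \<xi>)"
        unfolding T_def piece_def g_def by (intro sum.cong refl) (simp only: mult_ac)
      also have "\<dots> = (\<Sum>\<xi>\<in>freq_box J. complex_of_real (shell k j \<xi>) * g \<xi>)"
      proof (rule sum.mono_neutral_left[OF finite_freq_box sub], rule ballI)
        fix \<xi> assume "\<xi> \<in> freq_box J - freq_box j"
        then have "\<xi> \<notin> lattice_box (3 * k * 2 ^ j + k)" by (simp add: freq_box_def)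
        from shell_differences_support[OF this, of 0 _ "\<lambda>_. 1"]
        show "complex_of_real (shell k j \<xi>) * g \<xi> = 0" by simp
      qed
      finally show ?thesis .
    qed
    then have "(\<Sum>j\<le>J. T j f x) = (\<Sum>j\<le>J. \<Sum>\<xi>\<in>freq_box J. complex_of_real (shell k j \<xi>) * g \<xi>)" by simp
    also have "\<dots> = (\<Sum>\<xi>\<in>freq_box J. \<Sum>j\<le>J. complex_of_real (shell k j \<xi>) * g \<xi>)" by (rule sum.swap)
    also have "\<dots> = (\<Sum>\<xi>\<in>freq_box J. complex_of_real (cutoff k J \<xi>) * g \<xi>)"
      by (simp flip: sum_distrib_right of_real_sum sum_shell)
    also have "\<dots> = (\<Sum>\<xi> | \<xi> \<in> UNIV \<and> complex_of_real (cutoff k J \<xi>) * g \<xi> \<noteq> 0. complex_of_real (cutoff k J \<xi>) * g \<xi>)"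
      by (rule sum.mono_neutral_right[OF finite_freq_box sub]) auto
    also have "\<dots> = (\<integral>\<xi>. complex_of_real (cutoff k J \<xi>) * g \<xi> \<partial>count_space UNIV)"
      by (rule lebesgue_integral_count_space_finite_support[symmetric]) (rule finite_subset[OF sub finite_freq_box])
    finally show ?thesis .
  qed
  have "(\<lambda>J. \<integral>\<xi>. complex_of_real (cutoff k J \<xi>) * g \<xi> \<partial>count_space UNIV) \<longlonglongrightarrow> (\<integral>\<xi>. g \<xi> \<partial>count_space UNIV)"
  proof (rule integral_dominated_convergence[where w = "\<lambda>\<xi>. norm (g \<xi>)"])
    show "integrable (count_space UNIV) (\<lambda>\<xi>. norm (g \<xi>))" using gi by (rule integrable_norm)
    have "(\<lambda>J. complex_of_real (cutoff k J \<xi>) * g \<xi>) \<longlonglongrightarrow> g \<xi>" for \<xi>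
    proof (rule tendsto_eventually)
      define m where "m = Max (range (\<lambda>i. nat \<bar>\<xi> $ i\<bar>))"
      show "\<forall>\<^sub>F J in sequentially. complex_of_real (cutoff k J \<xi>) * g \<xi> = g \<xi>"
        unfolding eventually_sequentially
      proof (intro exI allI impI)
        fix J assume J: "m \<le> J"
        have "\<bar>\<xi> $ i\<bar> \<le> int (k * 2 ^ J)" for i
        proof -
          have "nat \<bar>\<xi> $ i\<bar> \<le> m" unfolding m_def by (intro Max_ge) auto
          also have "m \<le> 2 ^ J" using J less_exp[of J] by linarith
          also have "2 ^ J \<le> k * 2 ^ J" using kpos by simp
          finally show ?thesis by (simp add: nat_le_iff)
        qed
        then show "complex_of_real (cutoff k J \<xi>) * g \<xi> = g \<xi>" by (simp add: cutoff_eq_1)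
      qed
    qed
    then show "AE \<xi> in count_space UNIV. (\<lambda>J. complex_of_real (cutoff k J \<xi>) * g \<xi>) \<longlonglongrightarrow> g \<xi>" by simp
    show "AE \<xi> in count_space UNIV. norm (complex_of_real (cutoff k J \<xi>) * g \<xi>) \<le> norm (g \<xi>)" for J
    proof (rule AE_I2)
      fix \<xi> :: "int^'n"
      have "\<bar>cutoff k J \<xi>\<bar> \<le> 1" using cutoff_bounds[of k J \<xi>] by simp
      then show "norm (complex_of_real (cutoff k J \<xi>) * g \<xi>) \<le> norm (g \<xi>)"
        unfolding norm_mult norm_of_real by (rule mult_left_le_one_le[rotated 2]) auto
    qed
  qed auto
  then have "(\<lambda>j. T j f x) sums (\<integral>\<xi>. g \<xi> \<partial>count_space UNIV)"
    unfolding sums_def_le part .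
  then have "Op f x = infsetsum g UNIV" by (simp add: Op_def sums_iff infsetsum_def)
  also have "\<dots> = infsum g UNIV" by (rule infsetsum_infsum[OF gs])
  finally show ?thesis by (simp add: pseudo_diff_op_def g_def chr_def)
qed

theorem mainTheorem4:
  fixes a :: "real ^ 'n::finite \<Rightarrow> int ^ 'n \<Rightarrow> complex"
    and p q r \<epsilon> :: real
    and k :: nat
    and C C' :: "('n \<Rightarrow> nat) \<Rightarrow> real"
  assumes "2 \<le> p" and "0 < \<epsilon>" and "\<epsilon> < 1"
    and "k = CARD('n) div 2 + 1"
    and "\<And>\<xi>. periodic (\<lambda>x. a x \<xi>)"
    and "\<And>\<xi>. Ck k (\<lambda>x. a x \<xi>)"
    and "\<And>\<alpha> x \<xi>. mi_order \<alpha> \<le> k \<Longrightarrow>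
           norm (differences \<alpha> (a x) \<xi>)
             \<le> C \<alpha> * jbracket \<xi> powr (- (real CARD('n) / 2) * \<epsilon> - (1 - \<epsilon>) * real (mi_order \<alpha>))"
    and "\<And>\<beta> x \<xi>. mi_order \<beta> \<le> k \<Longrightarrow>
           norm (partials \<beta> (\<lambda>y. a y \<xi>) x)
             \<le> C' \<beta> * jbracket \<xi> powr (- (real CARD('n) / 2) * \<epsilon>)"
    and "1 / p + 1 / q = 1"
    and "1 < q" and "q \<le> r" and "r \<le> p"
  shows "extends_to_bounded_Lp p r (pseudo_diff_op a)"
proof -
  define n where "n = real CARD('n)"
  define \<mu> where "\<mu> = n / 2 * \<epsilon>"
  have \<mu>: "0 \<le> \<mu>" using assms(2) by (simp add: \<mu>_def n_def)
  have kpos: "k > 0" by (simp add: assms(4))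
  \<comment> \<open>\<open>Ck\<close> reveals differentiability along the axes only at a
    successor.\<close>
  then obtain k' where k': "k = Suc k'" by (cases k) auto
  define single where "single = (\<lambda>(i::'n) (l::nat). (\<lambda>j. if j = i then l else 0))"
  \<comment> \<open>The given constants depend on the multi-index. Finitely many single-coordinate
    ones occur, and the absolute values make their sum an upper bound whatever the signs of
    \<open>C\<close>.\<close>
  define C0 where "C0 = (\<Sum>i\<in>UNIV. \<Sum>l\<le>k. \<bar>C (single i l)\<bar>)"
  define L0 where "L0 = (\<Sum>i\<in>UNIV. \<bar>C' (single i 1)\<bar>)"
  have C0: "0 \<le> C0" and L0: "0 \<le> L0" by (simp_all add: C0_def L0_def sum_nonneg)
  have dif: "norm ((difference i ^^ l) (a x) \<xi>) \<le> C0 * jbracket \<xi> powr (- \<mu> - (1 - \<epsilon>) * real l)" if l: "l \<le> k" for i l x \<xi>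
  proof -
    have "norm ((difference i ^^ l) (a x) \<xi>) \<le> C (single i l) * jbracket \<xi> powr (- \<mu> - (1 - \<epsilon>) * real l)"
      using assms(7)[of "single i l" x \<xi>] l
      by (simp add: single_def differences_single mi_order_single \<mu>_def n_def)
    also have "\<dots> \<le> C0 * jbracket \<xi> powr (- \<mu> - (1 - \<epsilon>) * real l)"
    proof (intro mult_right_mono)
      have "\<bar>C (single i l)\<bar> \<le> (\<Sum>l\<le>k. \<bar>C (single i l)\<bar>)" using l by (intro member_le_sum) auto
      also have "\<dots> \<le> C0" unfolding C0_def
        by (rule member_le_sum[where f = "\<lambda>i. \<Sum>l\<le>k. \<bar>C (single i l)\<bar>"]) (auto simp: sum_nonneg)
      finally show "C (single i l) \<le> C0" by simp
    qed simp
    finally show ?thesis .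
  qed
  have lip: "norm (a x \<xi> - a y \<xi>) \<le> L0 * jbracket \<xi> powr (- \<mu>) * (\<Sum>i\<in>UNIV. \<bar>x $ i - y $ i\<bar>)" for x y \<xi>
  proof (rule lipschitz_coordinates)
    fix i y
    show "(\<lambda>t. a (y + t *\<^sub>R axis i 1) \<xi>) differentiable at 0"
      using assms(6)[of \<xi>] unfolding k' by simp
    have "norm (partial i (\<lambda>y. a y \<xi>) y) \<le> C' (single i 1) * jbracket \<xi> powr (- \<mu>)"
      using assms(8)[of "single i 1" \<xi> y] kpos partials_single[of i "Suc 0"] mi_order_single[of i "Suc 0"]
      by (simp add: single_def \<mu>_def n_def)
    also have "\<dots> \<le> L0 * jbracket \<xi> powr (- \<mu>)"
    proof (intro mult_right_mono)
      have "\<bar>C' (single i 1)\<bar> \<le> L0" unfolding L0_def by (rule member_le_sum) auto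
      then show "C' (single i 1) \<le> L0" by simp
    qed simp
    finally show "norm (partial i (\<lambda>y. a y \<xi>) y) \<le> L0 * jbracket \<xi> powr (- \<mu>)" .
  qed
  \<comment> \<open>One constant for the whole interface: 8^k covers the Leibniz loss in all orders
    up to k, and the second summand is the Lipschitz constant of the pieces.\<close>
  define A where "A = C0 * 4 powr \<mu> * 2 * 8 ^ k + L0 * 4 powr \<mu>"
  have AC: "C0 * 4 powr \<mu> * 2 * 8 ^ l \<le> A" if "l \<le> k" for l
  proof -
    have "C0 * 4 powr \<mu> * 2 * 8 ^ l \<le> C0 * 4 powr \<mu> * 2 * 8 ^ k"
      using C0 that by (intro mult_left_mono power_increasing) auto
    then show ?thesis using L0 by (simp add: A_def add_increasing2)
  qed
  have AL: "L0 * 4 powr \<mu> \<le> A" using C0 by (simp add: A_def)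
  have pd: "norm ((difference i ^^ l) (piece k a j x) \<xi>) \<le> A * (2 ^ j) powr (- \<mu> - (1 - \<epsilon>) * real l)" if l: "l \<le> k" for i j l x \<xi>
    by (rule order_trans[OF norm_differences_piece_le[OF kpos assms(2,3) C0 \<mu> dif l] mult_right_mono[OF AC[OF l]]]) auto
  interpret symbol_pieces a \<epsilon> A n k
  proof
    show "n = real CARD('n)" by (simp add: n_def)
    show "0 \<le> A" using order_trans[OF _ AL] L0 by simp
    show "continuous_on UNIV (\<lambda>x. a x \<xi>)" for \<xi> using assms(6)[of \<xi>] unfolding k' by simp
    show "norm (piece k a j x \<xi>) \<le> A * (2 ^ j) powr (- (n / 2 * \<epsilon>))" for j x \<xi>
      using pd[of 0] by (simp add: \<mu>_def)
    show "norm ((difference i ^^ k) (piece k a j x) \<xi>) \<le> A * (2 ^ j) powr (- (n / 2 * \<epsilon>) - (1 - \<epsilon>) * real k)" for i j x \<xi>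
      using pd[of k] by (simp add: \<mu>_def)
    show "norm (piece k a j x \<xi> - piece k a j y \<xi>) \<le> A * (2 ^ j) powr (- (n / 2 * \<epsilon>)) * (\<Sum>i\<in>UNIV. \<bar>x $ i - y $ i\<bar>)" for j x y \<xi>
      unfolding \<mu>_def[symmetric]
      by (rule order_trans[OF piece_lipschitz[OF kpos L0 \<mu> lip]])
        (use AL in \<open>intro mult_right_mono, auto simp: sum_nonneg\<close>)
  qed (use assms in auto)
  have "norm (a x \<xi>) \<le> C0" for x \<xi>
  proof -
    have "norm (a x \<xi>) \<le> C0 * jbracket \<xi> powr (- \<mu>)" using dif[of 0] by simp
    also have "\<dots> \<le> C0 * 1"
      using C0 \<mu> jbracket_ge_1[of \<xi>] powr_mono[of "- \<mu>" 0 "jbracket \<xi>"] by (intro mult_left_mono) auto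
    finally show ?thesis by simp
  qed
  then have "Op f x = pseudo_diff_op a f x" if "f \<in> smooth_torus" for f x
    using that by (rule Op_smooth[rotated])
  moreover have "bounded_linear_Lp p r Op"
    using assms by (intro Op_bounded_linear) auto
  ultimately show ?thesis unfolding extends_to_bounded_Lp_def by auto
qed

end
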